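(* Let $\phi:(A,\alpha)\to(B,\beta)$ be a morphism of monoidal Hom-algebras, and let $(\mathcal{C},\chi)$ be an $(A,\alpha)$-Hom-coring with comultiplication $c\mapsto c_1\otimes_A c_2$ and counit $\varepsilon_{\mathcal{C}}$. Regard $(B,\beta)$ as an $(A,\alpha)$-Hom-bimodule along $\phi$. Then $$(B\mathcal{C})B=\big((B\otimes_A\mathcal{C})\otimes_A B,\ (\beta\otimes\chi)\otimes\beta\big)$$ is a $(B,\beta)$-Hom-coring (called a base ring extension of the $(A,\alpha)$-Hom-coring $(\mathcal{C},\chi)$) with comultiplication and counit $$\Delta_{(B\mathcal{C})B}((b\otimes_A c)\otimes_A b')=((\beta^{-1}(b)\otimes_A c_1)\otimes_A 1_B)\otimes_B((1_B\otimes_A c_2)\otimes_A\beta^{-1}(b')),$$ $$\varepsilon_{(B\mathcal{C})B}((b\otimes_A c)\otimes_A b')=(b\,\phi(\varepsilon_{\mathcal{C}}(c)))\,b',$$ for $b,b'\in B$, $c\in\mathcal{C}$.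
   Context: $k$ is a commutative ring with unit; unadorned $\otimes$ is over $k$. The category $\widetilde{\mathcal{H}}(\mathcal{M}_k)$ has as objects pairs $(M,\mu)$ with $M$ a $k$-module and $\mu$ a $k$-linear automorphism of $M$; morphisms $(M,\mu)\to(N,\nu)$ are $k$-linear maps $f$ with $\nu\circ f=f\circ\mu$; $(M,\mu)\otimes(N,\nu)=(M\otimes N,\mu\otimes\nu)$. A monoidal Hom-algebra $(A,\alpha)$ is an object of $\widetilde{\mathcal{H}}(\mathcal{M}_k)$ with a $k$-linear multiplication $a\otimes b\mapsto ab$ and an element $1_A$ such that $\alpha(a)(bc)=(ab)\alpha(c)$, $a1_A=1_Aa=\alpha(a)$, $\alpha(ab)=\alpha(a)\alpha(b)$, $\alpha(1_A)=1_A$. A morphism of monoidal Hom-algebras is a morphism in $\widetilde{\mathcal{H}}(\mathcal{M}_k)$ that preserves multiplication and unit. A right $(A,\alpha)$-Hom-module is an object $(M,\mu)$ with a $k$-linear map $m\otimes a\mapsto ma$ such that $\mu(m)(ab)=(ma)\alpha(b)$, $m1_A=\mu(m)$, $\mu(ma)=\mu(m)\alpha(a)$. A left one satisfies $\alpha(a)(bm)=(ab)\mu(m)$, $1_Am=\mu(m)$, $\mu(am)=\alpha(a)\mu(m)$. An $[(A,\alpha),(B,\beta)]$-Hom-bimodule is a left $(A,\alpha)$- and right $(B,\beta)$-Hom-module $(M,\mu)$ with $(am)\beta(b)=\alpha(a)(mb)$; an $(A,\alpha)$-Hom-bimodule is the case $(B,\beta)=(A,\alpha)$. Linear maps are morphisms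 in $\widetilde{\mathcal{H}}(\mathcal{M}_k)$ commuting with the actions; bilinear means left and right linear. $(A,\alpha)$ is a Hom-bimodule over itself by multiplication; along a morphism $\phi:(A,\alpha)\to(B,\beta)$, $(B,\beta)$ is an $(A,\alpha)$-Hom-bimodule with $a\cdot b=\phi(a)b$, $b\cdot a=b\phi(a)$. For a right $(A,\alpha)$-Hom-module $(M,\mu)$ and a left $(A,\alpha)$-Hom-module $(N,\nu)$, $M\otimes_AN$ is the quotient of $M\otimes N$ by the relations $ma\otimes n=\mu(m)\otimes a\nu^{-1}(n)$, with automorphism $\mu\otimes\nu$. If $M$ carries a compatible left action of a monoidal Hom-algebra $(B,\beta)$ and $N$ a compatible right action, then $b(m\otimes_A n)=\beta^{-1}(b)m\otimes_A\nu(n)$ and $(m\otimes_An)b=\mu(m)\otimes_An\beta^{-1}(b)$. In particular the $(B,\beta)$-Hom-bimodule structure of $(B\otimes_A\mathcal{C})\otimes_AB$ is $b((b'\otimes_Ac)\otimes_Ab'')=(\beta^{-2}(b)b'\otimes_A\chi(c))\otimes_A\beta(b'')$ and $((b'\otimes_Ac)\otimes_Ab'')b=(\beta(b')\otimes_A\chi(c))\otimes_Ab''\beta^{-1}(b)$. An $(A,\alpha)$-Hom-coring is an $(A,\alpha)$-Hom-bimodule $(\mathcal{C},\chi)$ with $(A,\alpha)$-bilinear maps $\Delta_{\mathcal{C}}:\mathcal{C}\to\mathcal{C}\otimes_A\mathcal{C}$, $c\mapsto c_1\otimes_Ac_2$ (summation understood), and $\varepsilon_{\mathcal{C}}:\mathcal{C}\to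 A$, such that in $\mathcal{C}\otimes_A(\mathcal{C}\otimes_A\mathcal{C})$ $$c_1\otimes_A\Delta_{\mathcal{C}}(c_2)=\chi(c_{11})\otimes_A(c_{12}\otimes_A\chi^{-1}(c_2)),$$ and $\varepsilon_{\mathcal{C}}(c_1)c_2=c=c_1\varepsilon_{\mathcal{C}}(c_2)$, $\Delta_{\mathcal{C}}(\chi(c))=\chi(c_1)\otimes_A\chi(c_2)$, $\varepsilon_{\mathcal{C}}(\chi(c))=\alpha(\varepsilon_{\mathcal{C}}(c))$. *)

theory Defs
  imports "HOL-Algebra.Module" "HOL-Algebra.AbelCoset"
begin

section \<open>Linear maps, quotients, free modules, tensor products over the ground ring\<close>

definition linear_maps ::
  "('k, 'r) ring_scheme \<Rightarrow> ('k, 'm, 'x) module_scheme \<Rightarrow> ('k, 'n, 'y) module_scheme \<Rightarrow> ('m \<Rightarrow> 'n) set"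
  where "linear_maps R M N =
    {f \<in> hom (add_monoid M) (add_monoid N).
      \<forall>r \<in> carrier R. \<forall>m \<in> carrier M. f (r \<odot>\<^bsub>M\<^esub> m) = r \<odot>\<^bsub>N\<^esub> f m}"

definition bilinear_maps ::
  "('k, 'r) ring_scheme \<Rightarrow> ('k, 'm, 'x) module_scheme \<Rightarrow> ('k, 'n, 'y) module_scheme
    \<Rightarrow> ('k, 'p, 'z) module_scheme \<Rightarrow> ('m \<Rightarrow> 'n \<Rightarrow> 'p) set"
  where "bilinear_maps R M N P =
    {f. (\<forall>m \<in> carrier M. f m \<in> linear_maps R N P) \<and>
        (\<forall>n \<in> carrier N. (\<lambda>m. f m n) \<in> linear_maps R M P)}"

definition module_span ::
  "('k, 'r) ring_scheme \<Rightarrow> ('k, 'm, 'x) module_scheme \<Rightarrow> 'm set \<Rightarrow> 'm set"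
  where "module_span R M X = \<Inter> {H. submodule H R M \<and> X \<subseteq> H}"

text \<open>The multiplicative fields of the record type \<^type>\<open>module_ext\<close> carry no information
  for a plain module; they are left undefined in the constructions below.\<close>

definition quotient_module ::
  "('k, 'm, 'x) module_scheme \<Rightarrow> 'm set \<Rightarrow> ('k, 'm set) module"
  where "quotient_module M H =
    \<lparr>carrier = a_rcosets\<^bsub>M\<^esub> H, mult = undefined, one = undefined,
     zero = H, add = set_add M,
     smult = (\<lambda>r X. \<Union>x\<in>X. H +>\<^bsub>M\<^esub> (r \<odot>\<^bsub>M\<^esub> x))\<rparr>"

definition free_module :: "('k, 'r) ring_scheme \<Rightarrow> 's set \<Rightarrow> ('k, 's \<Rightarrow> 'k) module"
  where "free_module R S =
    \<lparr>carrier = {p. (\<forall>s \<in> S. p s \<in> carrier R) \<and> (\<forall>s. s \<notin> S \<longrightarrow> p s = \<zero>\<^bsub>R\<^esub>)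
                  \<and> finite {s. p s \<noteq> \<zero>\<^bsub>R\<^esub>}},
     mult = undefined, one = undefined,
     zero = (\<lambda>s. \<zero>\<^bsub>R\<^esub>), add = (\<lambda>p q s. p s \<oplus>\<^bsub>R\<^esub> q s),
     smult = (\<lambda>r p s. r \<otimes>\<^bsub>R\<^esub> p s)\<rparr>"

definition free_gen :: "('k, 'r) ring_scheme \<Rightarrow> 's \<Rightarrow> 's \<Rightarrow> 'k"
  where "free_gen R s = (\<lambda>t. if t = s then \<one>\<^bsub>R\<^esub> else \<zero>\<^bsub>R\<^esub>)"

definition tensor_relations ::
  "('k, 'r) ring_scheme \<Rightarrow> ('k, 'm, 'x) module_scheme \<Rightarrow> ('k, 'n, 'y) module_scheme
    \<Rightarrow> ('m \<times> 'n \<Rightarrow> 'k) set"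
  where "tensor_relations R M N =
    (let F = free_module R (carrier M \<times> carrier N); g = (\<lambda>m n. free_gen R (m, n)) in
      {g (m \<oplus>\<^bsub>M\<^esub> m') n \<ominus>\<^bsub>F\<^esub> (g m n \<oplus>\<^bsub>F\<^esub> g m' n) | m m' n.
        m \<in> carrier M \<and> m' \<in> carrier M \<and> n \<in> carrier N} \<union>
      {g m (n \<oplus>\<^bsub>N\<^esub> n') \<ominus>\<^bsub>F\<^esub> (g m n \<oplus>\<^bsub>F\<^esub> g m n') | m n n'.
        m \<in> carrier M \<and> n \<in> carrier N \<and> n' \<in> carrier N} \<union>
      {g (r \<odot>\<^bsub>M\<^esub> m) n \<ominus>\<^bsub>F\<^esub> (r \<odot>\<^bsub>F\<^esub> g m n) | r m n.
        r \<in> carrier R \<and> m \<in> carrier M \<and> n \<in> carrier N} \<union>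
      {g m (r \<odot>\<^bsub>N\<^esub> n) \<ominus>\<^bsub>F\<^esub> (r \<odot>\<^bsub>F\<^esub> g m n) | r m n.
        r \<in> carrier R \<and> m \<in> carrier M \<and> n \<in> carrier N})"

definition tensor_kernel ::
  "('k, 'r) ring_scheme \<Rightarrow> ('k, 'm, 'x) module_scheme \<Rightarrow> ('k, 'n, 'y) module_scheme
    \<Rightarrow> ('m \<times> 'n \<Rightarrow> 'k) set"
  where "tensor_kernel R M N =
    module_span R (free_module R (carrier M \<times> carrier N)) (tensor_relations R M N)"

definition tensor ::
  "('k, 'r) ring_scheme \<Rightarrow> ('k, 'm, 'x) module_scheme \<Rightarrow> ('k, 'n, 'y) module_scheme
    \<Rightarrow> ('k, ('m \<times> 'n \<Rightarrow> 'k) set) module"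
  where "tensor R M N =
    quotient_module (free_module R (carrier M \<times> carrier N)) (tensor_kernel R M N)"

definition pure ::
  "('k, 'r) ring_scheme \<Rightarrow> ('k, 'm, 'x) module_scheme \<Rightarrow> ('k, 'n, 'y) module_scheme
    \<Rightarrow> 'm \<Rightarrow> 'n \<Rightarrow> ('m \<times> 'n \<Rightarrow> 'k) set"
  where "pure R M N m n =
    tensor_kernel R M N +>\<^bsub>free_module R (carrier M \<times> carrier N)\<^esub> free_gen R (m, n)"

text \<open>The map on a tensor product induced by a bilinear map \<open>f\<close> into \<open>P\<close>: extend \<open>f\<close> linearly
  to the free module; the extension is constant on each coset, and \<^const>\<open>the_elem\<close> picks its
  value there.\<close>

definition tensor_lift ::
  "('k, 'r) ring_scheme \<Rightarrow> ('k, 'p, 'z) module_scheme \<Rightarrow> ('m \<Rightarrow> 'n \<Rightarrow> 'p)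
    \<Rightarrow> ('m \<times> 'n \<Rightarrow> 'k) set \<Rightarrow> 'p"
  where "tensor_lift R P f X =
    the_elem ((\<lambda>p. \<Oplus>\<^bsub>P\<^esub>s\<in>{s. p s \<noteq> \<zero>\<^bsub>R\<^esub>}. p s \<odot>\<^bsub>P\<^esub> f (fst s) (snd s)) ` X)"


section \<open>Objects with an automorphism, monoidal Hom-algebras, Hom-modules\<close>

record ('k, 'm) hom_mod = "('k, 'm) module" +
  twist :: "'m \<Rightarrow> 'm"

definition inv_twist :: "('k, 'm, 'x) hom_mod_scheme \<Rightarrow> 'm \<Rightarrow> 'm"
  where "inv_twist M = inv_into (carrier M) (twist M)"

locale hom_object = module R M
  for R :: "('k, 'r) ring_scheme" and M :: "('k, 'm, 'x) hom_mod_scheme" +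
  assumes twist_linear: "twist M \<in> linear_maps R M M"
    and twist_bij: "bij_betw (twist M) (carrier M) (carrier M)"

definition hom_morphisms ::
  "('k, 'r) ring_scheme \<Rightarrow> ('k, 'm, 'x) hom_mod_scheme \<Rightarrow> ('k, 'n, 'y) hom_mod_scheme \<Rightarrow> ('m \<Rightarrow> 'n) set"
  where "hom_morphisms R M N =
    {f \<in> linear_maps R M N. \<forall>m \<in> carrier M. twist N (f m) = f (twist M m)}"

text \<open>Multiplication and unit of a monoidal Hom-algebra are the \<^const>\<open>mult\<close> and
  \<^const>\<open>one\<close> fields of the record.\<close>

locale hom_algebra = hom_object R A
  for R :: "('k, 'r) ring_scheme" and A :: "('k, 'a, 'x) hom_mod_scheme" +
  assumes mult_bilinear: "(\<lambda>a b. a \<otimes>\<^bsub>A\<^esub> b) \<in> bilinear_maps R A A A"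
    and unit_closed: "\<one>\<^bsub>A\<^esub> \<in> carrier A"
    and hom_assoc: "\<lbrakk>a \<in> carrier A; b \<in> carrier A; c \<in> carrier A\<rbrakk> \<Longrightarrow>
      twist A a \<otimes>\<^bsub>A\<^esub> (b \<otimes>\<^bsub>A\<^esub> c) = (a \<otimes>\<^bsub>A\<^esub> b) \<otimes>\<^bsub>A\<^esub> twist A c"
    and hom_unit_right: "a \<in> carrier A \<Longrightarrow> a \<otimes>\<^bsub>A\<^esub> \<one>\<^bsub>A\<^esub> = twist A a"
    and hom_unit_left: "a \<in> carrier A \<Longrightarrow> \<one>\<^bsub>A\<^esub> \<otimes>\<^bsub>A\<^esub> a = twist A a"
    and twist_mult: "\<lbrakk>a \<in> carrier A; b \<in> carrier A\<rbrakk> \<Longrightarrow>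
      twist A (a \<otimes>\<^bsub>A\<^esub> b) = twist A a \<otimes>\<^bsub>A\<^esub> twist A b"
    and twist_unit: "twist A \<one>\<^bsub>A\<^esub> = \<one>\<^bsub>A\<^esub>"

definition hom_algebra_morphisms ::
  "('k, 'r) ring_scheme \<Rightarrow> ('k, 'a, 'x) hom_mod_scheme \<Rightarrow> ('k, 'b, 'y) hom_mod_scheme \<Rightarrow> ('a \<Rightarrow> 'b) set"
  where "hom_algebra_morphisms R A B =
    {f \<in> hom_morphisms R A B.
      (\<forall>a \<in> carrier A. \<forall>a' \<in> carrier A. f (a \<otimes>\<^bsub>A\<^esub> a') = f a \<otimes>\<^bsub>B\<^esub> f a') \<and> f \<one>\<^bsub>A\<^esub> = \<one>\<^bsub>B\<^esub>}"

record ('k, 'm, 'a, 'b) hom_bimod = "('k, 'm) hom_mod" +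
  lact :: "'a \<Rightarrow> 'm \<Rightarrow> 'm"  (infixr \<open>\<triangleright>\<index>\<close> 75)
  ract :: "'m \<Rightarrow> 'b \<Rightarrow> 'm"  (infixl \<open>\<triangleleft>\<index>\<close> 75)

locale left_hom_module = A: hom_algebra R A + M: hom_object R M
  for R :: "('k, 'r) ring_scheme" and A :: "('k, 'a, 'x) hom_mod_scheme"
    and M :: "('k, 'm, 'a, 'b, 'z) hom_bimod_scheme" +
  assumes lact_bilinear: "(\<lambda>a m. a \<triangleright>\<^bsub>M\<^esub> m) \<in> bilinear_maps R A M M"
    and lact_assoc: "\<lbrakk>a \<in> carrier A; b \<in> carrier A; m \<in> carrier M\<rbrakk> \<Longrightarrow>
      twist A a \<triangleright>\<^bsub>M\<^esub> (b \<triangleright>\<^bsub>M\<^esub> m) = (a \<otimes>\<^bsub>A\<^esub> b) \<triangleright>\<^bsub>M\<^esub> twist M m"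
    and lact_unit: "m \<in> carrier M \<Longrightarrow> \<one>\<^bsub>A\<^esub> \<triangleright>\<^bsub>M\<^esub> m = twist M m"
    and twist_lact: "\<lbrakk>a \<in> carrier A; m \<in> carrier M\<rbrakk> \<Longrightarrow>
      twist M (a \<triangleright>\<^bsub>M\<^esub> m) = twist A a \<triangleright>\<^bsub>M\<^esub> twist M m"

locale right_hom_module = B: hom_algebra R B + M: hom_object R M
  for R :: "('k, 'r) ring_scheme" and B :: "('k, 'b, 'y) hom_mod_scheme"
    and M :: "('k, 'm, 'a, 'b, 'z) hom_bimod_scheme" +
  assumes ract_bilinear: "(\<lambda>m b. m \<triangleleft>\<^bsub>M\<^esub> b) \<in> bilinear_maps R M B M"
    and ract_assoc: "\<lbrakk>m \<in> carrier M; a \<in> carrier B; b \<in> carrier B\<rbrakk> \<Longrightarrow>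
      twist M m \<triangleleft>\<^bsub>M\<^esub> (a \<otimes>\<^bsub>B\<^esub> b) = (m \<triangleleft>\<^bsub>M\<^esub> a) \<triangleleft>\<^bsub>M\<^esub> twist B b"
    and ract_unit: "m \<in> carrier M \<Longrightarrow> m \<triangleleft>\<^bsub>M\<^esub> \<one>\<^bsub>B\<^esub> = twist M m"
    and twist_ract: "\<lbrakk>m \<in> carrier M; b \<in> carrier B\<rbrakk> \<Longrightarrow>
      twist M (m \<triangleleft>\<^bsub>M\<^esub> b) = twist M m \<triangleleft>\<^bsub>M\<^esub> twist B b"

locale hom_bimodule = left_hom_module R A M + right_hom_module R B M
  for R :: "('k, 'r) ring_scheme" and A :: "('k, 'a, 'x) hom_mod_scheme"
    and B :: "('k, 'b, 'y) hom_mod_scheme" and M :: "('k, 'm, 'a, 'b, 'z) hom_bimod_scheme" +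
  assumes lact_ract: "\<lbrakk>a \<in> carrier A; m \<in> carrier M; b \<in> carrier B\<rbrakk> \<Longrightarrow>
      (a \<triangleright>\<^bsub>M\<^esub> m) \<triangleleft>\<^bsub>M\<^esub> twist B b = twist A a \<triangleright>\<^bsub>M\<^esub> (m \<triangleleft>\<^bsub>M\<^esub> b)"

definition bimodule_maps ::
  "('k, 'r) ring_scheme \<Rightarrow> ('k, 'a, 'x) hom_mod_scheme \<Rightarrow> ('k, 'b, 'y) hom_mod_scheme
    \<Rightarrow> ('k, 'm, 'a, 'b, 'z) hom_bimod_scheme \<Rightarrow> ('k, 'n, 'a, 'b, 'w) hom_bimod_scheme
    \<Rightarrow> ('m \<Rightarrow> 'n) set"
  where "bimodule_maps R A B M N =
    {f \<in> hom_morphisms R M N.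
      (\<forall>a \<in> carrier A. \<forall>m \<in> carrier M. f (a \<triangleright>\<^bsub>M\<^esub> m) = a \<triangleright>\<^bsub>N\<^esub> f m) \<and>
      (\<forall>m \<in> carrier M. \<forall>b \<in> carrier B. f (m \<triangleleft>\<^bsub>M\<^esub> b) = f m \<triangleleft>\<^bsub>N\<^esub> b)}"

text \<open>\<open>B\<close> as a bimodule along two morphisms into \<open>B\<close>, with \<open>a \<cdot> b = f(a)b\<close> and
  \<open>b \<cdot> c = bg(c)\<close>; with \<open>f = id\<close> or \<open>g = id\<close> the action on that side is multiplication.\<close>

definition bimodule_along ::
  "('a \<Rightarrow> 'b) \<Rightarrow> ('c \<Rightarrow> 'b) \<Rightarrow> ('k, 'b, 'x) hom_mod_scheme \<Rightarrow> ('k, 'b, 'a, 'c) hom_bimod"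
  where "bimodule_along f g B =
    \<lparr>carrier = carrier B, mult = (\<otimes>\<^bsub>B\<^esub>), one = \<one>\<^bsub>B\<^esub>,
     zero = \<zero>\<^bsub>B\<^esub>, add = (\<oplus>\<^bsub>B\<^esub>), smult = (\<odot>\<^bsub>B\<^esub>), twist = twist B,
     lact = (\<lambda>a b. f a \<otimes>\<^bsub>B\<^esub> b), ract = (\<lambda>b c. b \<otimes>\<^bsub>B\<^esub> g c)\<rparr>"


section \<open>Tensor products over a monoidal Hom-algebra\<close>

definition balancing_kernel ::
  "('k, 'r) ring_scheme \<Rightarrow> ('k, 'a, 'x) hom_mod_scheme \<Rightarrow> ('k, 'm, 'b, 'a, 'y) hom_bimod_scheme
    \<Rightarrow> ('k, 'n, 'a, 'c, 'z) hom_bimod_scheme \<Rightarrow> ('m \<times> 'n \<Rightarrow> 'k) set set"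
  where "balancing_kernel R A M N =
    module_span R (tensor R M N)
      {pure R M N (m \<triangleleft>\<^bsub>M\<^esub> a) n \<ominus>\<^bsub>tensor R M N\<^esub> pure R M N (twist M m) (a \<triangleright>\<^bsub>N\<^esub> inv_twist N n) | m a n.
        m \<in> carrier M \<and> a \<in> carrier A \<and> n \<in> carrier N}"

definition hom_pure ::
  "('k, 'r) ring_scheme \<Rightarrow> ('k, 'a, 'x) hom_mod_scheme \<Rightarrow> ('k, 'm, 'b, 'a, 'y) hom_bimod_scheme
    \<Rightarrow> ('k, 'n, 'a, 'c, 'z) hom_bimod_scheme \<Rightarrow> 'm \<Rightarrow> 'n \<Rightarrow> ('m \<times> 'n \<Rightarrow> 'k) set set"
  where "hom_pure R A M N m n = balancing_kernel R A M N +>\<^bsub>tensor R M N\<^esub> pure R M N m n"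

definition hom_tensor_lift ::
  "('k, 'r) ring_scheme \<Rightarrow> ('k, 'p, 'z) module_scheme \<Rightarrow> ('m \<Rightarrow> 'n \<Rightarrow> 'p)
    \<Rightarrow> ('m \<times> 'n \<Rightarrow> 'k) set set \<Rightarrow> 'p"
  where "hom_tensor_lift R P f X = the_elem (tensor_lift R P f ` X)"

text \<open>\<open>hom_tensor R B A D M N\<close> is \<open>M \<otimes>\<^sub>A N\<close> for a \<open>[B, A]\<close>-bimodule \<open>M\<close> and an
  \<open>[A, D]\<close>-bimodule \<open>N\<close>; the algebras \<open>B\<close> and \<open>D\<close> enter only through the inverse automorphisms
  in the two outer actions.\<close>

definition hom_tensor ::
  "('k, 'r) ring_scheme \<Rightarrow> ('k, 'b, 'u) hom_mod_scheme \<Rightarrow> ('k, 'a, 'v) hom_mod_scheme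
    \<Rightarrow> ('k, 'd, 'w) hom_mod_scheme \<Rightarrow> ('k, 'm, 'b, 'a, 'y) hom_bimod_scheme
    \<Rightarrow> ('k, 'n, 'a, 'd, 'z) hom_bimod_scheme
    \<Rightarrow> ('k, ('m \<times> 'n \<Rightarrow> 'k) set set, 'b, 'd) hom_bimod"
  where "hom_tensor R B A D M N =
    (let T = quotient_module (tensor R M N) (balancing_kernel R A M N);
         t = hom_pure R A M N
     in \<lparr>carrier = carrier T, mult = undefined, one = undefined,
         zero = \<zero>\<^bsub>T\<^esub>, add = (\<oplus>\<^bsub>T\<^esub>), smult = (\<odot>\<^bsub>T\<^esub>),
         twist = hom_tensor_lift R T (\<lambda>m n. t (twist M m) (twist N n)),
         lact = (\<lambda>b. hom_tensor_lift R T (\<lambda>m n. t (inv_twist B b \<triangleright>\<^bsub>M\<^esub> m) (twist N n))),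
         ract = (\<lambda>z d. hom_tensor_lift R T (\<lambda>m n. t (twist M m) (n \<triangleleft>\<^bsub>N\<^esub> inv_twist D d)) z)\<rparr>)"


section \<open>Hom-corings\<close>

text \<open>\<open>sweedler R A C z n x y\<close>: the family \<open>x\<^sub>i \<otimes>\<^sub>A y\<^sub>i\<close> (\<open>i < n\<close>) is an expression of \<open>z\<close> as a
  finite sum of pure tensors. Formulas in Sweedler notation for \<open>z = \<Delta>(c)\<close> are required for
  every such expression, so they include independence of the choice.\<close>

definition sweedler ::
  "('k, 'r) ring_scheme \<Rightarrow> ('k, 'a, 'x) hom_mod_scheme \<Rightarrow> ('k, 'c, 'a, 'a, 'y) hom_bimod_scheme
    \<Rightarrow> ('c \<times> 'c \<Rightarrow> 'k) set set \<Rightarrow> nat \<Rightarrow> (nat \<Rightarrow> 'c) \<Rightarrow> (nat \<Rightarrow> 'c) \<Rightarrow> bool"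
  where "sweedler R A C z n x y \<longleftrightarrow>
    (\<forall>i < n. x i \<in> carrier C \<and> y i \<in> carrier C) \<and>
    z = (\<Oplus>\<^bsub>hom_tensor R A A A C C\<^esub>i\<in>{..<n}. hom_pure R A C C (x i) (y i))"

locale hom_coring = hom_bimodule R A A C
  for R :: "('k, 'r) ring_scheme" and A :: "('k, 'a, 'x) hom_mod_scheme"
    and C :: "('k, 'c, 'a, 'a, 'y) hom_bimod_scheme"
    and \<Delta> :: "'c \<Rightarrow> ('c \<times> 'c \<Rightarrow> 'k) set set" and \<epsilon> :: "'c \<Rightarrow> 'a" +
  assumes comult_bilinear: "\<Delta> \<in> bimodule_maps R A A C (hom_tensor R A A A C C)"
    and counit_bilinear: "\<epsilon> \<in> bimodule_maps R A A C (bimodule_along id id A)"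
    and hom_coassoc:
      "\<lbrakk>c \<in> carrier C; sweedler R A C (\<Delta> c) n x y;
        \<And>i. i < n \<Longrightarrow> sweedler R A C (\<Delta> (x i)) (m i) (u i) (v i)\<rbrakk> \<Longrightarrow>
       (\<Oplus>\<^bsub>hom_tensor R A A A C (hom_tensor R A A A C C)\<^esub>i\<in>{..<n}.
          hom_pure R A C (hom_tensor R A A A C C) (x i) (\<Delta> (y i))) =
       (\<Oplus>\<^bsub>hom_tensor R A A A C (hom_tensor R A A A C C)\<^esub>i\<in>{..<n}.
          \<Oplus>\<^bsub>hom_tensor R A A A C (hom_tensor R A A A C C)\<^esub>j\<in>{..<m i}.
            hom_pure R A C (hom_tensor R A A A C C) (twist C (u i j))
              (hom_pure R A C C (v i j) (inv_twist C (y i))))"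
    and counit_left:
      "\<lbrakk>c \<in> carrier C; sweedler R A C (\<Delta> c) n x y\<rbrakk> \<Longrightarrow>
       (\<Oplus>\<^bsub>C\<^esub>i\<in>{..<n}. \<epsilon> (x i) \<triangleright>\<^bsub>C\<^esub> y i) = c"
    and counit_right:
      "\<lbrakk>c \<in> carrier C; sweedler R A C (\<Delta> c) n x y\<rbrakk> \<Longrightarrow>
       (\<Oplus>\<^bsub>C\<^esub>i\<in>{..<n}. x i \<triangleleft>\<^bsub>C\<^esub> \<epsilon> (y i)) = c"
    and comult_twist:
      "\<lbrakk>c \<in> carrier C; sweedler R A C (\<Delta> c) n x y\<rbrakk> \<Longrightarrow>
       \<Delta> (twist C c) =
       (\<Oplus>\<^bsub>hom_tensor R A A A C C\<^esub>i\<in>{..<n}. hom_pure R A C C (twist C (x i)) (twist C (y i)))"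
    and counit_twist: "c \<in> carrier C \<Longrightarrow> \<epsilon> (twist C c) = twist A (\<epsilon> c)"


section \<open>Base ring extension\<close>

text \<open>\<open>(B \<otimes>\<^sub>A C) \<otimes>\<^sub>A B\<close> along \<open>\<phi>\<close>: the left factor \<open>B\<close> is a \<open>[B, A]\<close>-bimodule, the right
  factor \<open>B\<close> an \<open>[A, B]\<close>-bimodule.\<close>

definition base_ext_left ::
  "('k, 'r) ring_scheme \<Rightarrow> ('k, 'a, 'x) hom_mod_scheme \<Rightarrow> ('k, 'b, 'y) hom_mod_scheme
    \<Rightarrow> ('a \<Rightarrow> 'b) \<Rightarrow> ('k, 'c, 'a, 'a, 'z) hom_bimod_scheme
    \<Rightarrow> ('k, ('b \<times> 'c \<Rightarrow> 'k) set set, 'b, 'a) hom_bimod"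
  where "base_ext_left R A B \<phi> C = hom_tensor R B A A (bimodule_along id \<phi> B) C"

definition base_ext ::
  "('k, 'r) ring_scheme \<Rightarrow> ('k, 'a, 'x) hom_mod_scheme \<Rightarrow> ('k, 'b, 'y) hom_mod_scheme
    \<Rightarrow> ('a \<Rightarrow> 'b) \<Rightarrow> ('k, 'c, 'a, 'a, 'z) hom_bimod_scheme
    \<Rightarrow> ('k, (('b \<times> 'c \<Rightarrow> 'k) set set \<times> 'b \<Rightarrow> 'k) set set, 'b, 'b) hom_bimod"
  where "base_ext R A B \<phi> C =
    hom_tensor R B A B (base_ext_left R A B \<phi> C) (bimodule_along \<phi> id B)"

definition base_ext_pure ::
  "('k, 'r) ring_scheme \<Rightarrow> ('k, 'a, 'x) hom_mod_scheme \<Rightarrow> ('k, 'b, 'y) hom_mod_scheme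
    \<Rightarrow> ('a \<Rightarrow> 'b) \<Rightarrow> ('k, 'c, 'a, 'a, 'z) hom_bimod_scheme
    \<Rightarrow> 'b \<Rightarrow> 'c \<Rightarrow> 'b \<Rightarrow> (('b \<times> 'c \<Rightarrow> 'k) set set \<times> 'b \<Rightarrow> 'k) set set"
  where "base_ext_pure R A B \<phi> C b c b' =
    hom_pure R A (base_ext_left R A B \<phi> C) (bimodule_along \<phi> id B)
      (hom_pure R A (bimodule_along id \<phi> B) C b c) b'"

end

theory Submission
  imports Defs
begin

text \<open>Write \<open>X = (B \<otimes>\<^sub>A C) \<otimes>\<^sub>A B\<close> and \<open>q b c b'\<close> for its generator \<open>(b \<otimes> c) \<otimes> b'\<close>; \<open>\<alpha>\<close>, \<open>\<beta>\<close> and \<open>\<chi>\<close>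
  are the automorphisms of \<open>A\<close>, \<open>B\<close> and \<open>C\<close>.
  The theorem rests on one observation about an inserted unit: an action of \<open>A\<close> on \<open>C\<close> that takes
  place next to the unit of \<open>B\<close> is an action of \<open>B\<close> on all of \<open>X\<close>, namely
  \<open>q b (c a) 1 = q (\<beta>\<^bsup>-1\<^esup> b) c 1 \<cdot> \<phi>(\<alpha>\<^sup>2 a)\<close> and \<open>\<phi>(\<alpha>\<^sup>2 a) \<cdot> q 1 c b = q 1 (a c) (\<beta> b)\<close>
  (lemmas \<open>q_unit_ract\<close> and \<open>q_unit_lact\<close>). Hence relations that balance over \<open>A\<close> inside \<open>C \<otimes>\<^sub>A C\<close>
  become relations that balance over \<open>B\<close> inside \<open>X \<otimes>\<^sub>B X\<close>, and
  \<open>c \<otimes> d \<mapsto> q (\<beta>\<^bsup>-1\<^esup> b) c 1 \<otimes>\<^sub>B q 1 d (\<beta>\<^bsup>-1\<^esup> b')\<close> is a well-defined map \<open>C \<otimes>\<^sub>A C \<rightarrow> X \<otimes>\<^sub>B X\<close>, called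
  \<open>insert_units b b'\<close> below. The comultiplication of \<open>X\<close> sends \<open>q b c b'\<close> to its value at \<open>\<Delta> c\<close>.

  The same reasoning gives a map \<open>insert_units3 b b'\<close> from \<open>C \<otimes>\<^sub>A (C \<otimes>\<^sub>A C)\<close> to
  \<open>X \<otimes>\<^sub>B (X \<otimes>\<^sub>B X)\<close>. It carries each side of the coassociativity law of \<open>C\<close> at \<open>c\<close> to the
  corresponding side for \<open>X\<close> at \<open>q b c b'\<close>, so the law for \<open>X\<close> follows (\<open>ext_coassoc_q\<close>). For the
  counit laws, letting the counit of one factor act on the other factor turns
  \<open>q (\<beta>\<^bsup>-1\<^esup> b) c\<^sub>1 1 \<otimes>\<^sub>B q 1 c\<^sub>2 (\<beta>\<^bsup>-1\<^esup> b')\<close> into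
  \<open>q b (\<epsilon>(c\<^sub>1) c\<^sub>2) b'\<close> or \<open>q b (c\<^sub>1 \<epsilon>(c\<^sub>2)) b'\<close>, whose sum is \<open>q b c b'\<close>.

  What makes these computations on generators sufficient is the universal property of the tensor
  product over a Hom-algebra: balanced bilinear maps extend linearly (\<open>hom_tensor_lift\<close>), and every
  element is a finite sum of pure tensors (\<open>hom_tensor_expression\<close>), which yields an induction
  principle. Sweedler formulas are quantified over all expressions of \<open>\<Delta> z\<close>; each of them is the
  value at \<open>\<Delta> z\<close> of a linear map on \<open>X \<otimes>\<^sub>B X\<close>, expanded along the given expression, so that only
  equalities between linear maps have to be proved.\<close>


section \<open>Linear maps and spans\<close>

lemma linear_maps_iff:
  "f \<in> linear_maps R M N \<longleftrightarrow>
    (\<forall>x\<in>carrier M. f x \<in> carrier N) \<and>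
    (\<forall>x\<in>carrier M. \<forall>y\<in>carrier M. f (x \<oplus>\<^bsub>M\<^esub> y) = f x \<oplus>\<^bsub>N\<^esub> f y) \<and>
    (\<forall>r\<in>carrier R. \<forall>x\<in>carrier M. f (r \<odot>\<^bsub>M\<^esub> x) = r \<odot>\<^bsub>N\<^esub> f x)"
  unfolding linear_maps_def hom_def by auto

lemma linear_mapsI:
  assumes "\<And>x. x \<in> carrier M \<Longrightarrow> f x \<in> carrier N"
    and "\<And>x y. \<lbrakk>x \<in> carrier M; y \<in> carrier M\<rbrakk> \<Longrightarrow> f (x \<oplus>\<^bsub>M\<^esub> y) = f x \<oplus>\<^bsub>N\<^esub> f y"
    and "\<And>r x. \<lbrakk>r \<in> carrier R; x \<in> carrier M\<rbrakk> \<Longrightarrow> f (r \<odot>\<^bsub>M\<^esub> x) = r \<odot>\<^bsub>N\<^esub> f x"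
  shows "f \<in> linear_maps R M N"
  using assms by (simp add: linear_maps_iff)

lemma linear_maps_closed: "\<lbrakk>f \<in> linear_maps R M N; x \<in> carrier M\<rbrakk> \<Longrightarrow> f x \<in> carrier N"
  and linear_maps_add: "\<lbrakk>f \<in> linear_maps R M N; x \<in> carrier M; y \<in> carrier M\<rbrakk>
      \<Longrightarrow> f (x \<oplus>\<^bsub>M\<^esub> y) = f x \<oplus>\<^bsub>N\<^esub> f y"
  and linear_maps_smult: "\<lbrakk>f \<in> linear_maps R M N; r \<in> carrier R; x \<in> carrier M\<rbrakk>
      \<Longrightarrow> f (r \<odot>\<^bsub>M\<^esub> x) = r \<odot>\<^bsub>N\<^esub> f x"
  by (simp_all add: linear_maps_iff)

lemma linear_maps_comp:
  "\<lbrakk>f \<in> linear_maps R M N; g \<in> linear_maps R N P\<rbrakk> \<Longrightarrow> (\<lambda>x. g (f x)) \<in> linear_maps R M P"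
  by (simp add: linear_maps_iff)

lemma linear_maps_zero:
  assumes "module R M" "module R N" "f \<in> linear_maps R M N"
  shows "f \<zero>\<^bsub>M\<^esub> = \<zero>\<^bsub>N\<^esub>"
proof -
  interpret M: module R M by fact
  interpret N: module R N by fact
  have "f \<zero>\<^bsub>M\<^esub> = f (\<zero>\<^bsub>R\<^esub> \<odot>\<^bsub>M\<^esub> \<zero>\<^bsub>M\<^esub>)" by simp
  also have "\<dots> = \<zero>\<^bsub>R\<^esub> \<odot>\<^bsub>N\<^esub> f \<zero>\<^bsub>M\<^esub>"
    by (rule linear_maps_smult[OF assms(3)]) simp_all
  finally show ?thesis using linear_maps_closed[OF assms(3), of "\<zero>\<^bsub>M\<^esub>"] by simp
qed

lemma linear_maps_neg:
  assumes "module R M" "module R N" "f \<in> linear_maps R M N" "x \<in> carrier M"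
  shows "f (\<ominus>\<^bsub>M\<^esub> x) = \<ominus>\<^bsub>N\<^esub> f x"
proof -
  interpret M: module R M by fact
  interpret N: module R N by fact
  have "f (\<ominus>\<^bsub>M\<^esub> x) \<oplus>\<^bsub>N\<^esub> f x = f (\<ominus>\<^bsub>M\<^esub> x \<oplus>\<^bsub>M\<^esub> x)"
    using assms(4) by (simp add: linear_maps_add[OF assms(3)])
  also have "\<dots> = \<zero>\<^bsub>N\<^esub>"
    using assms(4) linear_maps_zero[OF assms(1-3)] by (simp add: M.l_neg)
  finally show ?thesis
    using assms(4) linear_maps_closed[OF assms(3)] by (metis M.a_inv_closed N.minus_equality)
qed

lemma linear_maps_minus:
  assumes "module R M" "module R N" "f \<in> linear_maps R M N" "x \<in> carrier M" "y \<in> carrier M"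
  shows "f (x \<ominus>\<^bsub>M\<^esub> y) = f x \<ominus>\<^bsub>N\<^esub> f y"
proof -
  interpret M: module R M by fact
  show ?thesis
    using assms(4,5)
    by (simp add: a_minus_def linear_maps_add[OF assms(3)] linear_maps_neg[OF assms(1-3)])
qed

lemma linear_maps_finsum:
  assumes "module R M" "module R N" "f \<in> linear_maps R M N" "finite I"
    "\<And>i. i \<in> I \<Longrightarrow> g i \<in> carrier M"
  shows "f (\<Oplus>\<^bsub>M\<^esub>i\<in>I. g i) = (\<Oplus>\<^bsub>N\<^esub>i\<in>I. f (g i))"
proof -
  interpret M: module R M by fact
  interpret N: module R N by fact
  show ?thesis using assms(4,5)
  proof (induction I rule: finite_induct)
    case empty
    then show ?case by (simp add: linear_maps_zero[OF assms(1-3)])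
  next
    case (insert j I)
    then show ?case
      by (simp add: Pi_def linear_maps_add[OF assms(3)] linear_maps_closed[OF assms(3)])
  qed
qed

text \<open>Two linear maps that agree on a generating set agree everywhere because the set on which they
  agree is a submodule.\<close>

lemma submodule_equalizer:
  assumes "module R M" "module R N" "f \<in> linear_maps R M N" "g \<in> linear_maps R M N"
  shows "submodule {x \<in> carrier M. f x = g x} R M"
proof -
  interpret M: module R M by fact
  show ?thesis
    by (rule M.submoduleI)
      (auto simp: linear_maps_zero[OF assms(1-3)] linear_maps_zero[OF assms(1,2,4)]
        linear_maps_neg[OF assms(1-3)] linear_maps_neg[OF assms(1,2,4)]
        linear_maps_add[OF assms(3)] linear_maps_add[OF assms(4)]
        linear_maps_smult[OF assms(3)] linear_maps_smult[OF assms(4)])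
qed

lemma submodule_vimage:
  assumes "module R M" "module R N" "f \<in> linear_maps R M N" "submodule H R N"
  shows "submodule {x \<in> carrier M. f x \<in> H} R M"
proof -
  interpret M: module R M by fact
  interpret N: module R N by fact
  interpret H: submodule H R N by fact
  show ?thesis
    using N.submoduleE[OF assms(4)] H.one_closed
    by (intro M.submoduleI)
      (auto simp: linear_maps_zero[OF assms(1-3)] linear_maps_neg[OF assms(1-3)]
        linear_maps_add[OF assms(3)] linear_maps_smult[OF assms(3)])
qed

lemma submodule_kernel:
  assumes "module R M" "module R N" "f \<in> linear_maps R M N"
  shows "submodule {x \<in> carrier M. f x = \<zero>\<^bsub>N\<^esub>} R M"
proof -
  interpret N: module R N by fact
  have "(\<lambda>x. \<zero>\<^bsub>N\<^esub>) \<in> linear_maps R M N" by (rule linear_mapsI) simp_all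
  from submodule_equalizer[OF assms this] show ?thesis .
qed

lemma submodule_span:
  assumes "module R M" "X \<subseteq> carrier M"
  shows "submodule (module_span R M X) R M"
proof -
  interpret M: module R M by fact
  have 1: "submodule (carrier M) R M" by (rule M.carrier_is_submodule)
  have z: "submodule H R M \<Longrightarrow> \<zero>\<^bsub>M\<^esub> \<in> H" for H
    using subgroup.one_closed[OF submodule.axioms(1)] by fastforce
  show ?thesis
  proof (rule M.submoduleI)
    show "module_span R M X \<subseteq> carrier M" unfolding module_span_def using 1 assms(2) by blast
  qed (use z in \<open>simp_all add: module_span_def M.submoduleE(3-5)\<close>)
qed

lemma span_superset: "X \<subseteq> module_span R M X"
  unfolding module_span_def by auto

lemma span_least: "\<lbrakk>submodule H R M; X \<subseteq> H\<rbrakk> \<Longrightarrow> module_span R M X \<subseteq> H"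
  unfolding module_span_def by auto


section \<open>Quotient modules\<close>

lemma quotient_module_simps [simp]:
  "carrier (quotient_module M H) = a_rcosets\<^bsub>M\<^esub> H"
  "zero (quotient_module M H) = H"
  "add (quotient_module M H) = set_add M"
  "smult (quotient_module M H) = (\<lambda>r X. \<Union>x\<in>X. H +>\<^bsub>M\<^esub> (r \<odot>\<^bsub>M\<^esub> x))"
  by (simp_all add: quotient_module_def)

locale module_quotient = M: module R M for R :: "('k, 'r) ring_scheme"
    and M :: "('k, 'm, 'x) module_scheme" +
  fixes H :: "'m set"
  assumes sub: "submodule H R M"
begin

sublocale H: abelian_subgroup H M
  using sub by (intro abelian_subgroupI3 additive_subgroup.intro submodule.axioms(1))
    (assumption, rule M.abelian_group_axioms)

lemma coset_eqI:
  assumes "x \<in> carrier M" "y \<in> carrier M" "x \<ominus>\<^bsub>M\<^esub> y \<in> H"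
  shows "H +>\<^bsub>M\<^esub> x = H +>\<^bsub>M\<^esub> y"
proof -
  have "H +>\<^bsub>M\<^esub> (x \<ominus>\<^bsub>M\<^esub> y) = H"
    using M.a_coset_join2[OF _ H.a_subgroup assms(3)] assms by simp
  then show ?thesis
    using M.a_coset_add_inv1[of H x y] assms H.a_subset by (simp add: a_minus_def)
qed

lemma coset_memD:
  assumes "x \<in> carrier M" "y \<in> H +>\<^bsub>M\<^esub> x"
  obtains h where "h \<in> H" "y = h \<oplus>\<^bsub>M\<^esub> x" "y \<in> carrier M"
  using assms H.a_subset unfolding a_r_coset_def' by auto

lemma coset_zero: "H +>\<^bsub>M\<^esub> \<zero>\<^bsub>M\<^esub> = H"
  using H.a_subset by simp

text \<open>The scalar action on the quotient is given as a union over all representatives. Since \<open>r H \<subseteq> H\<close>,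
  all members of that union are the same coset.\<close>

lemma coset_smult:
  assumes "r \<in> carrier R" "x \<in> carrier M"
  shows "(\<Union>y\<in>H +>\<^bsub>M\<^esub> x. H +>\<^bsub>M\<^esub> (r \<odot>\<^bsub>M\<^esub> y)) = H +>\<^bsub>M\<^esub> (r \<odot>\<^bsub>M\<^esub> x)"
proof -
  have *: "H +>\<^bsub>M\<^esub> (r \<odot>\<^bsub>M\<^esub> y) = H +>\<^bsub>M\<^esub> (r \<odot>\<^bsub>M\<^esub> x)" if "y \<in> H +>\<^bsub>M\<^esub> x" for y
  proof -
    from coset_memD[OF assms(2) that] obtain h where h: "h \<in> H" "y = h \<oplus>\<^bsub>M\<^esub> x" "y \<in> carrier M" .
    have hM: "h \<in> carrier M" by (rule subsetD[OF H.a_subset h(1)])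
    have "r \<odot>\<^bsub>M\<^esub> y \<ominus>\<^bsub>M\<^esub> r \<odot>\<^bsub>M\<^esub> x = r \<odot>\<^bsub>M\<^esub> h"
      unfolding h(2) using hM assms by (simp add: M.smult_r_distr a_minus_def M.a_assoc M.r_neg)
    then have "r \<odot>\<^bsub>M\<^esub> y \<ominus>\<^bsub>M\<^esub> r \<odot>\<^bsub>M\<^esub> x \<in> H"
      using submodule.smult_closed[OF sub assms(1) h(1)] by (simp only:)
    then show ?thesis
      by (intro coset_eqI M.smult_closed assms h(3))
  qed
  have "x \<in> H +>\<^bsub>M\<^esub> x" by (rule H.a_rcos_self) fact
  then have "H +>\<^bsub>M\<^esub> x \<noteq> {}" by blast
  then show ?thesis using * by (rule SUP_eq_const)
qed

lemma quotient_cases: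
  assumes "X \<in> carrier (quotient_module M H)"
  obtains x where "x \<in> carrier M" "X = H +>\<^bsub>M\<^esub> x"
  using assms by (auto simp: A_RCOSETS_def')

lemma coset_closed: "x \<in> carrier M \<Longrightarrow> H +>\<^bsub>M\<^esub> x \<in> a_rcosets\<^bsub>M\<^esub> H"
  by (auto simp: A_RCOSETS_def')

lemma module_quotient_module: "module R (quotient_module M H)"
proof (rule moduleI)
  show "cring R" by (rule M.R.is_cring)
  show "abelian_group (quotient_module M H)"
  proof (rule abelian_groupI; (elim quotient_cases)?)
    fix x X assume "x \<in> carrier M" "X = H +>\<^bsub>M\<^esub> x"
    then show "\<exists>y\<in>carrier (quotient_module M H).
        y \<oplus>\<^bsub>quotient_module M H\<^esub> X = \<zero>\<^bsub>quotient_module M H\<^esub>"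
      by (intro bexI[of _ "H +>\<^bsub>M\<^esub> (\<ominus>\<^bsub>M\<^esub> x)"])
        (simp_all add: H.a_rcos_sum coset_closed M.l_neg coset_zero)
  next
    show "\<zero>\<^bsub>quotient_module M H\<^esub> \<in> carrier (quotient_module M H)"
      using coset_closed[of "\<zero>\<^bsub>M\<^esub>"] by (simp add: coset_zero)
  next
    fix X x assume "x \<in> carrier M" "X = H +>\<^bsub>M\<^esub> x"
    then show "\<zero>\<^bsub>quotient_module M H\<^esub> \<oplus>\<^bsub>quotient_module M H\<^esub> X = X"
      using H.a_rcos_sum[of "\<zero>\<^bsub>M\<^esub>" x] by (simp add: coset_zero)
  qed (simp_all add: H.a_rcos_sum coset_closed M.a_ac)
qed (elim quotient_cases, simp add: coset_smult coset_closed H.a_rcos_sum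
      M.smult_l_distr M.smult_r_distr M.smult_assoc1)+

lemma coset_linear: "(\<lambda>x. H +>\<^bsub>M\<^esub> x) \<in> linear_maps R M (quotient_module M H)"
  by (rule linear_mapsI) (simp_all add: coset_closed H.a_rcos_sum coset_smult)

text \<open>A linear map that kills \<open>H\<close> takes a single value on each coset, which is the value that
  \<^const>\<open>the_elem\<close> selects.\<close>

lemma quotient_lift:
  assumes "module R P" "g \<in> linear_maps R M P" "\<And>h. h \<in> H \<Longrightarrow> g h = \<zero>\<^bsub>P\<^esub>"
  shows "\<And>x. x \<in> carrier M \<Longrightarrow> the_elem (g ` (H +>\<^bsub>M\<^esub> x)) = g x"
    and "(\<lambda>X. the_elem (g ` X)) \<in> linear_maps R (quotient_module M H) P"
proof -
  interpret P: module R P by fact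
  show *: "the_elem (g ` (H +>\<^bsub>M\<^esub> x)) = g x" if x: "x \<in> carrier M" for x
  proof -
    have const: "g y = g x" if "y \<in> H +>\<^bsub>M\<^esub> x" for y
    proof -
      from coset_memD[OF x that] obtain h where h: "h \<in> H" "y = h \<oplus>\<^bsub>M\<^esub> x" "y \<in> carrier M" .
      have "h \<in> carrier M" by (rule subsetD[OF H.a_subset h(1)])
      then show ?thesis
        unfolding h(2) using x assms(3)[OF h(1)] linear_maps_closed[OF assms(2)]
        by (simp add: linear_maps_add[OF assms(2)])
    qed
    have "g ` (H +>\<^bsub>M\<^esub> x) = (\<lambda>_. g x) ` (H +>\<^bsub>M\<^esub> x)" by (rule image_cong[OF refl const])
    also have "\<dots> = {g x}" using H.a_rcos_self[OF x] by blast
    finally show ?thesis by simp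
  qed
  show "(\<lambda>X. the_elem (g ` X)) \<in> linear_maps R (quotient_module M H) P"
    by (rule linear_mapsI; elim quotient_cases)
      (simp_all add: * coset_smult H.a_rcos_sum linear_maps_closed[OF assms(2)]
        linear_maps_add[OF assms(2)] linear_maps_smult[OF assms(2)])
qed

end


section \<open>Free modules\<close>

lemma free_module_simps:
  "carrier (free_module R S) = {p. (\<forall>s \<in> S. p s \<in> carrier R) \<and> (\<forall>s. s \<notin> S \<longrightarrow> p s = \<zero>\<^bsub>R\<^esub>)
                  \<and> finite {s. p s \<noteq> \<zero>\<^bsub>R\<^esub>}}"
  "zero (free_module R S) = (\<lambda>s. \<zero>\<^bsub>R\<^esub>)"
  "add (free_module R S) = (\<lambda>p q s. p s \<oplus>\<^bsub>R\<^esub> q s)"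
  "smult (free_module R S) = (\<lambda>r p s. r \<otimes>\<^bsub>R\<^esub> p s)"
  by (simp_all add: free_module_def)

context cring
begin

lemma free_module_closed: "p \<in> carrier (free_module R S) \<Longrightarrow> p s \<in> carrier R"
  by (cases "s \<in> S") (auto simp: free_module_simps)

lemma free_module_finite: "p \<in> carrier (free_module R S) \<Longrightarrow> finite {s. p s \<noteq> \<zero>}"
  and free_module_support: "p \<in> carrier (free_module R S) \<Longrightarrow> {s. p s \<noteq> \<zero>} \<subseteq> S"
  by (auto simp: free_module_simps)

lemma free_moduleI:
  assumes "\<And>s. s \<in> S \<Longrightarrow> p s \<in> carrier R" "finite T" "T \<subseteq> S" "\<And>s. s \<notin> T \<Longrightarrow> p s = \<zero>"
  shows "p \<in> carrier (free_module R S)"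
  using assms finite_subset[of "{s. p s \<noteq> \<zero>}" T] unfolding free_module_simps by blast

lemma free_module_module: "module R (free_module R S)"
proof (rule moduleI)
  show "cring R" by (rule is_cring)
  note cl = free_module_closed[of _ S]
  have add: "p \<oplus>\<^bsub>free_module R S\<^esub> q \<in> carrier (free_module R S)"
    if "p \<in> carrier (free_module R S)" "q \<in> carrier (free_module R S)" for p q
    using that cl free_module_finite[of p S] free_module_finite[of q S]
      free_module_support[of p S] free_module_support[of q S]
    by (intro free_moduleI[of _ _ "{s. p s \<noteq> \<zero>} \<union> {s. q s \<noteq> \<zero>}"])
      (simp_all add: free_module_simps(2-))
  show "abelian_group (free_module R S)"
  proof (rule abelian_groupI)
    fix p assume p: "p \<in> carrier (free_module R S)"
    then have "(\<lambda>s. \<ominus> p s) \<in> carrier (free_module R S)"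
      using cl free_module_finite[of p S] free_module_support[of p S]
      by (intro free_moduleI[of _ _ "{s. p s \<noteq> \<zero>}"]) simp_all
    then show "\<exists>q\<in>carrier (free_module R S). q \<oplus>\<^bsub>free_module R S\<^esub> p = \<zero>\<^bsub>free_module R S\<^esub>"
      using p cl by (intro bexI) (auto simp: free_module_simps(2-) l_neg)
  next
    show "\<zero>\<^bsub>free_module R S\<^esub> \<in> carrier (free_module R S)"
      by (simp add: free_module_simps)
  qed (use add cl in \<open>simp_all add: free_module_simps(2-) a_ac\<close>)
  show "r \<odot>\<^bsub>free_module R S\<^esub> p \<in> carrier (free_module R S)"
    if "r \<in> carrier R" "p \<in> carrier (free_module R S)" for r p
    using that cl free_module_finite[of p S] free_module_support[of p S]
    by (intro free_moduleI[of _ _ "{s. p s \<noteq> \<zero>}"]) (simp_all add: free_module_simps(2-))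
qed (use free_module_closed[of _ S] in \<open>simp_all add: free_module_simps(2-) l_distr r_distr m_assoc\<close>)

lemma free_gen_closed: "s \<in> S \<Longrightarrow> free_gen R s \<in> carrier (free_module R S)"
  by (rule free_moduleI[of _ _ "{s}"]) (auto simp: free_gen_def)

text \<open>Induction on a finite set containing the support: splitting off the value at one point writes an
  element as one with smaller support plus a multiple of a generator.\<close>

lemma free_module_generated:
  assumes "submodule H R (free_module R S)" "\<And>s. s \<in> S \<Longrightarrow> free_gen R s \<in> H"
    and p: "p \<in> carrier (free_module R S)"
  shows "p \<in> H"
proof -
  interpret F: module R "free_module R S" by (rule free_module_module)
  have z: "\<zero>\<^bsub>free_module R S\<^esub> \<in> H"
    using subgroup.one_closed[OF submodule.axioms(1)[OF assms(1)]] by simp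
  have "\<forall>p\<in>carrier (free_module R S). {s. p s \<noteq> \<zero>} \<subseteq> T \<longrightarrow> p \<in> H" if "finite T" for T
    using that
  proof (induction T rule: finite_induct)
    case empty
    have "p = \<zero>\<^bsub>free_module R S\<^esub>" if "{s. p s \<noteq> \<zero>} \<subseteq> {}" for p
      using that by (auto simp: free_module_simps)
    then show ?case using z by auto
  next
    case (insert t T)
    show ?case
    proof (intro ballI impI)
      fix p assume p: "p \<in> carrier (free_module R S)" "{s. p s \<noteq> \<zero>} \<subseteq> insert t T"
      show "p \<in> H"
      proof (cases "t \<in> S")
        case False
        then have "{s. p s \<noteq> \<zero>} \<subseteq> T" using p by (auto simp: free_module_simps)
        then show ?thesis using insert p by blast
      next
        case True
        define q where "q = p(t := \<zero>)"
        have q: "q \<in> carrier (free_module R S)"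
          using p(1) free_module_closed[OF p(1)] free_module_finite[OF p(1)] free_module_support[OF p(1)]
          by (intro free_moduleI[of _ _ "{s. p s \<noteq> \<zero>}"]) (auto simp: q_def)
        have "{s. q s \<noteq> \<zero>} \<subseteq> T" using p(2) by (auto simp: q_def)
        then have qH: "q \<in> H" using insert q by blast
        have "p = q \<oplus>\<^bsub>free_module R S\<^esub> (p t \<odot>\<^bsub>free_module R S\<^esub> free_gen R t)"
          using free_module_closed[OF p(1)]
          by (auto simp: q_def free_gen_def free_module_simps(2-) fun_eq_iff)
        then show ?thesis
          using qH F.submoduleE(4,5)[OF assms(1)] free_module_closed[OF p(1)] assms(2)[OF True]
          by metis
      qed
    qed
  qed
  then show ?thesis using p free_module_finite[OF p] by blast
qed

end

definition free_lift :: "('k, 'r) ring_scheme \<Rightarrow> ('k, 'p, 'z) module_scheme \<Rightarrow> ('s \<Rightarrow> 'p)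
    \<Rightarrow> ('s \<Rightarrow> 'k) \<Rightarrow> 'p"
  where "free_lift R P h p = (\<Oplus>\<^bsub>P\<^esub>s\<in>{s. p s \<noteq> \<zero>\<^bsub>R\<^esub>}. p s \<odot>\<^bsub>P\<^esub> h s)"

text \<open>Summing over any finite set that contains the support makes sums with different supports
  comparable. It also covers the zero ring, where the support of a generator is empty.\<close>

lemma free_lift_superset:
  assumes "module R P" "\<And>s. s \<in> S \<Longrightarrow> h s \<in> carrier P" "p \<in> carrier (free_module R S)"
    "finite T" "T \<subseteq> S" "{s. p s \<noteq> \<zero>\<^bsub>R\<^esub>} \<subseteq> T"
  shows "free_lift R P h p = (\<Oplus>\<^bsub>P\<^esub>s\<in>T. p s \<odot>\<^bsub>P\<^esub> h s)"
proof -
  interpret P: module R P by fact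
  show ?thesis
    unfolding free_lift_def
    using assms P.R.free_module_closed[OF assms(3)]
    by (intro P.add.finprod_mono_neutral_cong_left) auto
qed

lemma free_lift_linear:
  assumes "module R P" "\<And>s. s \<in> S \<Longrightarrow> h s \<in> carrier P"
  shows "free_lift R P h \<in> linear_maps R (free_module R S) P"
proof -
  interpret P: module R P by fact
  interpret F: module R "free_module R S" by (rule P.R.free_module_module)
  note cl = P.R.free_module_closed[of _ S] and fs = P.R.free_module_finite[of _ S]
    P.R.free_module_support[of _ S]
  show ?thesis
  proof (rule linear_mapsI)
    fix p assume p: "p \<in> carrier (free_module R S)"
    then show "free_lift R P h p \<in> carrier P"
      unfolding free_lift_def using fs[OF p] cl assms(2) by (intro P.finsum_closed) auto
    fix r assume r: "r \<in> carrier R"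
    let ?T = "{s. p s \<noteq> \<zero>\<^bsub>R\<^esub>}"
    have "free_lift R P h (r \<odot>\<^bsub>free_module R S\<^esub> p)
        = (\<Oplus>\<^bsub>P\<^esub>s\<in>?T. (r \<odot>\<^bsub>free_module R S\<^esub> p) s \<odot>\<^bsub>P\<^esub> h s)"
      using r p fs[OF p] assms F.smult_closed[OF r p]
      by (intro free_lift_superset[of R P S]) (auto simp: free_module_simps(4))
    also have "\<dots> = (\<Oplus>\<^bsub>P\<^esub>s\<in>?T. r \<odot>\<^bsub>P\<^esub> (p s \<odot>\<^bsub>P\<^esub> h s))"
      using r p fs[OF p] assms cl
      by (intro P.finsum_cong') (auto simp: free_module_simps(4) P.smult_assoc1)
    also have "\<dots> = r \<odot>\<^bsub>P\<^esub> (\<Oplus>\<^bsub>P\<^esub>s\<in>?T. p s \<odot>\<^bsub>P\<^esub> h s)"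
      using r p fs[OF p] assms cl by (intro P.finsum_smult_ldistr[symmetric]) auto
    finally show "free_lift R P h (r \<odot>\<^bsub>free_module R S\<^esub> p) = r \<odot>\<^bsub>P\<^esub> free_lift R P h p"
      by (simp add: free_lift_def)
  next
    fix p q assume p: "p \<in> carrier (free_module R S)" and q: "q \<in> carrier (free_module R S)"
    let ?T = "{s. p s \<noteq> \<zero>\<^bsub>R\<^esub>} \<union> {s. q s \<noteq> \<zero>\<^bsub>R\<^esub>}"
    have T: "finite ?T" "?T \<subseteq> S" using fs[OF p] fs[OF q] by auto
    have "free_lift R P h (p \<oplus>\<^bsub>free_module R S\<^esub> q)
        = (\<Oplus>\<^bsub>P\<^esub>s\<in>?T. (p \<oplus>\<^bsub>free_module R S\<^esub> q) s \<odot>\<^bsub>P\<^esub> h s)"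
      using p q T assms F.a_closed[OF p q]
      by (intro free_lift_superset[of R P S]) (auto simp: free_module_simps(3))
    also have "\<dots> = (\<Oplus>\<^bsub>P\<^esub>s\<in>?T. p s \<odot>\<^bsub>P\<^esub> h s \<oplus>\<^bsub>P\<^esub> q s \<odot>\<^bsub>P\<^esub> h s)"
      using p q T assms cl
      by (intro P.finsum_cong') (auto simp: free_module_simps(3) P.smult_l_distr)
    also have "\<dots> = (\<Oplus>\<^bsub>P\<^esub>s\<in>?T. p s \<odot>\<^bsub>P\<^esub> h s) \<oplus>\<^bsub>P\<^esub> (\<Oplus>\<^bsub>P\<^esub>s\<in>?T. q s \<odot>\<^bsub>P\<^esub> h s)"
      using p q T assms cl by (intro P.finsum_addf) auto
    also have "(\<Oplus>\<^bsub>P\<^esub>s\<in>?T. p s \<odot>\<^bsub>P\<^esub> h s) = free_lift R P h p"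
      using p T assms by (intro free_lift_superset[of R P S, symmetric]) auto
    also have "(\<Oplus>\<^bsub>P\<^esub>s\<in>?T. q s \<odot>\<^bsub>P\<^esub> h s) = free_lift R P h q"
      using q T assms by (intro free_lift_superset[of R P S, symmetric]) auto
    finally show "free_lift R P h (p \<oplus>\<^bsub>free_module R S\<^esub> q) = free_lift R P h p \<oplus>\<^bsub>P\<^esub> free_lift R P h q" .
  qed
qed

lemma free_lift_gen:
  assumes "module R P" "\<And>s. s \<in> S \<Longrightarrow> h s \<in> carrier P" "t \<in> S"
  shows "free_lift R P h (free_gen R t) = h t"
proof -
  interpret P: module R P by fact
  have "free_lift R P h (free_gen R t) = (\<Oplus>\<^bsub>P\<^esub>s\<in>{t}. free_gen R t s \<odot>\<^bsub>P\<^esub> h s)"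
    using assms P.R.free_gen_closed[OF assms(3)]
    by (intro free_lift_superset[of R P S]) (auto simp: free_gen_def)
  then show ?thesis using assms by (simp add: free_gen_def)
qed


section \<open>The universal property of the tensor product\<close>

lemma bilinear_mapsI:
  assumes "\<And>m n. \<lbrakk>m \<in> carrier M; n \<in> carrier N\<rbrakk> \<Longrightarrow> f m n \<in> carrier P"
    and "\<And>m m' n. \<lbrakk>m \<in> carrier M; m' \<in> carrier M; n \<in> carrier N\<rbrakk> \<Longrightarrow> f (m \<oplus>\<^bsub>M\<^esub> m') n = f m n \<oplus>\<^bsub>P\<^esub> f m' n"
    and "\<And>m n n'. \<lbrakk>m \<in> carrier M; n \<in> carrier N; n' \<in> carrier N\<rbrakk> \<Longrightarrow> f m (n \<oplus>\<^bsub>N\<^esub> n') = f m n \<oplus>\<^bsub>P\<^esub> f m n'"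
    and "\<And>r m n. \<lbrakk>r \<in> carrier R; m \<in> carrier M; n \<in> carrier N\<rbrakk> \<Longrightarrow> f (r \<odot>\<^bsub>M\<^esub> m) n = r \<odot>\<^bsub>P\<^esub> f m n"
    and "\<And>r m n. \<lbrakk>r \<in> carrier R; m \<in> carrier M; n \<in> carrier N\<rbrakk> \<Longrightarrow> f m (r \<odot>\<^bsub>N\<^esub> n) = r \<odot>\<^bsub>P\<^esub> f m n"
  shows "f \<in> bilinear_maps R M N P"
  using assms by (simp add: bilinear_maps_def linear_maps_iff)

lemma bilinear_maps_left: "\<lbrakk>f \<in> bilinear_maps R M N P; n \<in> carrier N\<rbrakk> \<Longrightarrow> (\<lambda>m. f m n) \<in> linear_maps R M P"
  and bilinear_maps_right: "\<lbrakk>f \<in> bilinear_maps R M N P; m \<in> carrier M\<rbrakk> \<Longrightarrow> f m \<in> linear_maps R N P"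
  by (simp_all add: bilinear_maps_def)

lemma bilinear_mapsD:
  assumes "f \<in> bilinear_maps R M N P"
  shows "\<And>m n. \<lbrakk>m \<in> carrier M; n \<in> carrier N\<rbrakk> \<Longrightarrow> f m n \<in> carrier P"
    and "\<And>m m' n. \<lbrakk>m \<in> carrier M; m' \<in> carrier M; n \<in> carrier N\<rbrakk> \<Longrightarrow> f (m \<oplus>\<^bsub>M\<^esub> m') n = f m n \<oplus>\<^bsub>P\<^esub> f m' n"
    and "\<And>m n n'. \<lbrakk>m \<in> carrier M; n \<in> carrier N; n' \<in> carrier N\<rbrakk> \<Longrightarrow> f m (n \<oplus>\<^bsub>N\<^esub> n') = f m n \<oplus>\<^bsub>P\<^esub> f m n'"
    and "\<And>r m n. \<lbrakk>r \<in> carrier R; m \<in> carrier M; n \<in> carrier N\<rbrakk> \<Longrightarrow> f (r \<odot>\<^bsub>M\<^esub> m) n = r \<odot>\<^bsub>P\<^esub> f m n"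
    and "\<And>r m n. \<lbrakk>r \<in> carrier R; m \<in> carrier M; n \<in> carrier N\<rbrakk> \<Longrightarrow> f m (r \<odot>\<^bsub>N\<^esub> n) = r \<odot>\<^bsub>P\<^esub> f m n"
  using assms by (simp_all add: bilinear_maps_def linear_maps_iff)

lemma linear_maps_plus:
  assumes "module R N" "f \<in> linear_maps R M N" "g \<in> linear_maps R M N"
  shows "(\<lambda>x. f x \<oplus>\<^bsub>N\<^esub> g x) \<in> linear_maps R M N"
proof -
  interpret N: module R N by fact
  show ?thesis using assms(2,3) by (intro linear_mapsI) (simp_all add: linear_maps_iff N.smult_r_distr N.a_ac)
qed

lemma linear_maps_cong:
  assumes "module R M" "\<And>x. x \<in> carrier M \<Longrightarrow> f x = g x" "g \<in> linear_maps R M N"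
  shows "f \<in> linear_maps R M N"
proof -
  interpret M: module R M by fact
  show ?thesis using assms(2,3) by (simp add: linear_maps_iff)
qed

locale tensor_product = M: module R M + N: module R N
  for R :: "('k, 'r) ring_scheme" and M :: "('k, 'm, 'x) module_scheme"
    and N :: "('k, 'n, 'y) module_scheme"
begin

abbreviation "F \<equiv> free_module R (carrier M \<times> carrier N)"

sublocale F: module R F by (rule M.R.free_module_module)

lemma gen_closed: "\<lbrakk>m \<in> carrier M; n \<in> carrier N\<rbrakk> \<Longrightarrow> free_gen R (m, n) \<in> carrier F"
  by (rule M.R.free_gen_closed) simp

lemma tensor_relations_closed: "tensor_relations R M N \<subseteq> carrier F"
  unfolding tensor_relations_def Let_def using gen_closed by auto

sublocale Q: module_quotient R F "tensor_kernel R M N"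
  by (intro module_quotient.intro module_quotient_axioms.intro F.module_axioms)
    (simp add: tensor_kernel_def submodule_span[OF F.module_axioms tensor_relations_closed])

lemma tensor_module: "module R (tensor R M N)"
  unfolding tensor_def by (rule Q.module_quotient_module)

lemma tensor_relationsI:
  "\<lbrakk>m \<in> carrier M; m' \<in> carrier M; n \<in> carrier N\<rbrakk> \<Longrightarrow>
    free_gen R (m \<oplus>\<^bsub>M\<^esub> m', n) \<ominus>\<^bsub>F\<^esub> (free_gen R (m, n) \<oplus>\<^bsub>F\<^esub> free_gen R (m', n)) \<in> tensor_relations R M N"
  "\<lbrakk>m \<in> carrier M; n \<in> carrier N; n' \<in> carrier N\<rbrakk> \<Longrightarrow>
    free_gen R (m, n \<oplus>\<^bsub>N\<^esub> n') \<ominus>\<^bsub>F\<^esub> (free_gen R (m, n) \<oplus>\<^bsub>F\<^esub> free_gen R (m, n')) \<in> tensor_relations R M N"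
  "\<lbrakk>r \<in> carrier R; m \<in> carrier M; n \<in> carrier N\<rbrakk> \<Longrightarrow>
    free_gen R (r \<odot>\<^bsub>M\<^esub> m, n) \<ominus>\<^bsub>F\<^esub> (r \<odot>\<^bsub>F\<^esub> free_gen R (m, n)) \<in> tensor_relations R M N"
  "\<lbrakk>r \<in> carrier R; m \<in> carrier M; n \<in> carrier N\<rbrakk> \<Longrightarrow>
    free_gen R (m, r \<odot>\<^bsub>N\<^esub> n) \<ominus>\<^bsub>F\<^esub> (r \<odot>\<^bsub>F\<^esub> free_gen R (m, n)) \<in> tensor_relations R M N"
  unfolding tensor_relations_def Let_def by blast+

lemma relation_coset:
  assumes "x \<ominus>\<^bsub>F\<^esub> y \<in> tensor_relations R M N" "x \<in> carrier F" "y \<in> carrier F"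
  shows "tensor_kernel R M N +>\<^bsub>F\<^esub> x = tensor_kernel R M N +>\<^bsub>F\<^esub> y"
  using assms span_superset[of "tensor_relations R M N" R "free_module R (carrier M \<times> carrier N)"]
  by (intro Q.coset_eqI) (auto simp: tensor_kernel_def)

lemma pure_bilinear: "pure R M N \<in> bilinear_maps R M N (tensor R M N)"
proof (rule bilinear_mapsI)
  note [simp] = gen_closed
  show "pure R M N m n \<in> carrier (tensor R M N)" if "m \<in> carrier M" "n \<in> carrier N" for m n
    using that by (simp add: pure_def tensor_def Q.coset_closed)
  show "pure R M N (m \<oplus>\<^bsub>M\<^esub> m') n = pure R M N m n \<oplus>\<^bsub>tensor R M N\<^esub> pure R M N m' n"
    if "m \<in> carrier M" "m' \<in> carrier M" "n \<in> carrier N" for m m' n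
    unfolding pure_def tensor_def using that
    by (simp add: Q.H.a_rcos_sum, intro relation_coset)
      (simp_all add: tensor_relationsI)
  show "pure R M N m (n \<oplus>\<^bsub>N\<^esub> n') = pure R M N m n \<oplus>\<^bsub>tensor R M N\<^esub> pure R M N m n'"
    if "m \<in> carrier M" "n \<in> carrier N" "n' \<in> carrier N" for m n n'
    unfolding pure_def tensor_def using that
    by (simp add: Q.H.a_rcos_sum, intro relation_coset)
      (simp_all add: tensor_relationsI)
  show "pure R M N (r \<odot>\<^bsub>M\<^esub> m) n = r \<odot>\<^bsub>tensor R M N\<^esub> pure R M N m n"
    if "r \<in> carrier R" "m \<in> carrier M" "n \<in> carrier N" for r m n
    unfolding pure_def tensor_def using that
    by (simp add: Q.coset_smult, intro relation_coset)
      (simp_all add: tensor_relationsI)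
  show "pure R M N m (r \<odot>\<^bsub>N\<^esub> n) = r \<odot>\<^bsub>tensor R M N\<^esub> pure R M N m n"
    if "r \<in> carrier R" "m \<in> carrier M" "n \<in> carrier N" for r m n
    unfolding pure_def tensor_def using that
    by (simp add: Q.coset_smult, intro relation_coset)
      (simp_all add: tensor_relationsI)
qed

text \<open>The preimage of \<open>H\<close> in the free module is a submodule containing all generators.\<close>

lemma tensor_generated:
  assumes "submodule H R (tensor R M N)"
    and "\<And>m n. \<lbrakk>m \<in> carrier M; n \<in> carrier N\<rbrakk> \<Longrightarrow> pure R M N m n \<in> H"
    and "z \<in> carrier (tensor R M N)"
  shows "z \<in> H"
proof -
  have "submodule {x \<in> carrier F. tensor_kernel R M N +>\<^bsub>F\<^esub> x \<in> H} R F"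
    using submodule_vimage[OF F.module_axioms tensor_module _ assms(1)] Q.coset_linear
    by (simp add: tensor_def)
  then have "x \<in> {x \<in> carrier F. tensor_kernel R M N +>\<^bsub>F\<^esub> x \<in> H}" if "x \<in> carrier F" for x
    by (rule M.R.free_module_generated[OF _ _ that])
      (use assms(2) gen_closed in \<open>auto simp: pure_def\<close>)
  then show ?thesis using assms(3) unfolding tensor_def by (elim Q.quotient_cases) simp
qed

lemma tensor_lift:
  assumes P: "module R P" and f: "f \<in> bilinear_maps R M N P"
  shows "tensor_lift R P f \<in> linear_maps R (tensor R M N) P"
    and "\<lbrakk>m \<in> carrier M; n \<in> carrier N\<rbrakk> \<Longrightarrow> tensor_lift R P f (pure R M N m n) = f m n"
proof -
  interpret P: module R P by fact
  note fD = bilinear_mapsD[OF f]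
  let ?h = "\<lambda>s. f (fst s) (snd s)"
  let ?g = "free_lift R P ?h"
  have h: "\<And>s. s \<in> carrier M \<times> carrier N \<Longrightarrow> ?h s \<in> carrier P" using fD(1) by auto
  have lin: "?g \<in> linear_maps R F P" by (rule free_lift_linear[OF P h])
  have gen: "?g (free_gen R (m, n)) = f m n" if "m \<in> carrier M" "n \<in> carrier N" for m n
    using free_lift_gen[OF P h, where t = "(m, n)"] that by simp
  note gs = linear_maps_add[OF lin] linear_maps_smult[OF lin] gen gen_closed
    linear_maps_minus[OF F.module_axioms P lin]
  have "tensor_relations R M N \<subseteq> {x \<in> carrier F. ?g x = \<zero>\<^bsub>P\<^esub>}"
    unfolding tensor_relations_def Let_def
    by (auto simp: gs fD) (auto simp: a_minus_def P.r_neg fD)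
  then have "tensor_kernel R M N \<subseteq> {x \<in> carrier F. ?g x = \<zero>\<^bsub>P\<^esub>}"
    unfolding tensor_kernel_def by (intro span_least submodule_kernel F.module_axioms P lin)
  then have ker: "\<And>x. x \<in> tensor_kernel R M N \<Longrightarrow> ?g x = \<zero>\<^bsub>P\<^esub>" by auto
  have eq: "tensor_lift R P f = (\<lambda>X. the_elem (?g ` X))"
    by (simp add: fun_eq_iff tensor_lift_def free_lift_def)
  show "tensor_lift R P f \<in> linear_maps R (tensor R M N) P"
    unfolding eq tensor_def by (rule Q.quotient_lift(2)[OF P lin ker])
  show "tensor_lift R P f (pure R M N m n) = f m n" if "m \<in> carrier M" "n \<in> carrier N"
    unfolding eq pure_def using gen_closed[OF that] that by (subst Q.quotient_lift(1)[OF P lin ker]) (simp_all add: gen)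
qed

end


section \<open>Sums of generators\<close>

inductive_set sums_of :: "('k, 'm, 'x) module_scheme \<Rightarrow> 'm set \<Rightarrow> 'm set"
  for M G where
  gen: "g \<in> G \<Longrightarrow> g \<in> sums_of M G"
| add: "\<lbrakk>x \<in> sums_of M G; y \<in> sums_of M G\<rbrakk> \<Longrightarrow> x \<oplus>\<^bsub>M\<^esub> y \<in> sums_of M G"

text \<open>When a set of generators is stable under scalars, finite sums of generators already form a
  submodule; minus signs come from the scalar \<open>-1\<close>. Pure tensors are such a set, so induction over
  a tensor product consists of a case for pure tensors and a case for sums.\<close>

lemma submodule_sums_of:
  assumes "module R M" "G \<subseteq> carrier M" "\<zero>\<^bsub>M\<^esub> \<in> G"
    and smult: "\<And>r g. \<lbrakk>r \<in> carrier R; g \<in> G\<rbrakk> \<Longrightarrow> r \<odot>\<^bsub>M\<^esub> g \<in> G"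
  shows "submodule (sums_of M G) R M"
proof -
  interpret M: module R M by fact
  have cl: "x \<in> carrier M" if "x \<in> sums_of M G" for x
    using that assms(2) by induction auto
  have sm: "r \<odot>\<^bsub>M\<^esub> x \<in> sums_of M G" if "r \<in> carrier R" "x \<in> sums_of M G" for r x
    using that(2) by induction (simp_all add: that(1) smult cl sums_of.intros M.smult_r_distr)
  show ?thesis
  proof (rule M.submoduleI)
    show "\<ominus>\<^bsub>M\<^esub> x \<in> sums_of M G" if "x \<in> sums_of M G" for x
      using sm[OF _ that, of "\<ominus>\<^bsub>R\<^esub> \<one>\<^bsub>R\<^esub>"] cl[OF that] by (simp add: M.smult_l_minus)
  qed (use cl sm assms(3) in \<open>auto intro: sums_of.intros\<close>)
qed

text \<open>The sum of two expressions in pure tensors is an expression in pure tensors: concatenate them.\<close>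

lemma (in abelian_monoid) finsum_append:
  assumes "\<And>i. i < n \<Longrightarrow> f i \<in> carrier G" "\<And>i. i < m \<Longrightarrow> g i \<in> carrier G"
  shows "(\<Oplus>i\<in>{..<n + m}. if i < n then f i else g (i - n)) = (\<Oplus>i\<in>{..<n}. f i) \<oplus> (\<Oplus>i\<in>{..<m::nat}. g i)"
  using assms(2)
proof (induction m)
  case 0
  have "(\<Oplus>i\<in>{..<n}. if i < n then f i else g (i - n)) = (\<Oplus>i\<in>{..<n}. f i)"
    using assms(1) by (intro finsum_cong') auto
  then show ?case using assms(1) by (simp add: Pi_def)
next
  case (Suc m)
  have 1: "{..<n + Suc m} = insert (n + m) {..<n + m}" "{..<Suc m} = insert m {..<m}" by auto
  show ?case
    unfolding 1 using assms(1) Suc by (simp add: Pi_def a_lcomm)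
qed

text \<open>Bimodule records carry further fields on top of an underlying module; the module axioms only
  see the four fields below.\<close>

lemma module_transfer:
  assumes "module R M" "carrier N = carrier M" "zero N = zero M"
    "add N = add M" "smult N = smult M"
  shows "module R N"
proof -
  interpret M: module R M by fact
  have "abelian_group N"
    by (rule abelian_groupI) (use M.l_neg in \<open>auto simp: assms(2-) M.a_ac\<close>)
  with M.R.is_cring show ?thesis
    by (rule moduleI) (simp_all add: assms(2-) M.smult_l_distr M.smult_r_distr M.smult_assoc1)
qed


section \<open>Automorphisms, Hom-algebras and Hom-modules\<close>

context hom_object
begin

lemma twist_closed [simp]: "m \<in> carrier M \<Longrightarrow> twist M m \<in> carrier M"
  and twist_add: "\<lbrakk>m \<in> carrier M; n \<in> carrier M\<rbrakk> \<Longrightarrow> twist M (m \<oplus>\<^bsub>M\<^esub> n) = twist M m \<oplus>\<^bsub>M\<^esub> twist M n"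
  and twist_smult: "\<lbrakk>r \<in> carrier R; m \<in> carrier M\<rbrakk> \<Longrightarrow> twist M (r \<odot>\<^bsub>M\<^esub> m) = r \<odot>\<^bsub>M\<^esub> twist M m"
  using twist_linear by (simp_all add: linear_maps_iff)

lemma inv_twist_closed [simp]: "m \<in> carrier M \<Longrightarrow> inv_twist M m \<in> carrier M"
  using bij_betw_inv_into[OF twist_bij] unfolding inv_twist_def by (rule bij_betw_apply)

lemma twist_inv_twist [simp]: "m \<in> carrier M \<Longrightarrow> twist M (inv_twist M m) = m"
  using twist_bij unfolding inv_twist_def by (rule bij_betw_inv_into_right)

lemma inv_twist_twist [simp]: "m \<in> carrier M \<Longrightarrow> inv_twist M (twist M m) = m"
  using twist_bij unfolding inv_twist_def by (rule bij_betw_inv_into_left)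

lemma inv_twist_eqI: "\<lbrakk>x \<in> carrier M; twist M x = y\<rbrakk> \<Longrightarrow> inv_twist M y = x"
  by auto

lemma inv_twist_add: "\<lbrakk>m \<in> carrier M; n \<in> carrier M\<rbrakk>
    \<Longrightarrow> inv_twist M (m \<oplus>\<^bsub>M\<^esub> n) = inv_twist M m \<oplus>\<^bsub>M\<^esub> inv_twist M n"
  by (rule inv_twist_eqI) (simp_all add: twist_add)

lemma inv_twist_smult: "\<lbrakk>r \<in> carrier R; m \<in> carrier M\<rbrakk>
    \<Longrightarrow> inv_twist M (r \<odot>\<^bsub>M\<^esub> m) = r \<odot>\<^bsub>M\<^esub> inv_twist M m"
  by (rule inv_twist_eqI) (simp_all add: twist_smult)

end

context hom_algebra
begin

lemma mult_closed [simp]: "\<lbrakk>a \<in> carrier A; b \<in> carrier A\<rbrakk> \<Longrightarrow> a \<otimes>\<^bsub>A\<^esub> b \<in> carrier A"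
  by (rule bilinear_mapsD(1)[OF mult_bilinear])

lemmas mult_add_left = bilinear_mapsD(2)[OF mult_bilinear]
  and mult_add_right = bilinear_mapsD(3)[OF mult_bilinear]
  and mult_smult_left = bilinear_mapsD(4)[OF mult_bilinear]
  and mult_smult_right = bilinear_mapsD(5)[OF mult_bilinear]

text \<open>Used as a rewrite rule, Hom-associativity in this form brings iterated products into left-nested
  form, at the price of automorphisms on the factors.\<close>

lemma mult_mult: "\<lbrakk>a \<in> carrier A; b \<in> carrier A; c \<in> carrier A\<rbrakk>
    \<Longrightarrow> a \<otimes>\<^bsub>A\<^esub> (b \<otimes>\<^bsub>A\<^esub> c) = (inv_twist A a \<otimes>\<^bsub>A\<^esub> b) \<otimes>\<^bsub>A\<^esub> twist A c"
  using hom_assoc[of "inv_twist A a" b c] by simp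

lemma inv_twist_mult: "\<lbrakk>a \<in> carrier A; b \<in> carrier A\<rbrakk>
    \<Longrightarrow> inv_twist A (a \<otimes>\<^bsub>A\<^esub> b) = inv_twist A a \<otimes>\<^bsub>A\<^esub> inv_twist A b"
  by (rule inv_twist_eqI) (simp_all add: twist_mult)

lemma inv_twist_unit: "inv_twist A \<one>\<^bsub>A\<^esub> = \<one>\<^bsub>A\<^esub>"
  by (rule inv_twist_eqI) (simp_all add: twist_unit unit_closed)

end

context left_hom_module
begin

lemma lact_closed [simp]: "\<lbrakk>a \<in> carrier A; m \<in> carrier M\<rbrakk> \<Longrightarrow> a \<triangleright>\<^bsub>M\<^esub> m \<in> carrier M"
  by (rule bilinear_mapsD(1)[OF lact_bilinear])

lemmas lact_add_left = bilinear_mapsD(2)[OF lact_bilinear]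
  and lact_add_right = bilinear_mapsD(3)[OF lact_bilinear]
  and lact_smult_left = bilinear_mapsD(4)[OF lact_bilinear]
  and lact_smult_right = bilinear_mapsD(5)[OF lact_bilinear]

lemma inv_twist_lact: "\<lbrakk>a \<in> carrier A; m \<in> carrier M\<rbrakk>
    \<Longrightarrow> inv_twist M (a \<triangleright>\<^bsub>M\<^esub> m) = inv_twist A a \<triangleright>\<^bsub>M\<^esub> inv_twist M m"
  by (rule M.inv_twist_eqI) (simp_all add: twist_lact)

end

context right_hom_module
begin

lemma ract_closed [simp]: "\<lbrakk>m \<in> carrier M; b \<in> carrier B\<rbrakk> \<Longrightarrow> m \<triangleleft>\<^bsub>M\<^esub> b \<in> carrier M"
  by (rule bilinear_mapsD(1)[OF ract_bilinear])

lemmas ract_add_left = bilinear_mapsD(2)[OF ract_bilinear]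
  and ract_add_right = bilinear_mapsD(3)[OF ract_bilinear]
  and ract_smult_left = bilinear_mapsD(4)[OF ract_bilinear]
  and ract_smult_right = bilinear_mapsD(5)[OF ract_bilinear]

lemma inv_twist_ract: "\<lbrakk>m \<in> carrier M; b \<in> carrier B\<rbrakk>
    \<Longrightarrow> inv_twist M (m \<triangleleft>\<^bsub>M\<^esub> b) = inv_twist M m \<triangleleft>\<^bsub>M\<^esub> inv_twist B b"
  by (rule M.inv_twist_eqI) (simp_all add: twist_ract)

end


section \<open>The universal property of the tensor product over a Hom-algebra\<close>

text \<open>The balancing relation \<open>m a \<otimes> n = \<mu>(m) \<otimes> a \<nu>\<^bsup>-1\<^esup>(n)\<close> with \<open>n\<close> replaced by \<open>\<nu>(n)\<close>, which avoids
  the inverse.\<close>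

definition balanced_maps ::
  "('k, 'r) ring_scheme \<Rightarrow> ('k, 'a, 'x) hom_mod_scheme \<Rightarrow> ('k, 'm, 'b, 'a, 'y) hom_bimod_scheme
    \<Rightarrow> ('k, 'n, 'a, 'c, 'z) hom_bimod_scheme \<Rightarrow> ('k, 'p, 'w) module_scheme \<Rightarrow> ('m \<Rightarrow> 'n \<Rightarrow> 'p) set"
  where "balanced_maps R A M N P =
    {f \<in> bilinear_maps R M N P. \<forall>m \<in> carrier M. \<forall>a \<in> carrier A. \<forall>n \<in> carrier N.
      f (m \<triangleleft>\<^bsub>M\<^esub> a) (twist N n) = f (twist M m) (a \<triangleright>\<^bsub>N\<^esub> n)}"

lemma balanced_mapsI:
  assumes "f \<in> bilinear_maps R M N P"
    "\<And>m a n. \<lbrakk>m \<in> carrier M; a \<in> carrier A; n \<in> carrier N\<rbrakk> \<Longrightarrow>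
      f (m \<triangleleft>\<^bsub>M\<^esub> a) (twist N n) = f (twist M m) (a \<triangleright>\<^bsub>N\<^esub> n)"
  shows "f \<in> balanced_maps R A M N P"
  using assms by (simp add: balanced_maps_def)

locale hom_tensor_product = M: right_hom_module R A M + N: left_hom_module R A N
  for R :: "('k, 'r) ring_scheme" and A :: "('k, 'a, 'x) hom_mod_scheme"
    and M :: "('k, 'm, 'b, 'a, 'y) hom_bimod_scheme"
    and N :: "('k, 'n, 'a, 'd, 'z) hom_bimod_scheme"
begin

sublocale T: tensor_product R M N
  by (intro tensor_product.intro M.M.module_axioms N.M.module_axioms)

sublocale T: module R "tensor R M N" by (rule T.tensor_module)

lemmas pure_closed = bilinear_mapsD(1)[OF T.pure_bilinear]

lemma balancing_relations_closed:
  "{pure R M N (m \<triangleleft>\<^bsub>M\<^esub> a) n \<ominus>\<^bsub>tensor R M N\<^esub> pure R M N (twist M m) (a \<triangleright>\<^bsub>N\<^esub> inv_twist N n) | m a n.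
        m \<in> carrier M \<and> a \<in> carrier A \<and> n \<in> carrier N} \<subseteq> carrier (tensor R M N)"
  by (auto intro!: T.minus_closed pure_closed)

sublocale Q: module_quotient R "tensor R M N" "balancing_kernel R A M N"
  by (intro module_quotient.intro module_quotient_axioms.intro T.tensor_module)
    (simp add: balancing_kernel_def submodule_span[OF T.tensor_module balancing_relations_closed])

lemma hom_tensor_simps:
  "carrier (hom_tensor R B A D M N) = a_rcosets\<^bsub>tensor R M N\<^esub> balancing_kernel R A M N"
  "zero (hom_tensor R B A D M N) = zero (quotient_module (tensor R M N) (balancing_kernel R A M N))"
  "add (hom_tensor R B A D M N) = add (quotient_module (tensor R M N) (balancing_kernel R A M N))"
  "smult (hom_tensor R B A D M N) = smult (quotient_module (tensor R M N) (balancing_kernel R A M N))"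
  by (simp_all add: hom_tensor_def Let_def)

lemma hom_tensor_module: "module R (hom_tensor R B A D M N)"
  by (rule module_transfer[OF Q.module_quotient_module]) (simp_all only: hom_tensor_simps quotient_module_simps(1))

lemma linear_maps_from_hom_tensor:
  "linear_maps R (hom_tensor R B A D M N) P
    = linear_maps R (quotient_module (tensor R M N) (balancing_kernel R A M N)) P"
  by (rule Set.set_eqI) (simp only: linear_maps_iff hom_tensor_simps quotient_module_simps(1))

lemma linear_maps_into_hom_tensor:
  "linear_maps R P (hom_tensor R B A D M N)
    = linear_maps R P (quotient_module (tensor R M N) (balancing_kernel R A M N))"
  by (rule Set.set_eqI) (simp only: linear_maps_iff hom_tensor_simps quotient_module_simps(1))

lemma hom_pure_bilinear: "hom_pure R A M N \<in> bilinear_maps R M N (hom_tensor R B A D M N)"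
proof -
  have lin: "(\<lambda>x. balancing_kernel R A M N +>\<^bsub>tensor R M N\<^esub> x)
      \<in> linear_maps R (tensor R M N) (hom_tensor R B A D M N)"
    using Q.coset_linear by (simp only: linear_maps_into_hom_tensor)
  have eq: "hom_pure R A M N
      = (\<lambda>m n. balancing_kernel R A M N +>\<^bsub>tensor R M N\<^esub> pure R M N m n)"
    by (simp add: fun_eq_iff hom_pure_def)
  show ?thesis
    unfolding eq
    using linear_maps_comp[OF bilinear_maps_left[OF T.pure_bilinear] lin]
      linear_maps_comp[OF bilinear_maps_right[OF T.pure_bilinear] lin]
    by (simp add: bilinear_maps_def)
qed

lemma hom_pure_balanced: "hom_pure R A M N \<in> balanced_maps R A M N (hom_tensor R B A D M N)"
proof (rule balanced_mapsI[OF hom_pure_bilinear])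
  fix m a n assume mem: "m \<in> carrier M" "a \<in> carrier A" "n \<in> carrier N"
  let ?X = "{pure R M N (m \<triangleleft>\<^bsub>M\<^esub> a) n \<ominus>\<^bsub>tensor R M N\<^esub> pure R M N (twist M m) (a \<triangleright>\<^bsub>N\<^esub> inv_twist N n) | m a n.
        m \<in> carrier M \<and> a \<in> carrier A \<and> n \<in> carrier N}"
  have "pure R M N (m \<triangleleft>\<^bsub>M\<^esub> a) (twist N n)
      \<ominus>\<^bsub>tensor R M N\<^esub> pure R M N (twist M m) (a \<triangleright>\<^bsub>N\<^esub> inv_twist N (twist N n)) \<in> ?X"
    using mem by (intro CollectI exI[of _ m] exI[of _ a] exI[of _ "twist N n"] conjI refl) simp_all
  then have "pure R M N (m \<triangleleft>\<^bsub>M\<^esub> a) (twist N n)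
      \<ominus>\<^bsub>tensor R M N\<^esub> pure R M N (twist M m) (a \<triangleright>\<^bsub>N\<^esub> n) \<in> balancing_kernel R A M N"
    using mem span_superset[of ?X R "tensor R M N"]
    unfolding balancing_kernel_def by (simp add: subset_iff)
  then show "hom_pure R A M N (m \<triangleleft>\<^bsub>M\<^esub> a) (twist N n) = hom_pure R A M N (twist M m) (a \<triangleright>\<^bsub>N\<^esub> n)"
    unfolding hom_pure_def using mem by (intro Q.coset_eqI pure_closed) simp_all
qed

lemma hom_pure_balance:
  "\<lbrakk>m \<in> carrier M; a \<in> carrier A; n \<in> carrier N\<rbrakk> \<Longrightarrow>
    hom_pure R A M N (m \<triangleleft>\<^bsub>M\<^esub> a) (twist N n) = hom_pure R A M N (twist M m) (a \<triangleright>\<^bsub>N\<^esub> n)"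
  using hom_pure_balanced unfolding balanced_maps_def by blast

text \<open>The existence half of the universal property. The tensor product over \<open>A\<close> is a quotient of the
  tensor product over the ground ring, so the map is obtained by lifting twice; the balancing
  condition says that the first lift kills the balancing kernel.\<close>

lemma hom_tensor_lift:
  assumes P: "module R P" and f: "f \<in> balanced_maps R A M N P"
  shows "hom_tensor_lift R P f \<in> linear_maps R (hom_tensor R B A D M N) P"
    and "\<lbrakk>m \<in> carrier M; n \<in> carrier N\<rbrakk> \<Longrightarrow> hom_tensor_lift R P f (hom_pure R A M N m n) = f m n"
proof -
  interpret P: module R P by fact
  have bil: "f \<in> bilinear_maps R M N P"
    and bal: "\<And>m a n. \<lbrakk>m \<in> carrier M; a \<in> carrier A; n \<in> carrier N\<rbrakk> \<Longrightarrow>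
      f (m \<triangleleft>\<^bsub>M\<^esub> a) (twist N n) = f (twist M m) (a \<triangleright>\<^bsub>N\<^esub> n)"
    using f by (auto simp: balanced_maps_def)
  let ?g = "tensor_lift R P f"
  note lin = T.tensor_lift(1)[OF P bil] and val = T.tensor_lift(2)[OF P bil]
  have "balancing_kernel R A M N \<subseteq> {x \<in> carrier (tensor R M N). ?g x = \<zero>\<^bsub>P\<^esub>}"
    unfolding balancing_kernel_def
  proof (intro span_least submodule_kernel T.tensor_module P lin subsetI)
    fix x assume "x \<in> {pure R M N (m \<triangleleft>\<^bsub>M\<^esub> a) n \<ominus>\<^bsub>tensor R M N\<^esub> pure R M N (twist M m) (a \<triangleright>\<^bsub>N\<^esub> inv_twist N n) | m a n.
        m \<in> carrier M \<and> a \<in> carrier A \<and> n \<in> carrier N}"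
    then obtain m a n where mem: "m \<in> carrier M" "a \<in> carrier A" "n \<in> carrier N"
      and x: "x = pure R M N (m \<triangleleft>\<^bsub>M\<^esub> a) n \<ominus>\<^bsub>tensor R M N\<^esub> pure R M N (twist M m) (a \<triangleright>\<^bsub>N\<^esub> inv_twist N n)"
      by blast
    have "?g x = f (m \<triangleleft>\<^bsub>M\<^esub> a) n \<ominus>\<^bsub>P\<^esub> f (twist M m) (a \<triangleright>\<^bsub>N\<^esub> inv_twist N n)"
      unfolding x using mem
      by (simp add: linear_maps_minus[OF T.tensor_module P lin] pure_closed val)
    also have "\<dots> = \<zero>\<^bsub>P\<^esub>"
      using mem bal[of m a "inv_twist N n"] bilinear_mapsD(1)[OF bil]
      by (simp add: a_minus_def P.r_neg)
    finally show "x \<in> {x \<in> carrier (tensor R M N). ?g x = \<zero>\<^bsub>P\<^esub>}"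
      using mem by (simp add: x pure_closed)
  qed
  then have ker: "\<And>x. x \<in> balancing_kernel R A M N \<Longrightarrow> ?g x = \<zero>\<^bsub>P\<^esub>" by auto
  have eq: "hom_tensor_lift R P f = (\<lambda>X. the_elem (?g ` X))"
    by (simp add: fun_eq_iff hom_tensor_lift_def)
  show "hom_tensor_lift R P f \<in> linear_maps R (hom_tensor R B A D M N) P"
    unfolding eq linear_maps_from_hom_tensor by (rule Q.quotient_lift(2)[OF P lin ker])
  show "hom_tensor_lift R P f (hom_pure R A M N m n) = f m n" if "m \<in> carrier M" "n \<in> carrier N"
    unfolding eq hom_pure_def using pure_closed[OF that] that
    by (subst Q.quotient_lift(1)[OF P lin ker]) (simp_all add: val)
qed

lemma hom_tensor_generated:
  assumes "submodule H R (hom_tensor R B A D M N)"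
    and "\<And>m n. \<lbrakk>m \<in> carrier M; n \<in> carrier N\<rbrakk> \<Longrightarrow> hom_pure R A M N m n \<in> H"
    and "z \<in> carrier (hom_tensor R B A D M N)"
  shows "z \<in> H"
proof -
  let ?c = "\<lambda>x. balancing_kernel R A M N +>\<^bsub>tensor R M N\<^esub> x"
  have "?c \<in> linear_maps R (tensor R M N) (hom_tensor R B A D M N)"
    using Q.coset_linear by (simp only: linear_maps_into_hom_tensor)
  then have "submodule {x \<in> carrier (tensor R M N). ?c x \<in> H} R (tensor R M N)"
    by (rule submodule_vimage[OF T.tensor_module hom_tensor_module _ assms(1)])
  then have "x \<in> {x \<in> carrier (tensor R M N). ?c x \<in> H}" if "x \<in> carrier (tensor R M N)" for x
    by (rule T.tensor_generated[OF _ _ that])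
      (use assms(2) pure_closed in \<open>auto simp: hom_pure_def\<close>)
  moreover obtain x where "x \<in> carrier (tensor R M N)" "z = ?c x"
    using assms(3) by (auto simp: hom_tensor_simps A_RCOSETS_def')
  ultimately show ?thesis by blast
qed

text \<open>Sums of pure tensors form a submodule: \<open>r (m \<otimes> n) = (r m) \<otimes> n\<close>, and zero is \<open>0 \<otimes> 0\<close>. Hence they
  exhaust \<open>M \<otimes>\<^sub>A N\<close>.\<close>

lemma hom_tensor_induct [consumes 1, case_names pure add]:
  assumes z: "z \<in> carrier (hom_tensor R B A D M N)"
    and pure: "\<And>m n. \<lbrakk>m \<in> carrier M; n \<in> carrier N\<rbrakk> \<Longrightarrow> Q (hom_pure R A M N m n)"
    and add: "\<And>x y. \<lbrakk>x \<in> carrier (hom_tensor R B A D M N); y \<in> carrier (hom_tensor R B A D M N);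
      Q x; Q y\<rbrakk> \<Longrightarrow> Q (x \<oplus>\<^bsub>hom_tensor R B A D M N\<^esub> y)"
  shows "Q z"
proof -
  let ?T = "hom_tensor R B A D M N"
  let ?G = "{hom_pure R A M N m n | m n. m \<in> carrier M \<and> n \<in> carrier N}"
  interpret HT: module R ?T by (rule hom_tensor_module)
  note hp = hom_pure_bilinear[of B D]
  note cl = bilinear_mapsD(1)[OF hp]
  have zero: "\<zero>\<^bsub>?T\<^esub> = hom_pure R A M N \<zero>\<^bsub>M\<^esub> \<zero>\<^bsub>N\<^esub>"
    using bilinear_maps_right[OF hp, of "\<zero>\<^bsub>M\<^esub>"]
    by (simp add: linear_maps_zero[OF N.M.module_axioms hom_tensor_module])
  have sm: "r \<odot>\<^bsub>?T\<^esub> g \<in> ?G" if r: "r \<in> carrier R" and g: "g \<in> ?G" for r g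
  proof -
    from g obtain m n where "m \<in> carrier M" "n \<in> carrier N" "g = hom_pure R A M N m n" by blast
    then have "r \<odot>\<^bsub>?T\<^esub> g = hom_pure R A M N (r \<odot>\<^bsub>M\<^esub> m) n" "r \<odot>\<^bsub>M\<^esub> m \<in> carrier M"
      using r by (simp_all add: bilinear_mapsD(4)[OF hp])
    then show ?thesis using \<open>n \<in> carrier N\<close> by blast
  qed
  have GT: "?G \<subseteq> carrier ?T" using cl by blast
  have "\<zero>\<^bsub>?T\<^esub> \<in> ?G" unfolding zero by blast
  then have sub: "submodule (sums_of ?T ?G) R ?T"
    using GT sm by (intro submodule_sums_of hom_tensor_module)
  have "z \<in> sums_of ?T ?G"
    by (rule hom_tensor_generated[OF sub _ z]) (rule sums_of.gen, blast)
  then have "z \<in> carrier ?T \<and> Q z"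
    by induction (use pure cl add in auto)
  then show ?thesis ..
qed

lemma hom_tensor_ext:
  assumes "f \<in> linear_maps R (hom_tensor R B A D M N) P" "g \<in> linear_maps R (hom_tensor R B A D M N) P"
    and "\<And>m n. \<lbrakk>m \<in> carrier M; n \<in> carrier N\<rbrakk> \<Longrightarrow> f (hom_pure R A M N m n) = g (hom_pure R A M N m n)"
    and "z \<in> carrier (hom_tensor R B A D M N)"
  shows "f z = g z"
  using assms(4) by (induction rule: hom_tensor_induct)
    (simp_all add: assms(3) linear_maps_add[OF assms(1)] linear_maps_add[OF assms(2)])

lemma hom_tensor_expression:
  assumes "z \<in> carrier (hom_tensor R B A D M N)"
  shows "\<exists>k x y. (\<forall>i<k::nat. x i \<in> carrier M \<and> y i \<in> carrier N) \<and>
    z = (\<Oplus>\<^bsub>hom_tensor R B A D M N\<^esub>i\<in>{..<k}. hom_pure R A M N (x i) (y i))"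
proof -
  let ?T = "hom_tensor R B A D M N"
  interpret HT: module R ?T by (rule hom_tensor_module)
  note cl = bilinear_mapsD(1)[OF hom_pure_bilinear[of B D]]
  show ?thesis
    using assms
  proof (induction rule: hom_tensor_induct)
    case (pure m n)
    then have "hom_pure R A M N m n = (\<Oplus>\<^bsub>?T\<^esub>i\<in>{..<Suc 0}. hom_pure R A M N m n)"
      by (simp add: lessThan_Suc cl)
    then show ?case using pure
      by (intro exI[of _ "Suc 0"] exI[of _ "\<lambda>_. m"] exI[of _ "\<lambda>_. n"]) simp
  next
    case (add u v)
    from add.IH(1) obtain k x y where 1: "\<And>i. i < k \<Longrightarrow> x i \<in> carrier M \<and> y i \<in> carrier N"
      "u = (\<Oplus>\<^bsub>?T\<^esub>i\<in>{..<k::nat}. hom_pure R A M N (x i) (y i))" by blast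
    from add.IH(2) obtain l x' y' where 2: "\<And>i. i < l \<Longrightarrow> x' i \<in> carrier M \<and> y' i \<in> carrier N"
      "v = (\<Oplus>\<^bsub>?T\<^esub>i\<in>{..<l::nat}. hom_pure R A M N (x' i) (y' i))" by blast
    have "u \<oplus>\<^bsub>?T\<^esub> v = (\<Oplus>\<^bsub>?T\<^esub>i\<in>{..<k + l}. if i < k then hom_pure R A M N (x i) (y i)
        else hom_pure R A M N (x' (i - k)) (y' (i - k)))"
      unfolding 1(2) 2(2) using 1(1) 2(1) cl by (intro HT.finsum_append[symmetric]) auto
    also have "\<dots> = (\<Oplus>\<^bsub>?T\<^esub>i\<in>{..<k + l}. hom_pure R A M N
        (if i < k then x i else x' (i - k)) (if i < k then y i else y' (i - k)))"
      using 1(1) 2(1) cl by (intro HT.finsum_cong') auto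
    finally show ?case
      using 1(1) 2(1)
      by (intro exI[of _ "k + l"] exI[of _ "\<lambda>i. if i < k then x i else x' (i - k)"]
          exI[of _ "\<lambda>i. if i < k then y i else y' (i - k)"]) auto
  qed
qed

text \<open>A family of lifts \<open>G k\<close> depends linearly on its parameter as soon as it does so on pure tensors.
  This is how lifts of lifts are seen to be bilinear.\<close>

lemma hom_tensor_linear_param:
  assumes P: "module R P" and "module R K"
    and G: "\<And>k. k \<in> carrier K \<Longrightarrow> G k \<in> linear_maps R (hom_tensor R B A D M N) P"
    and pure: "\<And>m n. \<lbrakk>m \<in> carrier M; n \<in> carrier N\<rbrakk> \<Longrightarrow>
      (\<lambda>k. G k (hom_pure R A M N m n)) \<in> linear_maps R K P"
    and z: "z \<in> carrier (hom_tensor R B A D M N)"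
  shows "(\<lambda>k. G k z) \<in> linear_maps R K P"
  using z
proof (induction rule: hom_tensor_induct)
  case (add x y)
  show ?case
    by (rule linear_maps_cong[OF \<open>module R K\<close> _ linear_maps_plus[OF P add.IH]])
      (rule linear_maps_add[OF G add.hyps])
qed (rule pure)

end


section \<open>Tensor products of bimodules\<close>

context hom_bimodule
begin

lemma lact_ract_swap: "\<lbrakk>a \<in> carrier A; m \<in> carrier M; b \<in> carrier B\<rbrakk>
    \<Longrightarrow> a \<triangleright>\<^bsub>M\<^esub> (m \<triangleleft>\<^bsub>M\<^esub> b) = (inv_twist A a \<triangleright>\<^bsub>M\<^esub> m) \<triangleleft>\<^bsub>M\<^esub> twist B b"
  using lact_ract[of "inv_twist A a" m b] by simp

end

locale hom_tensor_bimodule = M: hom_bimodule R B A M + N: hom_bimodule R A D N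
  for R :: "('k, 'r) ring_scheme" and B :: "('k, 'b, 'u) hom_mod_scheme"
    and A :: "('k, 'a, 'x) hom_mod_scheme" and D :: "('k, 'd, 'w) hom_mod_scheme"
    and M :: "('k, 'm, 'b, 'a, 'y) hom_bimod_scheme"
    and N :: "('k, 'n, 'a, 'd, 'z) hom_bimod_scheme"
begin

sublocale hom_tensor_product R A M N
  by (intro hom_tensor_product.intro M.right_hom_module_axioms N.left_hom_module_axioms)

abbreviation "MN \<equiv> hom_tensor R B A D M N"
abbreviation mn_pure (infixl \<open>\<bullet>\<close> 70) where "m \<bullet> n \<equiv> hom_pure R A M N m n"

sublocale MN: module R MN by (rule hom_tensor_module)

lemmas tp_closed [simp] = bilinear_mapsD(1)[OF hom_pure_bilinear[of B D]]
  and tp_add_left = bilinear_mapsD(2)[OF hom_pure_bilinear[of B D]]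
  and tp_add_right = bilinear_mapsD(3)[OF hom_pure_bilinear[of B D]]
  and tp_smult_left = bilinear_mapsD(4)[OF hom_pure_bilinear[of B D]]
  and tp_smult_right = bilinear_mapsD(5)[OF hom_pure_bilinear[of B D]]

lemmas mn_induct = hom_tensor_induct[of _ B D, consumes 1, case_names pure add]

text \<open>The automorphism and the actions of \<open>M \<otimes>\<^sub>A N\<close> are lifts with values in the bare quotient module;
  that module has the same carrier, addition and scalars as \<open>M \<otimes>\<^sub>A N\<close> itself.\<close>

lemma lift_into_quotient:
  assumes "f \<in> balanced_maps R A M N MN"
  defines "g \<equiv> hom_tensor_lift R (quotient_module (tensor R M N) (balancing_kernel R A M N)) f"
  shows "g \<in> linear_maps R MN MN"
    and "\<And>m n. \<lbrakk>m \<in> carrier M; n \<in> carrier N\<rbrakk> \<Longrightarrow> g (m \<bullet> n) = f m n"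
proof -
  have "f \<in> balanced_maps R A M N (quotient_module (tensor R M N) (balancing_kernel R A M N))"
    using assms(1) unfolding balanced_maps_def bilinear_maps_def
    by (simp only: linear_maps_into_hom_tensor mem_Collect_eq)
  note hom_tensor_lift[OF Q.module_quotient_module this]
  then show "g \<in> linear_maps R MN MN"
    and "\<And>m n. \<lbrakk>m \<in> carrier M; n \<in> carrier N\<rbrakk> \<Longrightarrow> g (m \<bullet> n) = f m n"
    unfolding g_def by (simp_all only: linear_maps_into_hom_tensor)
qed

lemma twist_balanced: "(\<lambda>m n. twist M m \<bullet> twist N n) \<in> balanced_maps R A M N MN"
proof (intro balanced_mapsI bilinear_mapsI)
  fix m a n assume [simp]: "m \<in> carrier M" "a \<in> carrier A" "n \<in> carrier N"
  show "twist M (m \<triangleleft>\<^bsub>M\<^esub> a) \<bullet> twist N (twist N n) = twist M (twist M m) \<bullet> twist N (a \<triangleright>\<^bsub>N\<^esub> n)"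
    by (simp add: M.twist_ract N.twist_lact hom_pure_balance)
qed (simp_all add: M.M.twist_add M.M.twist_smult N.M.twist_add N.M.twist_smult
    tp_add_left tp_add_right tp_smult_left tp_smult_right)

lemma lact_balanced:
  assumes [simp]: "b \<in> carrier B"
  shows "(\<lambda>m n. (inv_twist B b \<triangleright>\<^bsub>M\<^esub> m) \<bullet> twist N n) \<in> balanced_maps R A M N MN"
proof (intro balanced_mapsI bilinear_mapsI)
  fix m a n assume [simp]: "m \<in> carrier M" "a \<in> carrier A" "n \<in> carrier N"
  show "(inv_twist B b \<triangleright>\<^bsub>M\<^esub> (m \<triangleleft>\<^bsub>M\<^esub> a)) \<bullet> twist N (twist N n)
      = (inv_twist B b \<triangleright>\<^bsub>M\<^esub> twist M m) \<bullet> twist N (a \<triangleright>\<^bsub>N\<^esub> n)"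
    by (simp add: M.lact_ract_swap M.twist_lact N.twist_lact hom_pure_balance)
qed (simp_all add: M.lact_add_right M.lact_smult_right N.M.twist_add N.M.twist_smult
    tp_add_left tp_add_right tp_smult_left tp_smult_right)

lemma ract_balanced:
  assumes [simp]: "d \<in> carrier D"
  shows "(\<lambda>m n. twist M m \<bullet> (n \<triangleleft>\<^bsub>N\<^esub> inv_twist D d)) \<in> balanced_maps R A M N MN"
proof (intro balanced_mapsI bilinear_mapsI)
  fix m a n assume [simp]: "m \<in> carrier M" "a \<in> carrier A" "n \<in> carrier N"
  have "twist N n \<triangleleft>\<^bsub>N\<^esub> inv_twist D d = twist N (n \<triangleleft>\<^bsub>N\<^esub> inv_twist D (inv_twist D d))"
    by (simp add: N.twist_ract)
  then show "twist M (m \<triangleleft>\<^bsub>M\<^esub> a) \<bullet> (twist N n \<triangleleft>\<^bsub>N\<^esub> inv_twist D d)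
      = twist M (twist M m) \<bullet> ((a \<triangleright>\<^bsub>N\<^esub> n) \<triangleleft>\<^bsub>N\<^esub> inv_twist D d)"
    using N.lact_ract[of a n "inv_twist D (inv_twist D d)"]
    by (simp add: M.twist_ract hom_pure_balance)
qed (simp_all add: M.M.twist_add M.M.twist_smult N.ract_add_left N.ract_smult_left
    tp_add_left tp_add_right tp_smult_left tp_smult_right)

lemma MN_ops:
  "twist MN = hom_tensor_lift R (quotient_module (tensor R M N) (balancing_kernel R A M N))
    (\<lambda>m n. twist M m \<bullet> twist N n)"
  "lact MN b = hom_tensor_lift R (quotient_module (tensor R M N) (balancing_kernel R A M N))
    (\<lambda>m n. (inv_twist B b \<triangleright>\<^bsub>M\<^esub> m) \<bullet> twist N n)"
  "(\<lambda>z. ract MN z d) = hom_tensor_lift R (quotient_module (tensor R M N) (balancing_kernel R A M N))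
    (\<lambda>m n. twist M m \<bullet> (n \<triangleleft>\<^bsub>N\<^esub> inv_twist D d))"
  by (simp_all add: hom_tensor_def Let_def)

lemmas MN_twist_linear = lift_into_quotient(1)[OF twist_balanced, folded MN_ops(1)]
  and MN_lact_linear = lift_into_quotient(1)[OF lact_balanced, folded MN_ops(2)]
  and MN_ract_linear = lift_into_quotient(1)[OF ract_balanced, folded MN_ops(3)]

lemma twist_tp: "\<lbrakk>m \<in> carrier M; n \<in> carrier N\<rbrakk> \<Longrightarrow> twist MN (m \<bullet> n) = twist M m \<bullet> twist N n"
  unfolding MN_ops by (rule lift_into_quotient(2)[OF twist_balanced])

lemma lact_tp: "\<lbrakk>b \<in> carrier B; m \<in> carrier M; n \<in> carrier N\<rbrakk>
    \<Longrightarrow> b \<triangleright>\<^bsub>MN\<^esub> (m \<bullet> n) = (inv_twist B b \<triangleright>\<^bsub>M\<^esub> m) \<bullet> twist N n"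
  unfolding MN_ops by (rule lift_into_quotient(2)[OF lact_balanced])

lemma ract_tp: "\<lbrakk>d \<in> carrier D; m \<in> carrier M; n \<in> carrier N\<rbrakk>
    \<Longrightarrow> (m \<bullet> n) \<triangleleft>\<^bsub>MN\<^esub> d = twist M m \<bullet> (n \<triangleleft>\<^bsub>N\<^esub> inv_twist D d)"
  using lift_into_quotient(2)[OF ract_balanced, folded MN_ops(3)] by simp

text \<open>Bijectivity of \<open>\<mu> \<otimes> \<nu>\<close> comes from an explicit inverse, the lift of \<open>\<mu>\<^bsup>-1\<^esup> \<otimes> \<nu>\<^bsup>-1\<^esup>\<close>.\<close>

lemma twist_inverse:
  "\<exists>g \<in> linear_maps R MN MN. \<forall>m \<in> carrier M. \<forall>n \<in> carrier N.
    g (m \<bullet> n) = inv_twist M m \<bullet> inv_twist N n"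
proof -
  have "(\<lambda>m n. inv_twist M m \<bullet> inv_twist N n) \<in> balanced_maps R A M N MN"
  proof (intro balanced_mapsI bilinear_mapsI)
    fix m a n assume [simp]: "m \<in> carrier M" "a \<in> carrier A" "n \<in> carrier N"
    show "inv_twist M (m \<triangleleft>\<^bsub>M\<^esub> a) \<bullet> inv_twist N (twist N n)
        = inv_twist M (twist M m) \<bullet> inv_twist N (a \<triangleright>\<^bsub>N\<^esub> n)"
      using hom_pure_balance[of "inv_twist M m" "inv_twist A a" "inv_twist N n"]
      by (simp add: M.inv_twist_ract N.inv_twist_lact)
  qed (simp_all add: M.M.inv_twist_add M.M.inv_twist_smult N.M.inv_twist_add N.M.inv_twist_smult
      tp_add_left tp_add_right tp_smult_left tp_smult_right)
  from lift_into_quotient[OF this] show ?thesis by blast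
qed

sublocale MN: hom_object R MN
proof
  show "twist MN \<in> linear_maps R MN MN" by (rule MN_twist_linear)
  obtain g where g: "g \<in> linear_maps R MN MN"
    "\<And>m n. \<lbrakk>m \<in> carrier M; n \<in> carrier N\<rbrakk> \<Longrightarrow> g (m \<bullet> n) = inv_twist M m \<bullet> inv_twist N n"
    using twist_inverse by blast
  have id: "(\<lambda>z. z) \<in> linear_maps R MN MN" by (rule linear_mapsI) simp_all
  have 1: "g (twist MN z) = z" if "z \<in> carrier MN" for z
    by (rule hom_tensor_ext[OF linear_maps_comp[OF MN_twist_linear g(1)] id _ that])
      (simp add: twist_tp g(2))
  have 2: "twist MN (g z) = z" if "z \<in> carrier MN" for z
    by (rule hom_tensor_ext[OF linear_maps_comp[OF g(1) MN_twist_linear] id _ that])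
      (simp add: twist_tp g(2))
  show "bij_betw (twist MN) (carrier MN) (carrier MN)"
    by (rule bij_betw_byWitness[where f' = g])
      (use 1 2 linear_maps_closed[OF MN_twist_linear] linear_maps_closed[OF g(1)] in auto)
qed

lemma MN_lact_bilinear: "(\<lambda>b z. b \<triangleright>\<^bsub>MN\<^esub> z) \<in> bilinear_maps R B MN MN"
proof -
  have "(\<lambda>b. b \<triangleright>\<^bsub>MN\<^esub> z) \<in> linear_maps R B MN" if "z \<in> carrier MN" for z
  proof (rule hom_tensor_linear_param[OF MN.module_axioms M.A.module_axioms MN_lact_linear _ that])
    show "(\<lambda>b. b \<triangleright>\<^bsub>MN\<^esub> (m \<bullet> n)) \<in> linear_maps R B MN" if "m \<in> carrier M" "n \<in> carrier N" for m n
      using that by (intro linear_mapsI) (simp_all add: lact_tp M.A.inv_twist_add M.A.inv_twist_smult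
        M.lact_add_left M.lact_smult_left tp_add_left tp_smult_left)
  qed
  then show ?thesis unfolding bilinear_maps_def using MN_lact_linear by simp
qed

lemma MN_ract_bilinear: "(\<lambda>z d. z \<triangleleft>\<^bsub>MN\<^esub> d) \<in> bilinear_maps R MN D MN"
proof -
  have "(\<lambda>d. z \<triangleleft>\<^bsub>MN\<^esub> d) \<in> linear_maps R D MN" if "z \<in> carrier MN" for z
  proof (rule hom_tensor_linear_param[OF MN.module_axioms N.B.module_axioms MN_ract_linear _ that])
    show "(\<lambda>d. (m \<bullet> n) \<triangleleft>\<^bsub>MN\<^esub> d) \<in> linear_maps R D MN" if "m \<in> carrier M" "n \<in> carrier N" for m n
      using that by (intro linear_mapsI) (simp_all add: ract_tp N.B.inv_twist_add N.B.inv_twist_smult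
        N.ract_add_right N.ract_smult_right tp_add_right tp_smult_right)
  qed
  then show ?thesis unfolding bilinear_maps_def using MN_ract_linear by simp
qed

lemmas MN_add = MN.twist_add bilinear_mapsD(2,3)[OF MN_lact_bilinear] bilinear_mapsD(2,3)[OF MN_ract_bilinear]
lemmas MN_closed [simp] = bilinear_mapsD(1)[OF MN_lact_bilinear] bilinear_mapsD(1)[OF MN_ract_bilinear]

text \<open>Each axiom is additive in the element of \<open>M \<otimes>\<^sub>A N\<close>. On pure tensors the axioms of the left
  structure reduce to those of \<open>M\<close> and the axioms of the right structure to those of \<open>N\<close>.\<close>

lemma hom_tensor_bimodule: "hom_bimodule R B D MN"
proof (intro_locales)
  show "left_hom_module_axioms R B MN"
  proof
    show "(\<lambda>b z. b \<triangleright>\<^bsub>MN\<^esub> z) \<in> bilinear_maps R B MN MN" by (rule MN_lact_bilinear)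
  next
    fix a b z assume [simp]: "a \<in> carrier B" "b \<in> carrier B" and z: "z \<in> carrier MN"
    from z show "twist B a \<triangleright>\<^bsub>MN\<^esub> (b \<triangleright>\<^bsub>MN\<^esub> z) = (a \<otimes>\<^bsub>B\<^esub> b) \<triangleright>\<^bsub>MN\<^esub> twist MN z"
    proof (induction rule: mn_induct)
      case (pure m n)
      then show ?case using M.lact_assoc[of "inv_twist B a" "inv_twist B b" m]
        by (simp add: lact_tp twist_tp M.A.inv_twist_mult)
    qed (simp add: MN_add)
  next
    fix z assume "z \<in> carrier MN"
    then show "\<one>\<^bsub>B\<^esub> \<triangleright>\<^bsub>MN\<^esub> z = twist MN z"
      by (induction rule: mn_induct)
        (simp_all add: MN_add lact_tp twist_tp M.A.unit_closed M.A.inv_twist_unit M.lact_unit)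
  next
    fix a z assume [simp]: "a \<in> carrier B" and z: "z \<in> carrier MN"
    from z show "twist MN (a \<triangleright>\<^bsub>MN\<^esub> z) = twist B a \<triangleright>\<^bsub>MN\<^esub> twist MN z"
      by (induction rule: mn_induct) (simp_all add: MN_add lact_tp twist_tp M.twist_lact)
  qed
  show "right_hom_module_axioms R D MN"
  proof
    show "(\<lambda>z d. z \<triangleleft>\<^bsub>MN\<^esub> d) \<in> bilinear_maps R MN D MN" by (rule MN_ract_bilinear)
  next
    fix z a b assume z: "z \<in> carrier MN" and [simp]: "a \<in> carrier D" "b \<in> carrier D"
    from z show "twist MN z \<triangleleft>\<^bsub>MN\<^esub> (a \<otimes>\<^bsub>D\<^esub> b) = (z \<triangleleft>\<^bsub>MN\<^esub> a) \<triangleleft>\<^bsub>MN\<^esub> twist D b"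
    proof (induction rule: mn_induct)
      case (pure m n)
      then show ?case using N.ract_assoc[of n "inv_twist D a" "inv_twist D b"]
        by (simp add: ract_tp twist_tp N.B.inv_twist_mult)
    qed (simp add: MN_add)
  next
    fix z assume "z \<in> carrier MN"
    then show "z \<triangleleft>\<^bsub>MN\<^esub> \<one>\<^bsub>D\<^esub> = twist MN z"
      by (induction rule: mn_induct)
        (simp_all add: MN_add ract_tp twist_tp N.B.unit_closed N.B.inv_twist_unit N.ract_unit)
  next
    fix z a assume z: "z \<in> carrier MN" and [simp]: "a \<in> carrier D"
    from z show "twist MN (z \<triangleleft>\<^bsub>MN\<^esub> a) = twist MN z \<triangleleft>\<^bsub>MN\<^esub> twist D a"
      by (induction rule: mn_induct) (simp_all add: MN_add ract_tp twist_tp N.twist_ract)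
  qed
  show "hom_bimodule_axioms B D MN"
  proof
    fix a z b assume [simp]: "a \<in> carrier B" "b \<in> carrier D" and z: "z \<in> carrier MN"
    from z show "(a \<triangleright>\<^bsub>MN\<^esub> z) \<triangleleft>\<^bsub>MN\<^esub> twist D b = twist B a \<triangleright>\<^bsub>MN\<^esub> (z \<triangleleft>\<^bsub>MN\<^esub> b)"
      by (induction rule: mn_induct) (simp_all add: MN_add ract_tp lact_tp M.twist_lact N.twist_ract)
  qed
qed

sublocale MN: hom_bimodule R B D MN by (rule hom_tensor_bimodule)

end

definition triple_lift ::
  "('k, 'r) ring_scheme \<Rightarrow> ('k, 'p, 'z) module_scheme \<Rightarrow> ('m \<Rightarrow> 'n \<Rightarrow> 'l \<Rightarrow> 'p)
    \<Rightarrow> (('m \<times> 'n \<Rightarrow> 'k) set set \<times> 'l \<Rightarrow> 'k) set set \<Rightarrow> 'p"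
  where "triple_lift R P f
    = hom_tensor_lift R P (\<lambda>z k. hom_tensor_lift R P (\<lambda>m n. f m n k) z)"

text \<open>The universal property of \<open>(M \<otimes>\<^sub>A N) \<otimes>\<^bsub>A'\<^esub> K\<close> for maps of three variables. The last hypothesis is
  the balancing relation between \<open>M \<otimes>\<^sub>A N\<close> and \<open>K\<close>: the right action on \<open>m \<otimes> n\<close> is
  \<open>\<mu>(m) \<otimes> n \<alpha>'\<^bsup>-1\<^esup>(a)\<close>, where \<open>\<alpha>'\<close> is the automorphism of \<open>A'\<close>, and the variables have been shifted
  by automorphisms so that no inverse is left.\<close>

lemma triple_lift:
  assumes "hom_tensor_bimodule R B A A' M N" "left_hom_module R A' K" "module R P"
    and f: "\<And>k. k \<in> carrier K \<Longrightarrow> (\<lambda>m n. f m n k) \<in> balanced_maps R A M N P"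
    and f3: "\<And>m n. \<lbrakk>m \<in> carrier M; n \<in> carrier N\<rbrakk> \<Longrightarrow> f m n \<in> linear_maps R K P"
    and bal: "\<And>m n a k. \<lbrakk>m \<in> carrier M; n \<in> carrier N; a \<in> carrier A'; k \<in> carrier K\<rbrakk> \<Longrightarrow>
      f m (n \<triangleleft>\<^bsub>N\<^esub> a) (twist K k) = f m (twist N n) (twist A' a \<triangleright>\<^bsub>K\<^esub> k)"
  shows "triple_lift R P f \<in> linear_maps R (hom_tensor R B A' E (hom_tensor R B A A' M N) K) P"
    and "\<lbrakk>m \<in> carrier M; n \<in> carrier N; k \<in> carrier K\<rbrakk> \<Longrightarrow> triple_lift R P f
      (hom_pure R A' (hom_tensor R B A A' M N) K (hom_pure R A M N m n) k) = f m n k"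
proof -
  interpret MN: hom_tensor_bimodule R B A A' M N by fact
  interpret K: left_hom_module R A' K by fact
  interpret P: module R P by fact
  interpret MNK: hom_tensor_product R A' MN.MN K
    by (intro hom_tensor_product.intro MN.MN.right_hom_module_axioms K.left_hom_module_axioms)
  define G where "G k = hom_tensor_lift R P (\<lambda>m n. f m n k)" for k
  have G_lin: "G k \<in> linear_maps R MN.MN P" if "k \<in> carrier K" for k
    unfolding G_def by (rule MN.hom_tensor_lift[OF assms(3) f[OF that]])
  have G_tp: "G k (hom_pure R A M N m n) = f m n k"
    if "m \<in> carrier M" "n \<in> carrier N" "k \<in> carrier K" for m n k
    unfolding G_def by (rule MN.hom_tensor_lift(2)[OF assms(3) f[OF that(3)] that(1,2)])
  have G_lin': "(\<lambda>k. G k z) \<in> linear_maps R K P" if "z \<in> carrier MN.MN" for z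
  proof (rule MN.hom_tensor_linear_param[OF assms(3) K.M.module_axioms G_lin _ that])
    show "(\<lambda>k. G k (hom_pure R A M N m n)) \<in> linear_maps R K P"
      if "m \<in> carrier M" "n \<in> carrier N" for m n
      using that f3 by (intro linear_maps_cong[OF K.M.module_axioms _ f3[OF that]] G_tp)
  qed
  have "(\<lambda>z k. G k z) \<in> balanced_maps R A' MN.MN K P"
  proof (rule balanced_mapsI)
    show "(\<lambda>z k. G k z) \<in> bilinear_maps R MN.MN K P"
      using G_lin G_lin' by (simp add: bilinear_maps_def)
    fix z a k assume z: "z \<in> carrier MN.MN" and [simp]: "a \<in> carrier A'" "k \<in> carrier K"
    from z show "G (twist K k) (z \<triangleleft>\<^bsub>MN.MN\<^esub> a) = G (a \<triangleright>\<^bsub>K\<^esub> k) (twist MN.MN z)"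
    proof (induction rule: MN.mn_induct)
      case (pure m n)
      then show ?case
        using bal[of "twist M m" n "inv_twist A' a" k]
        by (simp add: MN.ract_tp MN.twist_tp G_tp)
    qed (simp add: MN.MN_add linear_maps_add[OF G_lin])
  qed
  note lift = MNK.hom_tensor_lift[OF assms(3) this]
  have eq: "triple_lift R P f = hom_tensor_lift R P (\<lambda>z k. G k z)"
    by (simp add: triple_lift_def G_def)
  show "triple_lift R P f \<in> linear_maps R (hom_tensor R B A' E MN.MN K) P"
    unfolding eq by (rule lift(1))
  show "triple_lift R P f (hom_pure R A' MN.MN K (hom_pure R A M N m n) k) = f m n k"
    if "m \<in> carrier M" "n \<in> carrier N" "k \<in> carrier K"
    unfolding eq using that by (simp add: lift(2) G_tp)
qed


section \<open>A Hom-algebra as a bimodule along morphisms\<close>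

lemma bimodule_along_simps [simp]:
  "carrier (bimodule_along f g B) = carrier B" "zero (bimodule_along f g B) = \<zero>\<^bsub>B\<^esub>"
  "add (bimodule_along f g B) = add B" "smult (bimodule_along f g B) = smult B"
  "twist (bimodule_along f g B) = twist B"
  "lact (bimodule_along f g B) = (\<lambda>a b. f a \<otimes>\<^bsub>B\<^esub> b)"
  "ract (bimodule_along f g B) = (\<lambda>b c. b \<otimes>\<^bsub>B\<^esub> g c)"
  by (simp_all add: bimodule_along_def)

lemma inv_twist_bimodule_along [simp]: "inv_twist (bimodule_along f g B) = inv_twist B"
  by (simp add: inv_twist_def)

lemma hom_algebra_morphismsD:
  assumes "f \<in> hom_algebra_morphisms R A B"
  shows "f \<in> linear_maps R A B" "\<And>a. a \<in> carrier A \<Longrightarrow> f a \<in> carrier B"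
    "\<And>a. a \<in> carrier A \<Longrightarrow> f (twist A a) = twist B (f a)"
    "\<And>a a'. \<lbrakk>a \<in> carrier A; a' \<in> carrier A\<rbrakk> \<Longrightarrow> f (a \<otimes>\<^bsub>A\<^esub> a') = f a \<otimes>\<^bsub>B\<^esub> f a'"
    "f \<one>\<^bsub>A\<^esub> = \<one>\<^bsub>B\<^esub>"
  using assms by (auto simp: hom_algebra_morphisms_def hom_morphisms_def linear_maps_iff)

lemma hom_algebra_morphisms_id: "id \<in> hom_algebra_morphisms R B B"
  by (simp add: hom_algebra_morphisms_def hom_morphisms_def linear_maps_iff)

text \<open>As \<open>f\<close> and \<open>g\<close> are multiplicative, each of the three associativity laws of a bimodule is an
  instance of Hom-associativity of \<open>B\<close>.\<close>

lemma hom_bimodule_along: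
  assumes "hom_algebra R A" "hom_algebra R D" "hom_algebra R B"
    and f: "f \<in> hom_algebra_morphisms R A B" and g: "g \<in> hom_algebra_morphisms R D B"
  shows "hom_bimodule R A D (bimodule_along f g B)"
proof -
  interpret A: hom_algebra R A by fact
  interpret D: hom_algebra R D by fact
  interpret B: hom_algebra R B by fact
  let ?M = "bimodule_along f g B"
  note fD [simp] = hom_algebra_morphismsD(2-)[OF f] and gD [simp] = hom_algebra_morphismsD(2-)[OF g]
  note lin = linear_maps_add[OF hom_algebra_morphismsD(1)[OF f]] linear_maps_smult[OF hom_algebra_morphismsD(1)[OF f]]
    linear_maps_add[OF hom_algebra_morphismsD(1)[OF g]] linear_maps_smult[OF hom_algebra_morphismsD(1)[OF g]]
  have mod: "module R ?M" by (rule module_transfer[OF B.module_axioms]) simp_all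
  have obj: "hom_object R ?M"
    using B.twist_linear B.twist_bij
    by (intro hom_object.intro hom_object_axioms.intro mod) (simp_all add: linear_maps_iff)
  show ?thesis
  proof (intro hom_bimodule.intro left_hom_module.intro right_hom_module.intro
      left_hom_module_axioms.intro right_hom_module_axioms.intro hom_bimodule_axioms.intro obj assms(1,2))
    show "(\<lambda>a m. a \<triangleright>\<^bsub>?M\<^esub> m) \<in> bilinear_maps R A ?M ?M"
      by (rule bilinear_mapsI) (simp_all add: lin B.mult_add_left B.mult_add_right
        B.mult_smult_left B.mult_smult_right)
    show "(\<lambda>m a. m \<triangleleft>\<^bsub>?M\<^esub> a) \<in> bilinear_maps R ?M D ?M"
      by (rule bilinear_mapsI) (simp_all add: lin B.mult_add_left B.mult_add_right
        B.mult_smult_left B.mult_smult_right)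
  qed (simp_all add: B.hom_assoc B.hom_unit_left B.hom_unit_right B.twist_mult)
qed


section \<open>The bimodule underlying the base ring extension\<close>

locale base_extension = A: hom_algebra R A + B: hom_algebra R B + C: hom_coring R A C \<Delta> \<epsilon>
  for R :: "('k, 'r) ring_scheme" and A :: "('k, 'a, 'x) hom_mod_scheme"
    and B :: "('k, 'b, 'y) hom_mod_scheme" and \<phi> :: "'a \<Rightarrow> 'b"
    and C :: "('k, 'c, 'a, 'a, 'z) hom_bimod_scheme"
    and \<Delta> :: "'c \<Rightarrow> ('c \<times> 'c \<Rightarrow> 'k) set set" and \<epsilon> :: "'c \<Rightarrow> 'a" +
  assumes phi: "\<phi> \<in> hom_algebra_morphisms R A B"
begin

definition "Bl = bimodule_along id \<phi> B"
definition "Br = bimodule_along \<phi> id B"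

lemma Bl_simps [simp]:
  "carrier Bl = carrier B" "zero Bl = \<zero>\<^bsub>B\<^esub>" "add Bl = add B" "smult Bl = smult B" "twist Bl = twist B"
  "lact Bl = (\<lambda>b b'. b \<otimes>\<^bsub>B\<^esub> b')" "ract Bl = (\<lambda>b a. b \<otimes>\<^bsub>B\<^esub> \<phi> a)" "inv_twist Bl = inv_twist B"
  by (simp_all add: Bl_def fun_eq_iff)

lemma Br_simps [simp]:
  "carrier Br = carrier B" "zero Br = \<zero>\<^bsub>B\<^esub>" "add Br = add B" "smult Br = smult B" "twist Br = twist B"
  "lact Br = (\<lambda>a b. \<phi> a \<otimes>\<^bsub>B\<^esub> b)" "ract Br = (\<lambda>b b'. b \<otimes>\<^bsub>B\<^esub> b')" "inv_twist Br = inv_twist B"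
  by (simp_all add: Br_def fun_eq_iff)

abbreviation "Y \<equiv> hom_tensor R B A A Bl C"
abbreviation "X \<equiv> hom_tensor R B A B Y Br"
abbreviation "XX \<equiv> hom_tensor R B B B X X"
abbreviation "XXX \<equiv> hom_tensor R B B B X XX"
abbreviation "CC \<equiv> hom_tensor R A A A C C"
abbreviation "CCC \<equiv> hom_tensor R A A A C CC"

sublocale Bl: hom_bimodule R B A Bl
  unfolding Bl_def
  by (rule hom_bimodule_along[OF B.hom_algebra_axioms A.hom_algebra_axioms B.hom_algebra_axioms
    hom_algebra_morphisms_id phi])

sublocale Br: hom_bimodule R A B Br
  unfolding Br_def
  by (rule hom_bimodule_along[OF A.hom_algebra_axioms B.hom_algebra_axioms B.hom_algebra_axioms
    phi hom_algebra_morphisms_id])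

sublocale Y: hom_tensor_bimodule R B A A Bl C
  by (intro hom_tensor_bimodule.intro Bl.hom_bimodule_axioms C.hom_bimodule_axioms)

sublocale X: hom_tensor_bimodule R B A B Y Br
  by (intro hom_tensor_bimodule.intro Y.hom_tensor_bimodule Br.hom_bimodule_axioms)

sublocale XX: hom_tensor_bimodule R B B B X X
  by (intro hom_tensor_bimodule.intro X.hom_tensor_bimodule)

sublocale XXX: hom_tensor_bimodule R B B B X XX
  by (intro hom_tensor_bimodule.intro X.hom_tensor_bimodule XX.hom_tensor_bimodule)

sublocale CC: hom_tensor_bimodule R A A A C C
  by (intro hom_tensor_bimodule.intro C.hom_bimodule_axioms)

sublocale CCC: hom_tensor_bimodule R A A A C CC
  by (intro hom_tensor_bimodule.intro C.hom_bimodule_axioms CC.hom_tensor_bimodule)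

lemmas phi_closed [simp] = hom_algebra_morphismsD(2)[OF phi]
  and phi_twist = hom_algebra_morphismsD(3)[OF phi]
  and phi_mult = hom_algebra_morphismsD(4)[OF phi]
  and phi_add = linear_maps_add[OF hom_algebra_morphismsD(1)[OF phi]]
  and phi_smult = linear_maps_smult[OF hom_algebra_morphismsD(1)[OF phi]]

lemma phi_inv_twist: "a \<in> carrier A \<Longrightarrow> inv_twist B (\<phi> a) = \<phi> (inv_twist A a)"
  by (rule B.inv_twist_eqI) (simp_all add: phi_twist[symmetric])

declare B.unit_closed [simp]

abbreviation q :: "'b \<Rightarrow> 'c \<Rightarrow> 'b \<Rightarrow> (('b \<times> 'c \<Rightarrow> 'k) set set \<times> 'b \<Rightarrow> 'k) set set"
  where "q \<equiv> base_ext_pure R A B \<phi> C"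

lemma q_def: "q b c b' = hom_pure R A Y Br (hom_pure R A Bl C b c) b'"
  by (simp only: base_ext_pure_def base_ext_left_def Bl_def Br_def)

lemma q_closed [simp]: "\<lbrakk>b \<in> carrier B; c \<in> carrier C; b' \<in> carrier B\<rbrakk> \<Longrightarrow> q b c b' \<in> carrier X"
  by (simp add: q_def)

lemma q_linear1: "\<lbrakk>c \<in> carrier C; b' \<in> carrier B\<rbrakk> \<Longrightarrow> (\<lambda>b. q b c b') \<in> linear_maps R B X"
  using Y.tp_add_left Y.tp_smult_left
  by (intro linear_mapsI) (simp_all add: q_def X.tp_add_left X.tp_smult_left)

lemma q_linear2: "\<lbrakk>b \<in> carrier B; b' \<in> carrier B\<rbrakk> \<Longrightarrow> (\<lambda>c. q b c b') \<in> linear_maps R C X"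
  by (intro linear_mapsI)
    (simp_all add: q_def X.tp_add_left X.tp_smult_left Y.tp_add_right Y.tp_smult_right)

lemma q_linear3: "\<lbrakk>b \<in> carrier B; c \<in> carrier C\<rbrakk> \<Longrightarrow> q b c \<in> linear_maps R B X"
  using X.tp_add_right X.tp_smult_right by (intro linear_mapsI) (simp_all add: q_def)

lemmas q_add = linear_maps_add[OF q_linear1] linear_maps_add[OF q_linear2] linear_maps_add[OF q_linear3]
  and q_smult = linear_maps_smult[OF q_linear1] linear_maps_smult[OF q_linear2] linear_maps_smult[OF q_linear3]

lemma twist_q: "\<lbrakk>b \<in> carrier B; c \<in> carrier C; b' \<in> carrier B\<rbrakk>
    \<Longrightarrow> twist X (q b c b') = q (twist B b) (twist C c) (twist B b')"
  by (simp add: q_def X.twist_tp Y.twist_tp)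

lemma inv_twist_q: "\<lbrakk>b \<in> carrier B; c \<in> carrier C; b' \<in> carrier B\<rbrakk>
    \<Longrightarrow> inv_twist X (q b c b') = q (inv_twist B b) (inv_twist C c) (inv_twist B b')"
  by (rule X.MN.inv_twist_eqI) (simp_all add: twist_q)

lemma lact_q: "\<lbrakk>e \<in> carrier B; b \<in> carrier B; c \<in> carrier C; b' \<in> carrier B\<rbrakk>
    \<Longrightarrow> e \<triangleright>\<^bsub>X\<^esub> q b c b' = q (inv_twist B (inv_twist B e) \<otimes>\<^bsub>B\<^esub> b) (twist C c) (twist B b')"
  by (simp add: q_def X.lact_tp Y.lact_tp)

lemma ract_q: "\<lbrakk>e \<in> carrier B; b \<in> carrier B; c \<in> carrier C; b' \<in> carrier B\<rbrakk>
    \<Longrightarrow> q b c b' \<triangleleft>\<^bsub>X\<^esub> e = q (twist B b) (twist C c) (b' \<otimes>\<^bsub>B\<^esub> inv_twist B e)"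
  by (simp add: q_def X.ract_tp Y.twist_tp)

text \<open>The relation of the inner tensor product, for \<open>B\<close> and \<open>C\<close>; scalars from \<open>A\<close> act on \<open>B\<close> through
  \<open>\<phi>\<close>.\<close>

lemma q_balance_left: "\<lbrakk>b \<in> carrier B; a \<in> carrier A; c \<in> carrier C; b' \<in> carrier B\<rbrakk>
    \<Longrightarrow> q (b \<otimes>\<^bsub>B\<^esub> \<phi> a) (twist C c) b' = q (twist B b) (a \<triangleright>\<^bsub>C\<^esub> c) b'"
  using Y.hom_pure_balance[of b a c] by (simp add: q_def)

text \<open>The relation of the outer tensor product. The right action of \<open>A\<close> on \<open>B \<otimes>\<^sub>A C\<close> moves into \<open>C\<close> with
  an inverse automorphism, which accounts for \<open>\<alpha>(a)\<close> on the right-hand side.\<close>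

lemma q_balance_right:
  assumes [simp]: "b \<in> carrier B" "a \<in> carrier A" "c \<in> carrier C" "b' \<in> carrier B"
  shows "q b (c \<triangleleft>\<^bsub>C\<^esub> a) (twist B b') = q b (twist C c) (\<phi> (twist A a) \<otimes>\<^bsub>B\<^esub> b')"
  using X.hom_pure_balance[of "hom_pure R A Bl C (inv_twist B b) c" "twist A a" b']
  by (simp add: q_def Y.ract_tp Y.twist_tp)

lemma X_induct [consumes 1, case_names q add]:
  assumes z: "z \<in> carrier X"
    and q: "\<And>b c b'. \<lbrakk>b \<in> carrier B; c \<in> carrier C; b' \<in> carrier B\<rbrakk> \<Longrightarrow> Q (q b c b')"
    and add: "\<And>x y. \<lbrakk>x \<in> carrier X; y \<in> carrier X; Q x; Q y\<rbrakk> \<Longrightarrow> Q (x \<oplus>\<^bsub>X\<^esub> y)"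
  shows "Q z"
proof (rule X.mn_induct[OF z, where Q = Q])
  show "Q (hom_pure R A Y Br u b')" if u: "u \<in> carrier Y" and b': "b' \<in> carrier Br" for u b'
  proof (rule Y.mn_induct[OF u, where Q = "\<lambda>u. Q (hom_pure R A Y Br u b')"])
    show "Q (hom_pure R A Y Br (hom_pure R A Bl C b c) b')" if "b \<in> carrier Bl" "c \<in> carrier C" for b c
      using q[of b c b'] b' that by (simp add: q_def)
  next
    fix v w assume "v \<in> carrier Y" "w \<in> carrier Y"
      "Q (hom_pure R A Y Br v b')" "Q (hom_pure R A Y Br w b')"
    then show "Q (hom_pure R A Y Br (v \<oplus>\<^bsub>Y\<^esub> w) b')"
      using b' by (subst X.tp_add_left) (auto intro!: add)
  qed
qed (rule add)

lemma X_lift: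
  assumes "module R P"
    and 1: "\<And>c b'. \<lbrakk>c \<in> carrier C; b' \<in> carrier B\<rbrakk> \<Longrightarrow> (\<lambda>b. f b c b') \<in> linear_maps R B P"
    and 2: "\<And>b b'. \<lbrakk>b \<in> carrier B; b' \<in> carrier B\<rbrakk> \<Longrightarrow> (\<lambda>c. f b c b') \<in> linear_maps R C P"
    and 3: "\<And>b c. \<lbrakk>b \<in> carrier B; c \<in> carrier C\<rbrakk> \<Longrightarrow> f b c \<in> linear_maps R B P"
    and left: "\<And>b a c b'. \<lbrakk>b \<in> carrier B; a \<in> carrier A; c \<in> carrier C; b' \<in> carrier B\<rbrakk>
      \<Longrightarrow> f (b \<otimes>\<^bsub>B\<^esub> \<phi> a) (twist C c) b' = f (twist B b) (a \<triangleright>\<^bsub>C\<^esub> c) b'"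
    and right: "\<And>b a c b'. \<lbrakk>b \<in> carrier B; a \<in> carrier A; c \<in> carrier C; b' \<in> carrier B\<rbrakk>
      \<Longrightarrow> f b (c \<triangleleft>\<^bsub>C\<^esub> a) (twist B b') = f b (twist C c) (\<phi> (twist A a) \<otimes>\<^bsub>B\<^esub> b')"
  shows "triple_lift R P f \<in> linear_maps R X P"
    and "\<lbrakk>b \<in> carrier B; c \<in> carrier C; b' \<in> carrier B\<rbrakk> \<Longrightarrow> triple_lift R P f (q b c b') = f b c b'"
proof -
  have bal: "(\<lambda>b c. f b c k) \<in> balanced_maps R A Bl C P" if "k \<in> carrier Br" for k
    using 1 2 left that
    by (intro balanced_mapsI) (simp_all add: bilinear_maps_def linear_maps_iff)
  have lin: "f b c \<in> linear_maps R Br P" if "b \<in> carrier Bl" "c \<in> carrier C" for b c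
    using 3 that by (simp add: linear_maps_iff)
  have bal': "f b (c \<triangleleft>\<^bsub>C\<^esub> a) (twist Br k) = f b (twist C c) (twist A a \<triangleright>\<^bsub>Br\<^esub> k)"
    if "b \<in> carrier Bl" "c \<in> carrier C" "a \<in> carrier A" "k \<in> carrier Br" for b c a k
    using right that by simp
  note lift = triple_lift[OF Y.hom_tensor_bimodule_axioms Br.left_hom_module_axioms assms(1) bal lin bal']
  show "triple_lift R P f \<in> linear_maps R X P" by (rule lift(1))
  show "triple_lift R P f (q b c b') = f b c b'"
    if "b \<in> carrier B" "c \<in> carrier C" "b' \<in> carrier B"
    unfolding q_def using lift(2)[of b c b'] that by (simp only: Bl_simps Br_simps)
qed


section \<open>Comultiplication and counit of the base ring extension\<close>

abbreviation p where "p \<equiv> hom_pure R B X X"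
abbreviation pp where "pp \<equiv> hom_pure R B X XX"
abbreviation cp where "cp \<equiv> hom_pure R A C C"
abbreviation ccp where "ccp \<equiv> hom_pure R A C CC"

lemma phi_twist': "a \<in> carrier A \<Longrightarrow> twist B (\<phi> a) = \<phi> (twist A a)"
  by (simp add: phi_twist)

lemma unit_mult_phi: "a \<in> carrier A \<Longrightarrow> \<one>\<^bsub>B\<^esub> \<otimes>\<^bsub>B\<^esub> \<phi> a = \<phi> (twist A a)"
  and phi_mult_unit: "a \<in> carrier A \<Longrightarrow> \<phi> a \<otimes>\<^bsub>B\<^esub> \<one>\<^bsub>B\<^esub> = \<phi> (twist A a)"
  by (simp_all add: B.hom_unit_left B.hom_unit_right phi_twist)

lemmas unit_simps = B.twist_unit B.inv_twist_unit B.hom_unit_left B.hom_unit_right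
  phi_twist' phi_inv_twist unit_mult_phi phi_mult_unit

text \<open>Next to the unit, a right action of \<open>A\<close> on \<open>C\<close> is a right action of \<open>B\<close> on the whole element:
  by \<open>q_balance_right\<close> the scalar moves into the last factor, where it multiplies the unit. This and
  its mirror image \<open>q_unit_lact\<close> are the reason why the comultiplication is well defined.\<close>

lemma q_unit_ract:
  assumes [simp]: "b \<in> carrier B" "c \<in> carrier C" "a \<in> carrier A"
  shows "q b (c \<triangleleft>\<^bsub>C\<^esub> a) \<one>\<^bsub>B\<^esub> = q (inv_twist B b) c \<one>\<^bsub>B\<^esub> \<triangleleft>\<^bsub>X\<^esub> \<phi> (twist A (twist A a))"
  using q_balance_right[of b a c "\<one>\<^bsub>B\<^esub>"] by (simp add: ract_q unit_simps)

lemma q_unit_lact: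
  assumes [simp]: "b \<in> carrier B" "c \<in> carrier C" "a \<in> carrier A"
  shows "\<phi> (twist A (twist A a)) \<triangleright>\<^bsub>X\<^esub> q \<one>\<^bsub>B\<^esub> c b = q \<one>\<^bsub>B\<^esub> (a \<triangleright>\<^bsub>C\<^esub> c) (twist B b)"
  using q_balance_left[of "\<one>\<^bsub>B\<^esub>" a c "twist B b"] by (simp add: lact_q unit_simps)

text \<open>The map \<open>C \<otimes>\<^sub>A C \<rightarrow> X \<otimes>\<^sub>B X\<close> whose value at \<open>\<Delta> c\<close> is the comultiplication of \<open>(b \<otimes> c) \<otimes> b'\<close>.\<close>

definition insert_units :: "'b \<Rightarrow> 'b \<Rightarrow> ('c \<times> 'c \<Rightarrow> 'k) set set
    \<Rightarrow> (((('b \<times> 'c \<Rightarrow> 'k) set set \<times> 'b \<Rightarrow> 'k) set set) \<times> ((('b \<times> 'c \<Rightarrow> 'k) set set \<times> 'b \<Rightarrow> 'k) set set) \<Rightarrow> 'k) set set"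
  where "insert_units b b' = hom_tensor_lift R XX
    (\<lambda>c d. p (q (inv_twist B b) c \<one>\<^bsub>B\<^esub>) (q \<one>\<^bsub>B\<^esub> d (inv_twist B b')))"

text \<open>Both unit lemmas involve the same scalar \<open>\<phi>(\<alpha>\<^sup>2(a))\<close>; it passes through \<open>X \<otimes>\<^sub>B X\<close> from one factor
  to the other.\<close>

lemma insert_units_balanced:
  assumes [simp]: "b \<in> carrier B" "b' \<in> carrier B"
  shows "(\<lambda>c d. p (q (inv_twist B b) c \<one>\<^bsub>B\<^esub>) (q \<one>\<^bsub>B\<^esub> d (inv_twist B b')))
    \<in> balanced_maps R A C C XX"
proof (intro balanced_mapsI bilinear_mapsI)
  fix c a d assume [simp]: "c \<in> carrier C" "a \<in> carrier A" "d \<in> carrier C"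
  \<comment> \<open>The relation has \<open>\<xi>(?y)\<close> on one side and \<open>\<xi>(?x)\<close> on the other, where \<open>\<xi>\<close> is the automorphism
      of \<open>X\<close>; hence one more inverse of \<open>\<beta>\<close> in both.\<close>
  let ?x = "q (inv_twist B (inv_twist B b)) c \<one>\<^bsub>B\<^esub>" and ?y = "q \<one>\<^bsub>B\<^esub> d (inv_twist B (inv_twist B b'))"
  have "p (?x \<triangleleft>\<^bsub>X\<^esub> \<phi> (twist A (twist A a))) (twist X ?y)
      = p (twist X ?x) (\<phi> (twist A (twist A a)) \<triangleright>\<^bsub>X\<^esub> ?y)"
    by (rule XX.hom_pure_balance) simp_all
  then show "p (q (inv_twist B b) (c \<triangleleft>\<^bsub>C\<^esub> a) \<one>\<^bsub>B\<^esub>) (q \<one>\<^bsub>B\<^esub> (twist C d) (inv_twist B b'))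
      = p (q (inv_twist B b) (twist C c) \<one>\<^bsub>B\<^esub>) (q \<one>\<^bsub>B\<^esub> (a \<triangleright>\<^bsub>C\<^esub> d) (inv_twist B b'))"
    by (simp add: q_unit_ract q_unit_lact twist_q unit_simps)
qed (simp_all add: q_add q_smult XX.tp_add_left XX.tp_add_right XX.tp_smult_left XX.tp_smult_right)

lemma insert_units_linear: "\<lbrakk>b \<in> carrier B; b' \<in> carrier B\<rbrakk> \<Longrightarrow> insert_units b b' \<in> linear_maps R CC XX"
  unfolding insert_units_def by (rule CC.hom_tensor_lift(1)[OF XX.MN.module_axioms insert_units_balanced])

lemma insert_units_cp: "\<lbrakk>b \<in> carrier B; b' \<in> carrier B; c \<in> carrier C; d \<in> carrier C\<rbrakk> \<Longrightarrow>
    insert_units b b' (cp c d) = p (q (inv_twist B b) c \<one>\<^bsub>B\<^esub>) (q \<one>\<^bsub>B\<^esub> d (inv_twist B b'))"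
  unfolding insert_units_def by (rule CC.hom_tensor_lift(2)[OF XX.MN.module_axioms insert_units_balanced])

lemma insert_units_closed [simp]: "\<lbrakk>b \<in> carrier B; b' \<in> carrier B; w \<in> carrier CC\<rbrakk> \<Longrightarrow> insert_units b b' w \<in> carrier XX"
  by (rule linear_maps_closed[OF insert_units_linear])

lemmas insert_units_add = linear_maps_add[OF insert_units_linear]

lemma insert_units_linear_left:
  assumes [simp]: "b' \<in> carrier B" and w: "w \<in> carrier CC"
  shows "(\<lambda>b. insert_units b b' w) \<in> linear_maps R B XX"
proof (rule CC.hom_tensor_linear_param[OF XX.MN.module_axioms B.module_axioms insert_units_linear[OF _ assms(1)] _ w])
  show "(\<lambda>b. insert_units b b' (cp c d)) \<in> linear_maps R B XX" if "c \<in> carrier C" "d \<in> carrier C" for c d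
    using that by (intro linear_mapsI) (simp_all add: insert_units_cp B.inv_twist_add B.inv_twist_smult
      q_add q_smult XX.tp_add_left XX.tp_smult_left)
qed

lemma insert_units_linear_right:
  assumes [simp]: "b \<in> carrier B" and w: "w \<in> carrier CC"
  shows "(\<lambda>b'. insert_units b b' w) \<in> linear_maps R B XX"
proof (rule CC.hom_tensor_linear_param[OF XX.MN.module_axioms B.module_axioms insert_units_linear[OF assms(1)] _ w])
  show "(\<lambda>b'. insert_units b b' (cp c d)) \<in> linear_maps R B XX" if "c \<in> carrier C" "d \<in> carrier C" for c d
    using that by (intro linear_mapsI) (simp_all add: insert_units_cp B.inv_twist_add B.inv_twist_smult
      q_add q_smult XX.tp_add_right XX.tp_smult_right)
qed

text \<open>The next five lemmas describe how \<open>insert_units\<close> interacts with the structure of \<open>X \<otimes>\<^sub>B X\<close> and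
  \<open>C \<otimes>\<^sub>A C\<close>. The first three make the comultiplication a bimodule map; the two balancing lemmas
  make it well defined on \<open>X\<close>.\<close>

lemma twist_insert_units:
  assumes [simp]: "b \<in> carrier B" "b' \<in> carrier B" and w: "w \<in> carrier CC"
  shows "twist XX (insert_units b b' w) = insert_units (twist B b) (twist B b') (twist CC w)"
  by (rule CC.mn_induct[OF w])
    (simp_all add: insert_units_cp insert_units_add XX.twist_tp CC.twist_tp twist_q unit_simps XX.MN.twist_add CC.MN.twist_add)

lemma lact_insert_units:
  assumes [simp]: "e \<in> carrier B" "b \<in> carrier B" "b' \<in> carrier B" and w: "w \<in> carrier CC"
  shows "e \<triangleright>\<^bsub>XX\<^esub> insert_units b b' w = insert_units (inv_twist B (inv_twist B e) \<otimes>\<^bsub>B\<^esub> b) (twist B b') (twist CC w)"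
  by (rule CC.mn_induct[OF w])
    (simp_all add: insert_units_cp insert_units_add XX.lact_tp CC.twist_tp lact_q twist_q unit_simps
      B.inv_twist_mult XX.MN.lact_add_right CC.MN.twist_add)

lemma ract_insert_units:
  assumes [simp]: "e \<in> carrier B" "b \<in> carrier B" "b' \<in> carrier B" and w: "w \<in> carrier CC"
  shows "insert_units b b' w \<triangleleft>\<^bsub>XX\<^esub> e = insert_units (twist B b) (b' \<otimes>\<^bsub>B\<^esub> inv_twist B e) (twist CC w)"
  by (rule CC.mn_induct[OF w])
    (simp_all add: insert_units_cp insert_units_add XX.ract_tp CC.twist_tp ract_q twist_q unit_simps
      B.inv_twist_mult XX.MN.ract_add_left CC.MN.twist_add)

lemma insert_units_balance_left:
  assumes [simp]: "b \<in> carrier B" "b' \<in> carrier B" "a \<in> carrier A" and w: "w \<in> carrier CC"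
  shows "insert_units (b \<otimes>\<^bsub>B\<^esub> \<phi> a) b' (twist CC w) = insert_units (twist B b) b' (a \<triangleright>\<^bsub>CC\<^esub> w)"
proof (rule CC.mn_induct[OF w])
  fix c d assume [simp]: "c \<in> carrier C" "d \<in> carrier C"
  show "insert_units (b \<otimes>\<^bsub>B\<^esub> \<phi> a) b' (twist CC (cp c d)) = insert_units (twist B b) b' (a \<triangleright>\<^bsub>CC\<^esub> cp c d)"
    using q_balance_left[of "inv_twist B b" "inv_twist A a" c "\<one>\<^bsub>B\<^esub>"]
    by (simp add: insert_units_cp CC.twist_tp CC.lact_tp B.inv_twist_mult unit_simps)
qed (simp add: insert_units_add CC.MN.twist_add CC.MN.lact_add_right)

lemma insert_units_balance_right:
  assumes [simp]: "b \<in> carrier B" "b' \<in> carrier B" "a \<in> carrier A" and w: "w \<in> carrier CC"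
  shows "insert_units b (twist B b') (w \<triangleleft>\<^bsub>CC\<^esub> a) = insert_units b (\<phi> (twist A a) \<otimes>\<^bsub>B\<^esub> b') (twist CC w)"
proof (rule CC.mn_induct[OF w])
  fix c d assume [simp]: "c \<in> carrier C" "d \<in> carrier C"
  show "insert_units b (twist B b') (cp c d \<triangleleft>\<^bsub>CC\<^esub> a) = insert_units b (\<phi> (twist A a) \<otimes>\<^bsub>B\<^esub> b') (twist CC (cp c d))"
    using q_balance_right[of "\<one>\<^bsub>B\<^esub>" "inv_twist A a" d "inv_twist B b'"]
    by (simp add: insert_units_cp CC.twist_tp CC.ract_tp B.inv_twist_mult unit_simps)
qed (simp add: insert_units_add CC.MN.twist_add CC.MN.ract_add_left)

lemma comult_linear: "\<Delta> \<in> linear_maps R C CC"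
    and comult_closed [simp]: "\<And>c. c \<in> carrier C \<Longrightarrow> \<Delta> c \<in> carrier CC"
    and comult_twist: "\<And>c. c \<in> carrier C \<Longrightarrow> \<Delta> (twist C c) = twist CC (\<Delta> c)"
    and comult_lact: "\<And>a c. \<lbrakk>a \<in> carrier A; c \<in> carrier C\<rbrakk> \<Longrightarrow> \<Delta> (a \<triangleright>\<^bsub>C\<^esub> c) = a \<triangleright>\<^bsub>CC\<^esub> \<Delta> c"
    and comult_ract: "\<And>a c. \<lbrakk>a \<in> carrier A; c \<in> carrier C\<rbrakk> \<Longrightarrow> \<Delta> (c \<triangleleft>\<^bsub>C\<^esub> a) = \<Delta> c \<triangleleft>\<^bsub>CC\<^esub> a"
  using C.comult_bilinear by (auto simp: bimodule_maps_def hom_morphisms_def linear_maps_iff)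

lemma counit_linear: "\<epsilon> \<in> linear_maps R C A"
    and counit_closed [simp]: "\<And>c. c \<in> carrier C \<Longrightarrow> \<epsilon> c \<in> carrier A"
    and counit_twist: "\<And>c. c \<in> carrier C \<Longrightarrow> \<epsilon> (twist C c) = twist A (\<epsilon> c)"
    and counit_lact: "\<And>a c. \<lbrakk>a \<in> carrier A; c \<in> carrier C\<rbrakk> \<Longrightarrow> \<epsilon> (a \<triangleright>\<^bsub>C\<^esub> c) = a \<otimes>\<^bsub>A\<^esub> \<epsilon> c"
    and counit_ract: "\<And>a c. \<lbrakk>a \<in> carrier A; c \<in> carrier C\<rbrakk> \<Longrightarrow> \<epsilon> (c \<triangleleft>\<^bsub>C\<^esub> a) = \<epsilon> c \<otimes>\<^bsub>A\<^esub> a"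
  using C.counit_bilinear by (auto simp: bimodule_maps_def hom_morphisms_def linear_maps_iff)

definition "ext_comult = triple_lift R XX (\<lambda>b c b'. insert_units b b' (\<Delta> c))"

definition "ext_counit = triple_lift R B (\<lambda>b c b'. (b \<otimes>\<^bsub>B\<^esub> \<phi> (\<epsilon> c)) \<otimes>\<^bsub>B\<^esub> b')"

text \<open>Left and right \<open>A\<close>-linearity of \<open>\<Delta>\<close> translate the relations of \<open>X\<close> into the balancing lemmas
  for \<open>insert_units\<close>.\<close>

lemma ext_comult:
  shows ext_comult_linear: "ext_comult \<in> linear_maps R X XX"
    and ext_comult_q: "\<And>b c b'. \<lbrakk>b \<in> carrier B; c \<in> carrier C; b' \<in> carrier B\<rbrakk>
      \<Longrightarrow> ext_comult (q b c b') = insert_units b b' (\<Delta> c)"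
proof -
  have 2: "(\<lambda>c. insert_units b b' (\<Delta> c)) \<in> linear_maps R C XX" if "b \<in> carrier B" "b' \<in> carrier B" for b b'
    by (rule linear_maps_comp[OF comult_linear insert_units_linear[OF that]])
  have left: "insert_units (b \<otimes>\<^bsub>B\<^esub> \<phi> a) b' (\<Delta> (twist C c)) = insert_units (twist B b) b' (\<Delta> (a \<triangleright>\<^bsub>C\<^esub> c))"
    if "b \<in> carrier B" "a \<in> carrier A" "c \<in> carrier C" "b' \<in> carrier B" for b a c b'
    using that by (simp add: comult_twist comult_lact insert_units_balance_left)
  have right: "insert_units b (twist B b') (\<Delta> (c \<triangleleft>\<^bsub>C\<^esub> a)) = insert_units b (\<phi> (twist A a) \<otimes>\<^bsub>B\<^esub> b') (\<Delta> (twist C c))"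
    if "b \<in> carrier B" "a \<in> carrier A" "c \<in> carrier C" "b' \<in> carrier B" for b a c b'
    using that by (simp add: comult_twist comult_ract insert_units_balance_right)
  note lift = X_lift[of XX "\<lambda>b c b'. insert_units b b' (\<Delta> c)", OF XX.MN.module_axioms
      insert_units_linear_left[OF _ comult_closed] 2 insert_units_linear_right[OF _ comult_closed] left right]
  show "ext_comult \<in> linear_maps R X XX"
    unfolding ext_comult_def by (rule lift(1))
  show "\<And>b c b'. \<lbrakk>b \<in> carrier B; c \<in> carrier C; b' \<in> carrier B\<rbrakk>
      \<Longrightarrow> ext_comult (q b c b') = insert_units b b' (\<Delta> c)"
    unfolding ext_comult_def by (rule lift(2))
qed

text \<open>Here the relations of \<open>X\<close> hold by Hom-associativity of \<open>B\<close> and \<open>A\<close>-linearity of \<open>\<epsilon>\<close>.\<close>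

lemma ext_counit:
  shows ext_counit_linear: "ext_counit \<in> linear_maps R X B"
    and ext_counit_q: "\<And>b c b'. \<lbrakk>b \<in> carrier B; c \<in> carrier C; b' \<in> carrier B\<rbrakk>
      \<Longrightarrow> ext_counit (q b c b') = (b \<otimes>\<^bsub>B\<^esub> \<phi> (\<epsilon> c)) \<otimes>\<^bsub>B\<^esub> b'"
proof -
  let ?f = "\<lambda>b c b'. (b \<otimes>\<^bsub>B\<^esub> \<phi> (\<epsilon> c)) \<otimes>\<^bsub>B\<^esub> b'"
  note lin = linear_maps_add[OF counit_linear] linear_maps_smult[OF counit_linear] phi_add phi_smult
    B.mult_add_left B.mult_add_right B.mult_smult_left B.mult_smult_right
  have 1: "(\<lambda>b. ?f b c b') \<in> linear_maps R B B" if "c \<in> carrier C" "b' \<in> carrier B" for c b'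
    using that by (intro linear_mapsI) (simp_all add: lin)
  have 2: "(\<lambda>c. ?f b c b') \<in> linear_maps R C B" if "b \<in> carrier B" "b' \<in> carrier B" for b b'
    using that by (intro linear_mapsI) (simp_all add: lin)
  have 3: "?f b c \<in> linear_maps R B B" if "b \<in> carrier B" "c \<in> carrier C" for b c
    using that by (intro linear_mapsI) (simp_all add: lin)
  have left: "?f (b \<otimes>\<^bsub>B\<^esub> \<phi> a) (twist C c) b' = ?f (twist B b) (a \<triangleright>\<^bsub>C\<^esub> c) b'"
    if "b \<in> carrier B" "a \<in> carrier A" "c \<in> carrier C" "b' \<in> carrier B" for b a c b'
    using that by (simp add: counit_twist counit_lact phi_mult phi_twist B.hom_assoc)
  have right: "?f b (c \<triangleleft>\<^bsub>C\<^esub> a) (twist B b') = ?f b (twist C c) (\<phi> (twist A a) \<otimes>\<^bsub>B\<^esub> b')"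
    if "b \<in> carrier B" "a \<in> carrier A" "c \<in> carrier C" "b' \<in> carrier B" for b a c b'
    using that by (simp add: counit_twist counit_ract phi_mult phi_inv_twist phi_twist'
      B.mult_mult B.inv_twist_mult)
  note lift = X_lift[of B ?f, OF B.module_axioms 1 2 3 left right]
  show "ext_counit \<in> linear_maps R X B" unfolding ext_counit_def by (rule lift(1))
  show "\<And>b c b'. \<lbrakk>b \<in> carrier B; c \<in> carrier C; b' \<in> carrier B\<rbrakk>
      \<Longrightarrow> ext_counit (q b c b') = ?f b c b'" unfolding ext_counit_def by (rule lift(2))
qed

lemma ext_comult_closed [simp]: "z \<in> carrier X \<Longrightarrow> ext_comult z \<in> carrier XX"
  by (rule linear_maps_closed[OF ext_comult_linear])

lemma ext_counit_closed [simp]: "z \<in> carrier X \<Longrightarrow> ext_counit z \<in> carrier B"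
  by (rule linear_maps_closed[OF ext_counit_linear])

lemmas ext_add = linear_maps_add[OF ext_comult_linear] linear_maps_add[OF ext_counit_linear]

lemmas X_action_add = X.MN.lact_add_right X.MN.ract_add_left X.MN.twist_add
  and XX_action_add = XX.MN.lact_add_right XX.MN.ract_add_left XX.MN.twist_add

lemma ext_comult_twist: "z \<in> carrier X \<Longrightarrow> ext_comult (twist X z) = twist XX (ext_comult z)"
  by (rule X_induct)
    (simp_all add: twist_q ext_comult_q comult_twist twist_insert_units ext_add X_action_add XX_action_add)

lemma ext_comult_lact:
  assumes [simp]: "e \<in> carrier B" and z: "z \<in> carrier X"
  shows "ext_comult (e \<triangleright>\<^bsub>X\<^esub> z) = e \<triangleright>\<^bsub>XX\<^esub> ext_comult z"
  using z by (rule X_induct)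
    (simp_all add: lact_q ext_comult_q comult_twist lact_insert_units ext_add X_action_add XX_action_add)

lemma ext_comult_ract:
  assumes [simp]: "e \<in> carrier B" and z: "z \<in> carrier X"
  shows "ext_comult (z \<triangleleft>\<^bsub>X\<^esub> e) = ext_comult z \<triangleleft>\<^bsub>XX\<^esub> e"
  using z by (rule X_induct)
    (simp_all add: ract_q ext_comult_q comult_twist ract_insert_units ext_add X_action_add XX_action_add)

lemma ext_counit_twist: "z \<in> carrier X \<Longrightarrow> ext_counit (twist X z) = twist B (ext_counit z)"
  by (rule X_induct)
    (simp_all add: twist_q ext_counit_q counit_twist phi_twist B.twist_mult B.twist_add ext_add X_action_add)

lemma ext_counit_lact:
  assumes [simp]: "e \<in> carrier B" and z: "z \<in> carrier X"
  shows "ext_counit (e \<triangleright>\<^bsub>X\<^esub> z) = e \<otimes>\<^bsub>B\<^esub> ext_counit z"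
  using z by (rule X_induct)
    (simp_all add: lact_q ext_counit_q counit_twist phi_twist B.mult_mult B.inv_twist_mult
      B.mult_add_right ext_add X_action_add)

lemma ext_counit_ract:
  assumes [simp]: "e \<in> carrier B" and z: "z \<in> carrier X"
  shows "ext_counit (z \<triangleleft>\<^bsub>X\<^esub> e) = ext_counit z \<otimes>\<^bsub>B\<^esub> e"
  using z by (rule X_induct)
    (simp_all add: ract_q ext_counit_q counit_twist phi_twist phi_inv_twist B.mult_mult B.inv_twist_mult
      B.mult_add_left ext_add X_action_add)


section \<open>Counit laws\<close>

text \<open>In this lemma and the next, the left-hand sides of the two counit laws become linear maps on
  \<open>X \<otimes>\<^sub>B X\<close>. Balancing comes from the \<open>B\<close>-linearity of the counit.\<close>

lemma counit_left_linear: "hom_tensor_lift R X (\<lambda>x y. ext_counit x \<triangleright>\<^bsub>X\<^esub> y) \<in> linear_maps R XX X"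
    and counit_left_p: "\<And>x y. \<lbrakk>x \<in> carrier X; y \<in> carrier X\<rbrakk>
      \<Longrightarrow> hom_tensor_lift R X (\<lambda>x y. ext_counit x \<triangleright>\<^bsub>X\<^esub> y) (p x y) = ext_counit x \<triangleright>\<^bsub>X\<^esub> y"
proof -
  have "(\<lambda>x y. ext_counit x \<triangleright>\<^bsub>X\<^esub> y) \<in> balanced_maps R B X X X"
  proof (intro balanced_mapsI bilinear_mapsI)
    fix x b y assume "x \<in> carrier X" "b \<in> carrier B" "y \<in> carrier X"
    then show "ext_counit (x \<triangleleft>\<^bsub>X\<^esub> b) \<triangleright>\<^bsub>X\<^esub> twist X y = ext_counit (twist X x) \<triangleright>\<^bsub>X\<^esub> (b \<triangleright>\<^bsub>X\<^esub> y)"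
      by (simp add: ext_counit_ract ext_counit_twist X.MN.lact_assoc)
  qed (simp_all add: ext_add linear_maps_smult[OF ext_counit_linear]
      X.MN.lact_add_left X.MN.lact_add_right X.MN.lact_smult_left X.MN.lact_smult_right)
  note lift = XX.hom_tensor_lift[OF X.MN.module_axioms this]
  show "hom_tensor_lift R X (\<lambda>x y. ext_counit x \<triangleright>\<^bsub>X\<^esub> y) \<in> linear_maps R XX X"
    by (rule lift(1))
  show "\<And>x y. \<lbrakk>x \<in> carrier X; y \<in> carrier X\<rbrakk>
      \<Longrightarrow> hom_tensor_lift R X (\<lambda>x y. ext_counit x \<triangleright>\<^bsub>X\<^esub> y) (p x y) = ext_counit x \<triangleright>\<^bsub>X\<^esub> y"
    by (rule lift(2))
qed

lemma counit_right_linear: "hom_tensor_lift R X (\<lambda>x y. x \<triangleleft>\<^bsub>X\<^esub> ext_counit y) \<in> linear_maps R XX X"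
    and counit_right_p: "\<And>x y. \<lbrakk>x \<in> carrier X; y \<in> carrier X\<rbrakk>
      \<Longrightarrow> hom_tensor_lift R X (\<lambda>x y. x \<triangleleft>\<^bsub>X\<^esub> ext_counit y) (p x y) = x \<triangleleft>\<^bsub>X\<^esub> ext_counit y"
proof -
  have "(\<lambda>x y. x \<triangleleft>\<^bsub>X\<^esub> ext_counit y) \<in> balanced_maps R B X X X"
  proof (intro balanced_mapsI bilinear_mapsI)
    fix x b y assume "x \<in> carrier X" "b \<in> carrier B" "y \<in> carrier X"
    then show "(x \<triangleleft>\<^bsub>X\<^esub> b) \<triangleleft>\<^bsub>X\<^esub> ext_counit (twist X y) = twist X x \<triangleleft>\<^bsub>X\<^esub> ext_counit (b \<triangleright>\<^bsub>X\<^esub> y)"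
      by (simp add: ext_counit_lact ext_counit_twist X.MN.ract_assoc)
  qed (simp_all add: ext_add linear_maps_smult[OF ext_counit_linear]
      X.MN.ract_add_left X.MN.ract_add_right X.MN.ract_smult_left X.MN.ract_smult_right)
  note lift = XX.hom_tensor_lift[OF X.MN.module_axioms this]
  show "hom_tensor_lift R X (\<lambda>x y. x \<triangleleft>\<^bsub>X\<^esub> ext_counit y) \<in> linear_maps R XX X"
    by (rule lift(1))
  show "\<And>x y. \<lbrakk>x \<in> carrier X; y \<in> carrier X\<rbrakk>
      \<Longrightarrow> hom_tensor_lift R X (\<lambda>x y. x \<triangleleft>\<^bsub>X\<^esub> ext_counit y) (p x y) = x \<triangleleft>\<^bsub>X\<^esub> ext_counit y"
    by (rule lift(2))
qed

lemma sweedler_C: "w \<in> carrier CC \<Longrightarrow> \<exists>n x y. sweedler R A C w n x y"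
  unfolding sweedler_def by (rule CC.hom_tensor_expression)

lemma sweedlerD:
  assumes "sweedler R A C w n x y"
  shows "\<And>i. i < n \<Longrightarrow> x i \<in> carrier C" "\<And>i. i < n \<Longrightarrow> y i \<in> carrier C"
    "w = (\<Oplus>\<^bsub>CC\<^esub>i\<in>{..<n}. cp (x i) (y i))"
  using assms by (simp_all add: sweedler_def)

text \<open>A linear map evaluated at \<open>w\<close> can be expanded along any expression of \<open>w\<close>; conversely a Sweedler
  formula that holds as the value of a linear map is independent of the expression.\<close>

lemma linear_sweedler_C:
  assumes "module R P" "f \<in> linear_maps R CC P" "sweedler R A C w n x y"
  shows "f w = (\<Oplus>\<^bsub>P\<^esub>i\<in>{..<n}. f (cp (x i) (y i)))"
  unfolding sweedlerD(3)[OF assms(3)] using sweedlerD(1,2)[OF assms(3)]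
  by (intro linear_maps_finsum[OF CC.MN.module_axioms assms(1,2)]) simp_all

lemma linear_sweedler_X:
  assumes "module R P" "f \<in> linear_maps R XX P" "sweedler R B X w n x y"
  shows "f w = (\<Oplus>\<^bsub>P\<^esub>i\<in>{..<n}. f (p (x i) (y i)))"
proof -
  have "w = (\<Oplus>\<^bsub>XX\<^esub>i\<in>{..<n}. p (x i) (y i))" and "\<And>i. i < n \<Longrightarrow> x i \<in> carrier X \<and> y i \<in> carrier X"
    using assms(3) by (simp_all add: sweedler_def)
  then show ?thesis
    by (simp only:) (rule linear_maps_finsum[OF XX.MN.module_axioms assms(1,2)], simp_all)
qed

text \<open>On a generator, the inner counit \<open>\<epsilon>(c)\<close> is absorbed by the middle factor through
  \<open>q_balance_left\<close>, and the counit law of \<open>C\<close> evaluates the sum that results.\<close>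

lemma ext_counit_left:
  assumes "z \<in> carrier X"
  shows "hom_tensor_lift R X (\<lambda>x y. ext_counit x \<triangleright>\<^bsub>X\<^esub> y) (ext_comult z) = z" (is "?E (ext_comult z) = z")
proof -
  have "?E (ext_comult (q b c b')) = q b c b'"
    if [simp]: "b \<in> carrier B" and c [simp]: "c \<in> carrier C" and [simp]: "b' \<in> carrier B" for b c b'
  proof -
    obtain n x y where s: "sweedler R A C (\<Delta> c) n x y" using sweedler_C[OF comult_closed[OF c]] by blast
    note [simp] = sweedlerD(1,2)[OF s]
    have pure: "?E (insert_units b b' (cp c d)) = q b (\<epsilon> c \<triangleright>\<^bsub>C\<^esub> d) b'" if [simp]: "c \<in> carrier C" "d \<in> carrier C" for c d
      using q_balance_left[of "inv_twist B b" "\<epsilon> c" d b']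
      by (simp add: insert_units_cp counit_left_p ext_counit_q lact_q unit_simps B.inv_twist_mult B.twist_mult)
    have "?E (insert_units b b' (\<Delta> c)) = (\<Oplus>\<^bsub>X\<^esub>i\<in>{..<n}. ?E (insert_units b b' (cp (x i) (y i))))"
      by (rule linear_sweedler_C[OF X.MN.module_axioms linear_maps_comp[OF insert_units_linear counit_left_linear] s])
        simp_all
    also have "\<dots> = (\<Oplus>\<^bsub>X\<^esub>i\<in>{..<n}. q b (\<epsilon> (x i) \<triangleright>\<^bsub>C\<^esub> y i) b')"
      by (rule X.MN.finsum_cong') (auto simp: pure)
    also have "\<dots> = q b (\<Oplus>\<^bsub>C\<^esub>i\<in>{..<n}. \<epsilon> (x i) \<triangleright>\<^bsub>C\<^esub> y i) b'"
      by (rule linear_maps_finsum[OF C.M.module_axioms X.MN.module_axioms q_linear2, symmetric]) simp_all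
    also have "(\<Oplus>\<^bsub>C\<^esub>i\<in>{..<n}. \<epsilon> (x i) \<triangleright>\<^bsub>C\<^esub> y i) = c"
      by (rule C.counit_left[OF c s])
    finally show ?thesis by (simp add: ext_comult_q)
  qed
  with assms show ?thesis
    by (rule_tac X_induct) (simp_all add: ext_add linear_maps_add[OF counit_left_linear])
qed

text \<open>As for the left law, but the counit enters from the last factor, through \<open>q_balance_right\<close>.\<close>

lemma ext_counit_right:
  assumes "z \<in> carrier X"
  shows "hom_tensor_lift R X (\<lambda>x y. x \<triangleleft>\<^bsub>X\<^esub> ext_counit y) (ext_comult z) = z" (is "?E (ext_comult z) = z")
proof -
  have "?E (ext_comult (q b c b')) = q b c b'"
    if [simp]: "b \<in> carrier B" and c [simp]: "c \<in> carrier C" and [simp]: "b' \<in> carrier B" for b c b'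
  proof -
    obtain n x y where s: "sweedler R A C (\<Delta> c) n x y" using sweedler_C[OF comult_closed[OF c]] by blast
    note [simp] = sweedlerD(1,2)[OF s]
    have pure: "?E (insert_units b b' (cp c d)) = q b (c \<triangleleft>\<^bsub>C\<^esub> \<epsilon> d) b'" if [simp]: "c \<in> carrier C" "d \<in> carrier C" for c d
      using q_balance_right[of b "\<epsilon> d" c "inv_twist B b'"]
      by (simp add: insert_units_cp counit_right_p ext_counit_q ract_q unit_simps B.inv_twist_mult B.twist_mult)
    have "?E (insert_units b b' (\<Delta> c)) = (\<Oplus>\<^bsub>X\<^esub>i\<in>{..<n}. ?E (insert_units b b' (cp (x i) (y i))))"
      by (rule linear_sweedler_C[OF X.MN.module_axioms linear_maps_comp[OF insert_units_linear counit_right_linear] s])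
        simp_all
    also have "\<dots> = (\<Oplus>\<^bsub>X\<^esub>i\<in>{..<n}. q b (x i \<triangleleft>\<^bsub>C\<^esub> \<epsilon> (y i)) b')"
      by (rule X.MN.finsum_cong') (auto simp: pure)
    also have "\<dots> = q b (\<Oplus>\<^bsub>C\<^esub>i\<in>{..<n}. x i \<triangleleft>\<^bsub>C\<^esub> \<epsilon> (y i)) b'"
      by (rule linear_maps_finsum[OF C.M.module_axioms X.MN.module_axioms q_linear2, symmetric]) simp_all
    also have "(\<Oplus>\<^bsub>C\<^esub>i\<in>{..<n}. x i \<triangleleft>\<^bsub>C\<^esub> \<epsilon> (y i)) = c"
      by (rule C.counit_right[OF c s])
    finally show ?thesis by (simp add: ext_comult_q)
  qed
  with assms show ?thesis
    by (rule_tac X_induct) (simp_all add: ext_add linear_maps_add[OF counit_right_linear])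
qed


section \<open>Coassociativity\<close>

text \<open>The left-hand side of coassociativity, \<open>x \<otimes> y \<mapsto> x \<otimes> \<Delta>(y)\<close>, as a linear map
  \<open>X \<otimes>\<^sub>B X \<rightarrow> X \<otimes>\<^sub>B (X \<otimes>\<^sub>B X)\<close>.\<close>

definition "id_comult = hom_tensor_lift R XXX (\<lambda>x y. pp x (ext_comult y))"

lemma id_comult:
  shows id_comult_linear: "id_comult \<in> linear_maps R XX XXX"
    and id_comult_p: "\<And>x y. \<lbrakk>x \<in> carrier X; y \<in> carrier X\<rbrakk> \<Longrightarrow> id_comult (p x y) = pp x (ext_comult y)"
proof -
  have "(\<lambda>x y. pp x (ext_comult y)) \<in> balanced_maps R B X X XXX"
  proof (intro balanced_mapsI bilinear_mapsI)
    fix x b y assume "x \<in> carrier X" "b \<in> carrier B" "y \<in> carrier X"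
    then show "pp (x \<triangleleft>\<^bsub>X\<^esub> b) (ext_comult (twist X y)) = pp (twist X x) (ext_comult (b \<triangleright>\<^bsub>X\<^esub> y))"
      by (simp add: ext_comult_lact ext_comult_twist XXX.hom_pure_balance)
  qed (simp_all add: ext_add linear_maps_smult[OF ext_comult_linear]
      XXX.tp_add_left XXX.tp_add_right XXX.tp_smult_left XXX.tp_smult_right)
  note lift = XX.hom_tensor_lift[OF XXX.MN.module_axioms this]
  show "id_comult \<in> linear_maps R XX XXX"
    unfolding id_comult_def by (rule lift(1))
  show "\<And>x y. \<lbrakk>x \<in> carrier X; y \<in> carrier X\<rbrakk> \<Longrightarrow> id_comult (p x y) = pp x (ext_comult y)"
    unfolding id_comult_def by (rule lift(2))
qed

text \<open>The associator \<open>(u \<otimes> v) \<otimes> y \<mapsto> \<xi>(u) \<otimes> (v \<otimes> \<xi>\<^bsup>-1\<^esup>(y))\<close> with its last argument fixed, where \<open>\<xi>\<close> is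
  the automorphism of \<open>X\<close>.\<close>

definition "reassoc y = hom_tensor_lift R XXX (\<lambda>u v. pp (twist X u) (p v (inv_twist X y)))"

lemma reassoc:
  assumes [simp]: "y \<in> carrier X"
  shows reassoc_linear: "reassoc y \<in> linear_maps R XX XXX"
    and reassoc_p: "\<And>u v. \<lbrakk>u \<in> carrier X; v \<in> carrier X\<rbrakk>
      \<Longrightarrow> reassoc y (p u v) = pp (twist X u) (p v (inv_twist X y))"
proof -
  have "(\<lambda>u v. pp (twist X u) (p v (inv_twist X y))) \<in> balanced_maps R B X X XXX"
  proof (intro balanced_mapsI bilinear_mapsI)
    fix u b v assume [simp]: "u \<in> carrier X" "b \<in> carrier B" "v \<in> carrier X"
    show "pp (twist X (u \<triangleleft>\<^bsub>X\<^esub> b)) (p (twist X v) (inv_twist X y))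
        = pp (twist X (twist X u)) (p (b \<triangleright>\<^bsub>X\<^esub> v) (inv_twist X y))"
      using XXX.hom_pure_balance[of "twist X u" "twist B b" "p v (inv_twist X (inv_twist X y))"]
      by (simp add: X.MN.twist_ract XX.twist_tp XX.lact_tp)
  qed (simp_all add: X.MN.twist_add X.MN.twist_smult XX.tp_add_left XX.tp_smult_left
      XXX.tp_add_left XXX.tp_add_right XXX.tp_smult_left XXX.tp_smult_right)
  note lift = XX.hom_tensor_lift[OF XXX.MN.module_axioms this]
  show "reassoc y \<in> linear_maps R XX XXX"
    unfolding reassoc_def by (rule lift(1))
  show "\<And>u v. \<lbrakk>u \<in> carrier X; v \<in> carrier X\<rbrakk> \<Longrightarrow> reassoc y (p u v) = pp (twist X u) (p v (inv_twist X y))"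
    unfolding reassoc_def by (rule lift(2))
qed

lemma reassoc_closed [simp]: "\<lbrakk>y \<in> carrier X; w \<in> carrier XX\<rbrakk> \<Longrightarrow> reassoc y w \<in> carrier XXX"
  by (rule linear_maps_closed[OF reassoc_linear])

lemma reassoc_linear_param:
  assumes "w \<in> carrier XX"
  shows "(\<lambda>y. reassoc y w) \<in> linear_maps R X XXX"
proof (rule XX.hom_tensor_linear_param[OF XXX.MN.module_axioms X.MN.module_axioms reassoc_linear _ assms])
  show "(\<lambda>y. reassoc y (p u v)) \<in> linear_maps R X XXX" if "u \<in> carrier X" "v \<in> carrier X" for u v
    using that by (intro linear_mapsI) (simp_all add: reassoc_p X.MN.inv_twist_add X.MN.inv_twist_smult
      XX.tp_add_right XX.tp_smult_right XXX.tp_add_right XXX.tp_smult_right)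
qed

lemma reassoc_balance:
  assumes [simp]: "y \<in> carrier X" "b \<in> carrier B" and w: "w \<in> carrier XX"
  shows "reassoc (twist X y) (w \<triangleleft>\<^bsub>XX\<^esub> b) = reassoc (b \<triangleright>\<^bsub>X\<^esub> y) (twist XX w)"
proof (rule XX.mn_induct[OF w])
  fix u v assume [simp]: "u \<in> carrier X" "v \<in> carrier X"
  show "reassoc (twist X y) (p u v \<triangleleft>\<^bsub>XX\<^esub> b) = reassoc (b \<triangleright>\<^bsub>X\<^esub> y) (twist XX (p u v))"
    using XX.hom_pure_balance[of v "inv_twist B b" "inv_twist X y"]
    by (simp add: XX.ract_tp XX.twist_tp reassoc_p X.MN.inv_twist_lact)
qed (simp add: XX_action_add linear_maps_add[OF reassoc_linear])

text \<open>The right-hand side of coassociativity: apply the comultiplication to the first factor, then the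
  associator. It is balanced because the associator is (\<open>reassoc_balance\<close>).\<close>

definition "comult_id = hom_tensor_lift R XXX (\<lambda>x y. reassoc y (ext_comult x))"

lemma comult_id:
  shows comult_id_linear: "comult_id \<in> linear_maps R XX XXX"
    and comult_id_p: "\<And>x y. \<lbrakk>x \<in> carrier X; y \<in> carrier X\<rbrakk>
      \<Longrightarrow> comult_id (p x y) = reassoc y (ext_comult x)"
proof -
  have "(\<lambda>x y. reassoc y (ext_comult x)) \<in> balanced_maps R B X X XXX"
  proof (rule balanced_mapsI)
    show "(\<lambda>x y. reassoc y (ext_comult x)) \<in> bilinear_maps R X X XXX"
      using linear_maps_comp[OF ext_comult_linear reassoc_linear] reassoc_linear_param[OF ext_comult_closed]
      by (simp add: bilinear_maps_def)
    fix x b y assume "x \<in> carrier X" "b \<in> carrier B" "y \<in> carrier X"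
    then show "reassoc (twist X y) (ext_comult (x \<triangleleft>\<^bsub>X\<^esub> b)) = reassoc (b \<triangleright>\<^bsub>X\<^esub> y) (ext_comult (twist X x))"
      by (simp add: ext_comult_ract ext_comult_twist reassoc_balance)
  qed
  note lift = XX.hom_tensor_lift[OF XXX.MN.module_axioms this]
  show "comult_id \<in> linear_maps R XX XXX"
    unfolding comult_id_def by (rule lift(1))
  show "\<And>x y. \<lbrakk>x \<in> carrier X; y \<in> carrier X\<rbrakk> \<Longrightarrow> comult_id (p x y) = reassoc y (ext_comult x)"
    unfolding comult_id_def by (rule lift(2))
qed

text \<open>The analogue of \<open>insert_units\<close> for three factors from \<open>C\<close>:
  \<open>c \<otimes> (d \<otimes> e)\<close> goes to \<open>q (\<beta>\<^bsup>-1\<^esup> b) c 1 \<otimes> (q 1 d 1 \<otimes> q 1 e (\<beta>\<^bsup>-2\<^esup> b'))\<close>.\<close>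

definition "insert_units3 b b' = hom_tensor_lift R XXX
  (\<lambda>c w. pp (q (inv_twist B b) c \<one>\<^bsub>B\<^esub>) (insert_units \<one>\<^bsub>B\<^esub> (inv_twist B b') w))"

lemma insert_units3:
  assumes [simp]: "b \<in> carrier B" "b' \<in> carrier B"
  shows insert_units3_linear: "insert_units3 b b' \<in> linear_maps R CCC XXX"
    and insert_units3_ccp: "\<And>c w. \<lbrakk>c \<in> carrier C; w \<in> carrier CC\<rbrakk>
      \<Longrightarrow> insert_units3 b b' (ccp c w) = pp (q (inv_twist B b) c \<one>\<^bsub>B\<^esub>) (insert_units \<one>\<^bsub>B\<^esub> (inv_twist B b') w)"
proof -
  have "(\<lambda>c w. pp (q (inv_twist B b) c \<one>\<^bsub>B\<^esub>) (insert_units \<one>\<^bsub>B\<^esub> (inv_twist B b') w)) \<in> balanced_maps R A C CC XXX"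
  proof (intro balanced_mapsI bilinear_mapsI)
    fix c a w assume [simp]: "c \<in> carrier C" "a \<in> carrier A" "w \<in> carrier CC"
    let ?x = "q (inv_twist B (inv_twist B b)) c \<one>\<^bsub>B\<^esub>"
      and ?y = "insert_units \<one>\<^bsub>B\<^esub> (inv_twist B (inv_twist B b')) w"
    have "pp (?x \<triangleleft>\<^bsub>X\<^esub> \<phi> (twist A (twist A a))) (twist XX ?y)
        = pp (twist X ?x) (\<phi> (twist A (twist A a)) \<triangleright>\<^bsub>XX\<^esub> ?y)"
      by (rule XXX.hom_pure_balance) simp_all
    moreover have "\<phi> (twist A (twist A a)) \<triangleright>\<^bsub>XX\<^esub> ?y = insert_units \<one>\<^bsub>B\<^esub> (inv_twist B b') (a \<triangleright>\<^bsub>CC\<^esub> w)"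
      using insert_units_balance_left[of "\<one>\<^bsub>B\<^esub>" "inv_twist B b'" a w] by (simp add: lact_insert_units unit_simps)
    ultimately show "pp (q (inv_twist B b) (c \<triangleleft>\<^bsub>C\<^esub> a) \<one>\<^bsub>B\<^esub>) (insert_units \<one>\<^bsub>B\<^esub> (inv_twist B b') (twist CC w))
        = pp (q (inv_twist B b) (twist C c) \<one>\<^bsub>B\<^esub>) (insert_units \<one>\<^bsub>B\<^esub> (inv_twist B b') (a \<triangleright>\<^bsub>CC\<^esub> w))"
      by (simp add: q_unit_ract twist_q twist_insert_units unit_simps)
  qed (simp_all add: q_add q_smult insert_units_add linear_maps_smult[OF insert_units_linear]
      XXX.tp_add_left XXX.tp_add_right XXX.tp_smult_left XXX.tp_smult_right)
  note lift = CCC.hom_tensor_lift[OF XXX.MN.module_axioms this]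
  show "insert_units3 b b' \<in> linear_maps R CCC XXX"
    unfolding insert_units3_def by (rule lift(1))
  show "\<And>c w. \<lbrakk>c \<in> carrier C; w \<in> carrier CC\<rbrakk>
      \<Longrightarrow> insert_units3 b b' (ccp c w) = pp (q (inv_twist B b) c \<one>\<^bsub>B\<^esub>) (insert_units \<one>\<^bsub>B\<^esub> (inv_twist B b') w)"
    unfolding insert_units3_def by (rule lift(2))
qed

lemma insert_units3_closed [simp]: "\<lbrakk>b \<in> carrier B; b' \<in> carrier B; w \<in> carrier CCC\<rbrakk> \<Longrightarrow> insert_units3 b b' w \<in> carrier XXX"
  by (rule linear_maps_closed[OF insert_units3_linear])

lemma id_comult_insert_units:
  assumes [simp]: "b \<in> carrier B" "b' \<in> carrier B" "c \<in> carrier C" "d \<in> carrier C"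
  shows "id_comult (insert_units b b' (cp c d)) = insert_units3 b b' (ccp c (\<Delta> d))"
  by (simp add: insert_units_cp id_comult_p ext_comult_q insert_units3_ccp)

lemma comult_id_insert_units:
  assumes [simp]: "b \<in> carrier B" "b' \<in> carrier B" "c \<in> carrier C" "d \<in> carrier C"
  shows "comult_id (insert_units b b' (cp c d))
    = reassoc (q \<one>\<^bsub>B\<^esub> d (inv_twist B b')) (insert_units (inv_twist B b) \<one>\<^bsub>B\<^esub> (\<Delta> c))"
  by (simp add: insert_units_cp comult_id_p ext_comult_q)

lemma reassoc_insert_units:
  assumes [simp]: "b \<in> carrier B" "b' \<in> carrier B" "u \<in> carrier C" "v \<in> carrier C" "d \<in> carrier C"
  shows "reassoc (q \<one>\<^bsub>B\<^esub> d (inv_twist B b')) (insert_units (inv_twist B b) \<one>\<^bsub>B\<^esub> (cp u v))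
    = insert_units3 b b' (ccp (twist C u) (cp v (inv_twist C d)))"
  by (simp add: insert_units_cp reassoc_p insert_units3_ccp twist_q inv_twist_q unit_simps)

text \<open>Both sides of the law for \<open>X\<close> are the image under \<open>insert_units3 b b'\<close> of the corresponding side
  of the law for \<open>C\<close>; the latter is applied to one chosen expression of \<open>\<Delta> c\<close> and of each
  \<open>\<Delta> (x i)\<close>.\<close>

lemma ext_coassoc_q:
  assumes [simp]: "b \<in> carrier B" "c \<in> carrier C" "b' \<in> carrier B"
  shows "id_comult (ext_comult (q b c b')) = comult_id (ext_comult (q b c b'))"
proof -
  obtain n x y where s: "sweedler R A C (\<Delta> c) n x y" using sweedler_C[OF comult_closed[OF assms(2)]] by blast
  note [simp] = sweedlerD(1,2)[OF s]
  have "\<forall>i. \<exists>k u v. i < n \<longrightarrow> sweedler R A C (\<Delta> (x i)) k u v"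
    using sweedler_C[OF comult_closed[OF sweedlerD(1)[OF s]]] by blast
  then obtain m u v where s': "\<And>i. i < n \<Longrightarrow> sweedler R A C (\<Delta> (x i)) (m i) (u i) (v i)"
    by metis
  note [simp] = sweedlerD(1,2)[OF s']
  let ?T = "insert_units3 b b'" and ?Y = "\<lambda>i. q \<one>\<^bsub>B\<^esub> (y i) (inv_twist B b')"
  note T_sum = linear_maps_finsum[OF CCC.MN.module_axioms XXX.MN.module_axioms insert_units3_linear]
  note lin = linear_maps_comp[OF insert_units_linear[of b b'] id_comult_linear]
    linear_maps_comp[OF insert_units_linear[of b b'] comult_id_linear]
  have "id_comult (insert_units b b' (\<Delta> c)) = (\<Oplus>\<^bsub>XXX\<^esub>i\<in>{..<n}. id_comult (insert_units b b' (cp (x i) (y i))))"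
    by (rule linear_sweedler_C[OF XXX.MN.module_axioms lin(1) s]) simp_all
  also have "\<dots> = (\<Oplus>\<^bsub>XXX\<^esub>i\<in>{..<n}. ?T (ccp (x i) (\<Delta> (y i))))"
    by (rule XXX.MN.finsum_cong') (auto simp: id_comult_insert_units)
  also have "\<dots> = ?T (\<Oplus>\<^bsub>CCC\<^esub>i\<in>{..<n}. ccp (x i) (\<Delta> (y i)))"
    by (rule T_sum[symmetric]) simp_all
  also have "(\<Oplus>\<^bsub>CCC\<^esub>i\<in>{..<n}. ccp (x i) (\<Delta> (y i)))
      = (\<Oplus>\<^bsub>CCC\<^esub>i\<in>{..<n}. \<Oplus>\<^bsub>CCC\<^esub>j\<in>{..<m i}. ccp (twist C (u i j)) (cp (v i j) (inv_twist C (y i))))"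
    by (rule C.hom_coassoc[OF assms(2) s s'])
  also have "?T \<dots> = (\<Oplus>\<^bsub>XXX\<^esub>i\<in>{..<n}. ?T (\<Oplus>\<^bsub>CCC\<^esub>j\<in>{..<m i}. ccp (twist C (u i j)) (cp (v i j) (inv_twist C (y i)))))"
    by (rule T_sum) (auto intro!: CCC.MN.finsum_closed)
  also have "\<dots> = (\<Oplus>\<^bsub>XXX\<^esub>i\<in>{..<n}. reassoc (?Y i) (insert_units (inv_twist B b) \<one>\<^bsub>B\<^esub> (\<Delta> (x i))))"
  proof (rule XXX.MN.finsum_cong'[OF refl])
    fix i assume "i \<in> {..<n}"
    then have i [simp]: "i < n" by simp
    have "?T (\<Oplus>\<^bsub>CCC\<^esub>j\<in>{..<m i}. ccp (twist C (u i j)) (cp (v i j) (inv_twist C (y i))))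
        = (\<Oplus>\<^bsub>XXX\<^esub>j\<in>{..<m i}. ?T (ccp (twist C (u i j)) (cp (v i j) (inv_twist C (y i)))))"
      by (rule T_sum) simp_all
    also have "\<dots> = (\<Oplus>\<^bsub>XXX\<^esub>j\<in>{..<m i}. reassoc (?Y i) (insert_units (inv_twist B b) \<one>\<^bsub>B\<^esub> (cp (u i j) (v i j))))"
      by (rule XXX.MN.finsum_cong') (auto simp: reassoc_insert_units)
    also have "\<dots> = reassoc (?Y i) (insert_units (inv_twist B b) \<one>\<^bsub>B\<^esub> (\<Delta> (x i)))"
      by (rule linear_sweedler_C[OF XXX.MN.module_axioms
            linear_maps_comp[OF insert_units_linear reassoc_linear] s'[OF i], symmetric]) simp_all
    finally show "?T (\<Oplus>\<^bsub>CCC\<^esub>j\<in>{..<m i}. ccp (twist C (u i j)) (cp (v i j) (inv_twist C (y i))))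
        = reassoc (?Y i) (insert_units (inv_twist B b) \<one>\<^bsub>B\<^esub> (\<Delta> (x i)))" .
  qed auto
  also have "\<dots> = (\<Oplus>\<^bsub>XXX\<^esub>i\<in>{..<n}. comult_id (insert_units b b' (cp (x i) (y i))))"
    by (rule XXX.MN.finsum_cong')
      (auto simp: comult_id_insert_units intro!: linear_maps_closed[OF comult_id_linear])
  also have "\<dots> = comult_id (insert_units b b' (\<Delta> c))"
    by (rule linear_sweedler_C[OF XXX.MN.module_axioms lin(2) s, symmetric]) simp_all
  finally show ?thesis by (simp add: ext_comult_q)
qed

lemma ext_coassoc:
  assumes "z \<in> carrier X"
  shows "id_comult (ext_comult z) = comult_id (ext_comult z)"
  using assms
  by (rule X_induct) (simp_all add: ext_coassoc_q ext_add
      linear_maps_add[OF id_comult_linear] linear_maps_add[OF comult_id_linear])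


section \<open>The base ring extension is a Hom-coring\<close>

text \<open>For each axiom in Sweedler form, both sides are rewritten as values of linear maps at the
  comultiplication of \<open>z\<close>.\<close>

lemma base_extension_coring: "hom_coring R B X ext_comult ext_counit"
proof (intro hom_coring.intro hom_coring_axioms.intro)
  show "hom_bimodule R B B X" by (rule X.hom_tensor_bimodule)
  show "ext_comult \<in> bimodule_maps R B B X XX"
    by (simp add: bimodule_maps_def hom_morphisms_def ext_comult_linear ext_comult_twist
        ext_comult_lact ext_comult_ract)
  show "ext_counit \<in> bimodule_maps R B B X (bimodule_along id id B)"
    using ext_counit_linear
    by (simp add: bimodule_maps_def hom_morphisms_def linear_maps_iff ext_counit_twist
        ext_counit_lact ext_counit_ract)
next
  fix z n x y m u v
  assume z: "z \<in> carrier X" and s: "sweedler R B X (ext_comult z) n x y"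
    and s': "\<And>i. i < n \<Longrightarrow> sweedler R B X (ext_comult (x i)) (m i) (u i) (v i)"
  note [simp] = s[unfolded sweedler_def, THEN conjunct1, rule_format, THEN conjunct1]
    s[unfolded sweedler_def, THEN conjunct1, rule_format, THEN conjunct2]
    s'[unfolded sweedler_def, THEN conjunct1, rule_format, THEN conjunct1]
    s'[unfolded sweedler_def, THEN conjunct1, rule_format, THEN conjunct2]
  have "(\<Oplus>\<^bsub>XXX\<^esub>i\<in>{..<n}. pp (x i) (ext_comult (y i))) = (\<Oplus>\<^bsub>XXX\<^esub>i\<in>{..<n}. id_comult (p (x i) (y i)))"
    by (rule XXX.MN.finsum_cong') (auto simp: id_comult_p)
  also have "\<dots> = id_comult (ext_comult z)"
    by (rule linear_sweedler_X[OF XXX.MN.module_axioms id_comult_linear s, symmetric])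
  also have "\<dots> = comult_id (ext_comult z)" by (rule ext_coassoc[OF z])
  also have "\<dots> = (\<Oplus>\<^bsub>XXX\<^esub>i\<in>{..<n}. comult_id (p (x i) (y i)))"
    by (rule linear_sweedler_X[OF XXX.MN.module_axioms comult_id_linear s])
  also have "\<dots> = (\<Oplus>\<^bsub>XXX\<^esub>i\<in>{..<n}. \<Oplus>\<^bsub>XXX\<^esub>j\<in>{..<m i}. pp (twist X (u i j)) (p (v i j) (inv_twist X (y i))))"
  proof (rule XXX.MN.finsum_cong'[OF refl])
    fix i assume "i \<in> {..<n}"
    then have i [simp]: "i < n" by simp
    have "comult_id (p (x i) (y i)) = reassoc (y i) (ext_comult (x i))"
      by (simp add: comult_id_p)
    also have "\<dots> = (\<Oplus>\<^bsub>XXX\<^esub>j\<in>{..<m i}. reassoc (y i) (p (u i j) (v i j)))"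
      by (rule linear_sweedler_X[OF XXX.MN.module_axioms reassoc_linear s'[OF i]]) simp
    also have "\<dots> = (\<Oplus>\<^bsub>XXX\<^esub>j\<in>{..<m i}. pp (twist X (u i j)) (p (v i j) (inv_twist X (y i))))"
      by (rule XXX.MN.finsum_cong') (auto simp: reassoc_p)
    finally show "comult_id (p (x i) (y i))
        = (\<Oplus>\<^bsub>XXX\<^esub>j\<in>{..<m i}. pp (twist X (u i j)) (p (v i j) (inv_twist X (y i))))" .
  qed (auto intro!: XXX.MN.finsum_closed)
  finally show "(\<Oplus>\<^bsub>XXX\<^esub>i\<in>{..<n}. pp (x i) (ext_comult (y i)))
      = (\<Oplus>\<^bsub>XXX\<^esub>i\<in>{..<n}. \<Oplus>\<^bsub>XXX\<^esub>j\<in>{..<m i}. pp (twist X (u i j)) (p (v i j) (inv_twist X (y i))))" .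
next
  fix z n x y
  assume z: "z \<in> carrier X" and s: "sweedler R B X (ext_comult z) n x y"
  note [simp] = s[unfolded sweedler_def, THEN conjunct1, rule_format, THEN conjunct1]
    s[unfolded sweedler_def, THEN conjunct1, rule_format, THEN conjunct2]
  have "(\<Oplus>\<^bsub>X\<^esub>i\<in>{..<n}. ext_counit (x i) \<triangleright>\<^bsub>X\<^esub> y i)
      = (\<Oplus>\<^bsub>X\<^esub>i\<in>{..<n}. hom_tensor_lift R X (\<lambda>x y. ext_counit x \<triangleright>\<^bsub>X\<^esub> y) (p (x i) (y i)))"
    by (rule X.MN.finsum_cong') (auto simp: counit_left_p)
  also have "\<dots> = z"
    using linear_sweedler_X[OF X.MN.module_axioms counit_left_linear s] ext_counit_left[OF z] by simp
  finally show "(\<Oplus>\<^bsub>X\<^esub>i\<in>{..<n}. ext_counit (x i) \<triangleright>\<^bsub>X\<^esub> y i) = z" .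
  have "(\<Oplus>\<^bsub>X\<^esub>i\<in>{..<n}. x i \<triangleleft>\<^bsub>X\<^esub> ext_counit (y i))
      = (\<Oplus>\<^bsub>X\<^esub>i\<in>{..<n}. hom_tensor_lift R X (\<lambda>x y. x \<triangleleft>\<^bsub>X\<^esub> ext_counit y) (p (x i) (y i)))"
    by (rule X.MN.finsum_cong') (auto simp: counit_right_p)
  also have "\<dots> = z"
    using linear_sweedler_X[OF X.MN.module_axioms counit_right_linear s] ext_counit_right[OF z] by simp
  finally show "(\<Oplus>\<^bsub>X\<^esub>i\<in>{..<n}. x i \<triangleleft>\<^bsub>X\<^esub> ext_counit (y i)) = z" .
  have "ext_comult (twist X z) = twist XX (ext_comult z)" by (rule ext_comult_twist[OF z])
  also have "\<dots> = (\<Oplus>\<^bsub>XX\<^esub>i\<in>{..<n}. twist XX (p (x i) (y i)))"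
    by (rule linear_sweedler_X[OF XX.MN.module_axioms XX.MN.twist_linear s])
  also have "\<dots> = (\<Oplus>\<^bsub>XX\<^esub>i\<in>{..<n}. p (twist X (x i)) (twist X (y i)))"
    by (rule XX.MN.finsum_cong') (auto simp: XX.twist_tp)
  finally show "ext_comult (twist X z) = (\<Oplus>\<^bsub>XX\<^esub>i\<in>{..<n}. p (twist X (x i)) (twist X (y i)))" .
qed (rule ext_counit_twist)

lemma ext_comult_sweedler:
  assumes [simp]: "b \<in> carrier B" "c \<in> carrier C" "b' \<in> carrier B" and s: "sweedler R A C (\<Delta> c) n x y"
  shows "ext_comult (q b c b')
    = (\<Oplus>\<^bsub>XX\<^esub>i\<in>{..<n}. p (q (inv_twist B b) (x i) \<one>\<^bsub>B\<^esub>) (q \<one>\<^bsub>B\<^esub> (y i) (inv_twist B b')))"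
proof -
  note [simp] = sweedlerD(1,2)[OF s]
  have "ext_comult (q b c b') = insert_units b b' (\<Delta> c)" by (simp add: ext_comult_q)
  also have "\<dots> = (\<Oplus>\<^bsub>XX\<^esub>i\<in>{..<n}. insert_units b b' (cp (x i) (y i)))"
    by (rule linear_sweedler_C[OF XX.MN.module_axioms insert_units_linear s]) simp_all
  also have "\<dots> = (\<Oplus>\<^bsub>XX\<^esub>i\<in>{..<n}. p (q (inv_twist B b) (x i) \<one>\<^bsub>B\<^esub>) (q \<one>\<^bsub>B\<^esub> (y i) (inv_twist B b')))"
    by (rule XX.MN.finsum_cong') (auto simp: insert_units_cp)
  finally show ?thesis .
qed

lemma base_ext_eq: "base_ext R A B \<phi> C = X"
  by (simp only: base_ext_def base_ext_left_def Bl_def Br_def)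

end

theorem theorem3p2:
  fixes R :: "'k ring" and A :: "('k, 'a) hom_mod" and B :: "('k, 'b) hom_mod"
    and \<phi> :: "'a \<Rightarrow> 'b" and C :: "('k, 'c, 'a, 'a) hom_bimod"
    and \<Delta> :: "'c \<Rightarrow> ('c \<times> 'c \<Rightarrow> 'k) set set" and \<epsilon> :: "'c \<Rightarrow> 'a"
  assumes "cring R"
    and "hom_algebra R A" and "hom_algebra R B"
    and "\<phi> \<in> hom_algebra_morphisms R A B"
    and "hom_coring R A C \<Delta> \<epsilon>"
  shows "\<exists>\<Delta>' \<epsilon>'.
    hom_coring R B (base_ext R A B \<phi> C) \<Delta>' \<epsilon>' \<and>
    (\<forall>b \<in> carrier B. \<forall>c \<in> carrier C. \<forall>b' \<in> carrier B. \<forall>n x y.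
      sweedler R A C (\<Delta> c) n x y \<longrightarrow>
      \<Delta>' (base_ext_pure R A B \<phi> C b c b') =
      (\<Oplus>\<^bsub>hom_tensor R B B B (base_ext R A B \<phi> C) (base_ext R A B \<phi> C)\<^esub>i\<in>{..<n}.
        hom_pure R B (base_ext R A B \<phi> C) (base_ext R A B \<phi> C)
          (base_ext_pure R A B \<phi> C (inv_twist B b) (x i) \<one>\<^bsub>B\<^esub>)
          (base_ext_pure R A B \<phi> C \<one>\<^bsub>B\<^esub> (y i) (inv_twist B b')))) \<and>
    (\<forall>b \<in> carrier B. \<forall>c \<in> carrier C. \<forall>b' \<in> carrier B.
      \<epsilon>' (base_ext_pure R A B \<phi> C b c b') = (b \<otimes>\<^bsub>B\<^esub> \<phi> (\<epsilon> c)) \<otimes>\<^bsub>B\<^esub> b')"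
proof -
  interpret base_extension R A B \<phi> C \<Delta> \<epsilon>
    using assms by (intro base_extension.intro base_extension_axioms.intro)
  show ?thesis
    unfolding base_ext_eq
    using base_extension_coring ext_comult_sweedler ext_counit_q by blast
qed

end
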